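(* For each even integer $N\ge2$ let $\{\varphi_{N,j}\}_{j=1}^{N}$ be an orthonormal basis of $\mathcal{H}_N$ consisting of eigenvectors of the quantum baker's map $\hat B_N$. Then for each even $N$ there exists a subset $J_N\subset\{1,\ldots,N\}$, with $\frac{\#J_N}{N}\to1$ as $N\to\infty$ (along even integers), such that for any $a\in C^\infty(\mathbb{T}^2)$ and any sequence $(j_N)_{N\in2\mathbb{N}}$ with $j_N\in J_N$, $$\lim_{N\to\infty}\langle\varphi_{N,j_N},\mathrm{Op}^{\mathrm W}_N(a)\varphi_{N,j_N}\rangle=\int_{\mathbb{T}^2}a(\mathbf{x})\,d\mathbf{x}.$$
   Context: $\mathbb{T}^2=\mathbb{R}^2/\mathbb{Z}^2$, with points $\mathbf{x}=(q,p)$. For an integer $N\ge1$ (inverse Planck constant, $\hbar=(2\pi N)^{-1}$), $\mathcal{H}_N$ is an $N$-dimensional complex Hilbert space identified with $\mathbb{C}^N$ through an orthonormal "position" basis $\{\mathbf{q}_j\}_{j=0}^{N-1}$ (indices understood mod $N$); the inner product is antilinear in the first argument. Discrete Fourier transform: $\hat F_N$ is the unitary $N\times N$ matrix $(\hat F_N)_{kj}=N^{-1/2}e^{-2\pi i kj/N}$, $0\le k,j\le N-1$. Quantum baker's map: for $N$ even, in the basis $\{\mathbf{q}_j\}$, $$\hat B_N:=\hat F_N^{-1}\begin{pmatrix}\hat F_{N/2}&0\\0&\hat F_{N/2}\end{pmatrix},$$ a unitary matrix. Weyl quantisation: for $\mathbf{k}=(k_1,k_2)\in\mathbb{Z}^2$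 let $T(\mathbf{k})$ be the unitary operator on $\mathcal{H}_N$ with $T(\mathbf{k})\mathbf{q}_j=e^{i\pi k_1k_2/N}e^{2\pi i k_2 j/N}\,\mathbf{q}_{j+k_1}$. For $f\in C^\infty(\mathbb{T}^2)$ with Fourier expansion $f(q,p)=\sum_{\mathbf{k}\in\mathbb{Z}^2}\tilde f(\mathbf{k})e^{2\pi i(qk_2-pk_1)}$, set $\mathrm{Op}^{\mathrm W}_N(f):=\sum_{\mathbf{k}\in\mathbb{Z}^2}\tilde f(\mathbf{k})\,T(\mathbf{k})$. *)

theory Defs
  imports
    "HOL-Analysis.Analysis"
    "Jordan_Normal_Form.VS_Connect"
    "Jordan_Normal_Form.Char_Poly"
    "Jordan_Normal_Form.Gauss_Jordan_Elimination"
begin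

text \<open>The Hilbert space of dimension \<open>N\<close> is \<open>carrier_vec N\<close>, with position basis
  \<open>unit_vec N j\<close>, \<open>0 \<le> j < N\<close>. Its inner product, antilinear in the first argument, is the
  library's \<open>\<bullet>c\<close> (antilinear in the second) with the arguments exchanged.\<close>

abbreviation qinner :: "complex vec \<Rightarrow> complex vec \<Rightarrow> complex" where
  "qinner u v \<equiv> v \<bullet>c u"

definition orthonormal_basis :: "nat \<Rightarrow> (nat \<Rightarrow> complex vec) \<Rightarrow> bool" where
  "orthonormal_basis N e \<longleftrightarrow>
     vectorspace.basis class_ring (module_vec TYPE(complex) N) (e ` {1..N}) \<and>
     (\<forall>i\<in>{1..N}. \<forall>j\<in>{1..N}. qinner (e i) (e j) = (if i = j then 1 else 0))"

definition dft :: "nat \<Rightarrow> complex mat" where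
  "dft N = Matrix.mat N N (\<lambda>(k, j).
     complex_of_real (1 / sqrt (real N)) * cis (- 2 * pi * real k * real j / real N))"

text \<open>Used for even \<open>N \<ge> 2\<close> only; the matrices \<open>dft N\<close> are then invertible, so that
  \<open>mat_inverse\<close> does not return \<open>None\<close>.\<close>

definition baker :: "nat \<Rightarrow> complex mat" where
  "baker N = the (mat_inverse (dft N)) *
     four_block_mat (dft (N div 2)) (0\<^sub>m (N div 2) (N div 2))
                    (0\<^sub>m (N div 2) (N div 2)) (dft (N div 2))"

text \<open>Column \<open>j\<close> of the matrix of \<open>T(k)\<close> is a phase times the position state with index
  \<open>j + k\<^sub>1\<close> reduced mod \<open>N\<close>.\<close>

definition translation :: "nat \<Rightarrow> int \<times> int \<Rightarrow> complex mat" where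
  "translation N = (\<lambda>(k1, k2). Matrix.mat N N (\<lambda>(i, j).
     if int i = (int j + k1) mod int N
     then cis (pi * of_int k1 * of_int k2 / real N) * cis (2 * pi * of_int k2 * real j / real N)
     else 0))"

text \<open>Functions on the torus are \<open>\<int>\<^sup>2\<close>-periodic functions of \<open>(q, p) \<in> \<real>\<^sup>2\<close>; integrals over the
  torus are integrals over the unit square.\<close>

definition torus_periodic :: "(real \<times> real \<Rightarrow> complex) \<Rightarrow> bool" where
  "torus_periodic f \<longleftrightarrow> (\<forall>q p. f (q + 1, p) = f (q, p) \<and> f (q, p + 1) = f (q, p))"

primrec C_k :: "nat \<Rightarrow> (real \<times> real \<Rightarrow> complex) \<Rightarrow> bool" where
  "C_k 0 f \<longleftrightarrow> continuous_on UNIV f"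
| "C_k (Suc k) f \<longleftrightarrow> continuous_on UNIV f \<and>
     (\<exists>fq fp.
        (\<forall>q p. ((\<lambda>t. f (t, p)) has_vector_derivative fq (q, p)) (at q) \<and>
               ((\<lambda>t. f (q, t)) has_vector_derivative fp (q, p)) (at p)) \<and>
        C_k k fq \<and> C_k k fp)"

definition smooth_torus :: "(real \<times> real \<Rightarrow> complex) \<Rightarrow> bool" where
  "smooth_torus f \<longleftrightarrow> torus_periodic f \<and> (\<forall>k. C_k k f)"

definition torus_integral :: "(real \<times> real \<Rightarrow> complex) \<Rightarrow> complex" where
  "torus_integral f = integral (cbox (0, 0) (1, 1)) f"

text \<open>The coefficient of \<open>exp (2 \<pi> i (q k\<^sub>2 - p k\<^sub>1))\<close> in the Fourier expansion of \<open>f\<close>.\<close>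

definition fourier_coeff :: "(real \<times> real \<Rightarrow> complex) \<Rightarrow> int \<times> int \<Rightarrow> complex" where
  "fourier_coeff f = (\<lambda>(k1, k2).
     torus_integral (\<lambda>(q, p). f (q, p) * cis (- 2 * pi * (q * of_int k2 - p * of_int k1))))"

text \<open>The operator series is summed entrywise, which in finite dimension is the same as
  convergence in norm; for smooth \<open>f\<close> it converges absolutely.\<close>

definition weyl_op :: "nat \<Rightarrow> (real \<times> real \<Rightarrow> complex) \<Rightarrow> complex mat" where
  "weyl_op N f = Matrix.mat N N (\<lambda>(i, j).
     infsum (\<lambda>k. fourier_coeff f k * translation N k $$ (i, j)) UNIV)"

definition even_at_top :: "nat filter" where
  "even_at_top = inf at_top (principal {N. even N})"

end

theory Submission
  imports Defs
begin

text \<open>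
  All estimates are made in the Hilbert-Schmidt norm normalised by the dimension, in which an
  operator of bounded rank and norm is negligible. Up to such an error the direct sum of two cyclic
  shifts of size \<open>N/2\<close> is the cyclic shift of size \<open>N\<close>; since the baker's map is built from
  Fourier matrices of these two sizes, conjugation by it sends \<open>f(q)\<close> to \<open>f(2q)\<close>, and a function
  of the momentum that is constant on dyadic intervals of length \<open>2\<^sup>-\<^sup>m\<close> becomes, after \<open>m\<close> steps,
  a function of the position. Hence \<open>T(k)\<close> has the same diagonal matrix elements in an eigenbasis
  as an operator close to a function \<open>f(q)\<close> with the same trace. Approximating \<open>f\<close> by a
  trigonometric polynomial reduces the quantum variance of \<open>T(k)\<close> to that of \<open>exp(2 \<pi> i l q)\<close>, where
  averaging along the orbit \<open>l, 2l, 4l, \<dots>\<close> of pairwise orthogonal modes makes it vanish in the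
  limit. Chebyshev's inequality for a weighted sum of the variances over all \<open>k\<close> yields one
  index set of density one for all observables.
\<close>


section \<open>Matrices and the normalised Hilbert-Schmidt norm\<close>

text \<open>The classical map is (q, p) -> (2q mod 1, (p + floor(2q)) / 2): position doubles by
  itself, while momentum takes up one binary digit of q per step. After m steps the first m digits
  of the momentum are functions of q alone; this is why momentum phases are frozen on dyadic
  intervals before evolving, with m fixed before the dimension grows. The obstacle is that these
  digits are discontinuous functions, without uniform approximation by trigonometric polynomials.
  They are therefore approximated in mean square on the grid j/N, where bounded functions with
  finitely many possible jumps cause no trouble. The price is that the normalised Hilbert-Schmidt
  norm is not submultiplicative uniformly in N, so in a product one factor is kept bounded as an
  operator and the limit of the other is kept bounded as a function. Deviations are measured from
  the exact normalised trace, which the evolution preserves; hence no intermediate limit function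
  has to be integrated.\<close>

definition echar :: "int \<Rightarrow> real \<Rightarrow> complex" where
  "echar k x = cis (2 * pi * of_int k * x)"

definition mat_adj :: "complex mat \<Rightarrow> complex mat" where
  "mat_adj A = Matrix.mat (dim_col A) (dim_row A) (\<lambda>(i, j). cnj (A $$ (j, i)))"

definition unitary :: "nat \<Rightarrow> complex mat \<Rightarrow> bool" where
  "unitary N W \<longleftrightarrow> W \<in> carrier_mat N N \<and> W * mat_adj W = 1\<^sub>m N \<and> mat_adj W * W = 1\<^sub>m N"

text \<open>With this normalisation the identity has norm 1 in every dimension \<open>N > 0\<close>.
  For \<open>N = 0\<close> the quotient is 0, which spares the statements below a positivity
  hypothesis.\<close>

definition hs_norm :: "nat \<Rightarrow> complex mat \<Rightarrow> real" where
  "hs_norm N A = L2_set (\<lambda>(i, j). cmod (A $$ (i, j))) ({..<N} \<times> {..<N}) / sqrt N"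

definition ntrace :: "nat \<Rightarrow> complex mat \<Rightarrow> complex" where
  "ntrace N A = (\<Sum>i<N. A $$ (i, i)) / of_nat N"

lemma mat_adj_carrier [simp]: "A \<in> carrier_mat m n \<Longrightarrow> mat_adj A \<in> carrier_mat n m"
  by (auto simp: mat_adj_def)

lemma mat_adj_dim [simp]: "dim_row (mat_adj A) = dim_col A" "dim_col (mat_adj A) = dim_row A"
  by (auto simp: mat_adj_def)

lemma mat_adj_index [simp]: "i < dim_col A \<Longrightarrow> j < dim_row A \<Longrightarrow> mat_adj A $$ (i, j) = cnj (A $$ (j, i))"
  by (auto simp: mat_adj_def)

lemma mat_adj_mat_adj [simp]: "mat_adj (mat_adj A) = A"
  by (rule eq_matI) auto

lemma index_mult_mat_sum:
  assumes "A \<in> carrier_mat n m" "B \<in> carrier_mat m l" "i < n" "j < l"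
  shows "(A * B) $$ (i, j) = (\<Sum>k<m. A $$ (i, k) * B $$ (k, j))"
  using assms by (simp add: scalar_prod_def atLeast0LessThan)

lemma mat_adj_mult: "A \<in> carrier_mat n m \<Longrightarrow> B \<in> carrier_mat m l \<Longrightarrow> mat_adj (A * B) = mat_adj B * mat_adj A"
  by (rule eq_matI) (auto simp: index_mult_mat_sum[of _ n m _ l] index_mult_mat_sum[of _ l m _ n] mult.commute simp del: index_mult_mat(1))

lemma sq_mult [simp]:
  "A \<in> carrier_mat N N \<Longrightarrow> B \<in> carrier_mat N N \<Longrightarrow> A * B \<in> carrier_mat N N"
  by (rule mult_carrier_mat)

lemma unitary_carrier: "unitary N W \<Longrightarrow> W \<in> carrier_mat N N"
  by (simp add: unitary_def)

lemma unitary_mat_adj: "unitary N W \<Longrightarrow> unitary N (mat_adj W)"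
  by (auto simp: unitary_def)

lemma unitary_mult:
  assumes "unitary N A" "unitary N B" shows "unitary N (A * B)"
proof -
  have c: "A \<in> carrier_mat N N" "B \<in> carrier_mat N N"
    using assms by (auto simp: unitary_def)
  have c': "mat_adj A \<in> carrier_mat N N" "mat_adj B \<in> carrier_mat N N" using c by auto
  have "A * B * (mat_adj B * mat_adj A) = A * (B * mat_adj B) * mat_adj A"
    using c c' by (simp add: assoc_mult_mat[of _ N N _ N _ N] sq_mult[of _ N])
  moreover have "mat_adj B * mat_adj A * (A * B) = mat_adj B * (mat_adj A * A) * B"
    using c c' by (simp add: assoc_mult_mat[of _ N N _ N _ N] sq_mult[of _ N])
  ultimately show ?thesis using assms c c'
    by (simp add: unitary_def mat_adj_mult[OF c])
qed

lemma hs_norm_nonneg [simp]: "0 \<le> hs_norm N A"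
  by (simp add: hs_norm_def)

lemma hs_norm_power2: "(hs_norm N A)\<^sup>2 * N = (\<Sum>i<N. \<Sum>j<N. (cmod (A $$ (i, j)))\<^sup>2)"
proof (cases "N = 0")
  case False
  then show ?thesis
    by (simp add: hs_norm_def power_divide L2_set_def sum_nonneg sum.cartesian_product case_prod_unfold)
qed simp

lemma hs_norm_eqI:
  assumes "(\<Sum>i<N. \<Sum>j<N. (cmod (A $$ (i, j)))\<^sup>2) = (\<Sum>i<N. \<Sum>j<N. (cmod (B $$ (i, j)))\<^sup>2)"
  shows "hs_norm N A = hs_norm N B"
proof (cases "N = 0")
  case True then show ?thesis by (simp add: hs_norm_def)
next
  case False
  with hs_norm_power2[of N A] hs_norm_power2[of N B] assms have "(hs_norm N A)\<^sup>2 * N = (hs_norm N B)\<^sup>2 * N" by simp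
  with False have "(hs_norm N A)\<^sup>2 = (hs_norm N B)\<^sup>2" by simp
  then show ?thesis using power2_eq_imp_eq hs_norm_nonneg by blast
qed

lemma hs_norm_leI:
  fixes B :: real
  assumes "(\<Sum>i<N. \<Sum>j<N. (cmod (A $$ (i, j)))\<^sup>2) \<le> B\<^sup>2 * N" "B \<ge> 0"
  shows "hs_norm N A \<le> B"
proof (cases "N = 0")
  case True then show ?thesis using assms by (simp add: hs_norm_def)
next
  case False
  from hs_norm_power2[of N A] assms have "(hs_norm N A)\<^sup>2 * N \<le> B\<^sup>2 * N" by simp
  with False have "(hs_norm N A)\<^sup>2 \<le> B\<^sup>2" by simp
  then show ?thesis using assms power2_le_imp_le by blast
qed

lemma hs_norm_triangle:
  assumes "A \<in> carrier_mat N N" "B \<in> carrier_mat N N"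
  shows "hs_norm N (A + B) \<le> hs_norm N A + hs_norm N B"
proof -
  have "L2_set (\<lambda>(i, j). cmod ((A + B) $$ (i, j))) ({..<N} \<times> {..<N})
     \<le> L2_set (\<lambda>x. (\<lambda>(i, j). cmod (A $$ (i, j))) x + (\<lambda>(i, j). cmod (B $$ (i, j))) x) ({..<N} \<times> {..<N})"
    using assms by (intro L2_set_mono) (auto simp: norm_triangle_ineq)
  also have "\<dots> \<le> L2_set (\<lambda>(i, j). cmod (A $$ (i, j))) ({..<N} \<times> {..<N}) +
      L2_set (\<lambda>(i, j). cmod (B $$ (i, j))) ({..<N} \<times> {..<N})"
    by (rule L2_set_triangle_ineq)
  finally show ?thesis by (simp add: hs_norm_def add_divide_distrib[symmetric] divide_right_mono)
qed

lemma hs_norm_smult: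
  assumes "A \<in> carrier_mat N N"
  shows "hs_norm N (c \<cdot>\<^sub>m A) = cmod c * hs_norm N A"
proof -
  have "L2_set (\<lambda>(i, j). cmod ((c \<cdot>\<^sub>m A) $$ (i, j))) ({..<N} \<times> {..<N})
     = L2_set (\<lambda>x. cmod c * (\<lambda>(i, j). cmod (A $$ (i, j))) x) ({..<N} \<times> {..<N})"
    using assms by (intro L2_set_cong) (auto simp: norm_mult)
  also have "\<dots> = cmod c * L2_set (\<lambda>(i, j). cmod (A $$ (i, j))) ({..<N} \<times> {..<N})"
    by (rule L2_set_right_distrib[symmetric]) simp
  finally show ?thesis by (simp add: hs_norm_def)
qed

lemma hs_norm_diff_triangle:
  assumes "A \<in> carrier_mat N N" "B \<in> carrier_mat N N" "C \<in> carrier_mat N N"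
  shows "hs_norm N (A - C) \<le> hs_norm N (A - B) + hs_norm N (B - C)"
proof -
  have "A - C = (A - B) + (B - C)" by (rule eq_matI) (use assms in auto)
  then show ?thesis using hs_norm_triangle[of "A - B" N "B - C"] assms by (metis minus_carrier_mat)
qed

lemma hs_norm_sym:
  assumes "A \<in> carrier_mat N N" "B \<in> carrier_mat N N"
  shows "hs_norm N (A - B) = hs_norm N (B - A)"
  by (rule hs_norm_eqI) (use assms in \<open>simp add: norm_minus_commute\<close>)

lemma hs_norm_mat_adj: "A \<in> carrier_mat N N \<Longrightarrow> hs_norm N (mat_adj A) = hs_norm N A"
  by (rule hs_norm_eqI) (simp, rule sum.swap)

lemma hs_norm_transpose: "A \<in> carrier_mat N N \<Longrightarrow> hs_norm N (transpose_mat A) = hs_norm N A"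
  by (rule hs_norm_eqI) (simp, rule sum.swap)

lemma ntrace_comm:
  assumes "A \<in> carrier_mat N N" "B \<in> carrier_mat N N"
  shows "ntrace N (A * B) = ntrace N (B * A)"
proof -
  have "(\<Sum>i<N. (A * B) $$ (i, i)) = (\<Sum>i<N. \<Sum>k<N. A $$ (i, k) * B $$ (k, i))"
    using assms by (intro sum.cong) (auto simp: index_mult_mat_sum[of _ N N _ N] simp del: index_mult_mat(1))
  also have "\<dots> = (\<Sum>k<N. \<Sum>i<N. B $$ (k, i) * A $$ (i, k))"
    by (subst sum.swap) (simp add: mult.commute)
  also have "\<dots> = (\<Sum>i<N. (B * A) $$ (i, i))"
    using assms by (intro sum.cong) (auto simp: index_mult_mat_sum[of _ N N _ N] simp del: index_mult_mat(1))
  finally show ?thesis by (simp add: ntrace_def)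
qed

text \<open>Writing the norm through \<open>mat_adj A * A\<close> reduces its unitary invariance to
  cancelling \<open>mat_adj W * W\<close>.\<close>

lemma hs_norm_ntrace: 
  assumes "A \<in> carrier_mat N N"
  shows "ntrace N (mat_adj A * A) = of_real ((hs_norm N A)\<^sup>2)"
proof (cases "N = 0")
  case True then show ?thesis by (simp add: ntrace_def hs_norm_def)
next
  case False
  have "(\<Sum>i<N. (mat_adj A * A) $$ (i, i)) = (\<Sum>i<N. \<Sum>k<N. of_real ((cmod (A $$ (k, i)))\<^sup>2))"
    using assms by (intro sum.cong) (auto simp: index_mult_mat_sum[of _ N N _ N] complex_norm_square[symmetric] mult.commute[of "cnj _"] simp del: index_mult_mat(1) of_real_power)
  also have "\<dots> = of_real ((hs_norm N A)\<^sup>2 * N)"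
    unfolding hs_norm_power2 of_real_sum by (rule sum.swap)
  finally show ?thesis using False by (simp add: ntrace_def)
qed

lemma hs_norm_unitary_left:
  assumes W: "unitary N W" and A: "A \<in> carrier_mat N N"
  shows "hs_norm N (W * A) = hs_norm N A"
proof -
  have c: "W \<in> carrier_mat N N" "mat_adj W \<in> carrier_mat N N" "mat_adj A \<in> carrier_mat N N"
    using W A by (auto simp: unitary_def)
  have "mat_adj (W * A) * (W * A) = mat_adj A * (mat_adj W * W) * A"
    using c A by (simp add: mat_adj_mult[of _ N N _ N] assoc_mult_mat[of _ N N _ N _ N] sq_mult[of _ N])
  also have "\<dots> = mat_adj A * A" using W c A by (simp add: unitary_def)
  finally have "complex_of_real ((hs_norm N (W * A))\<^sup>2) = of_real ((hs_norm N A)\<^sup>2)"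
    using hs_norm_ntrace[of "W * A" N] hs_norm_ntrace[of A N] c A by simp
  then have "(hs_norm N (W * A))\<^sup>2 = (hs_norm N A)\<^sup>2" by (simp only: of_real_eq_iff)
  then show ?thesis by simp
qed

lemma hs_norm_unitary_right:
  assumes W: "unitary N W" and A: "A \<in> carrier_mat N N"
  shows "hs_norm N (A * W) = hs_norm N A"
proof -
  have c: "W \<in> carrier_mat N N" using W by (simp add: unitary_def)
  have "hs_norm N (A * W) = hs_norm N (mat_adj W * mat_adj A)"
    using hs_norm_mat_adj[of "A * W" N] c A by (simp add: mat_adj_mult[of _ N N _ N])
  also have "\<dots> = hs_norm N A"
    using hs_norm_unitary_left[OF unitary_mat_adj[OF W], of "mat_adj A"] A hs_norm_mat_adj[OF A] by simp
  finally show ?thesis .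
qed

text \<open>The Heisenberg picture: the matrix element of the result in a state \<open>u\<close> is
  that of \<open>A\<close> in \<open>W *\<^sub>v u\<close>. With \<open>W\<close> the baker's map
  this is one step of evolution forward in time.\<close>

definition unitary_conj :: "complex mat \<Rightarrow> complex mat \<Rightarrow> complex mat" where
  "unitary_conj W A = mat_adj W * A * W"

lemma unitary_conj_carrier [simp]: "unitary N W \<Longrightarrow> A \<in> carrier_mat N N \<Longrightarrow> unitary_conj W A \<in> carrier_mat N N"
  unfolding unitary_conj_def unitary_def by (metis mat_adj_carrier mult_carrier_mat)

lemma unitary_conj_hs_norm: "unitary N W \<Longrightarrow> A \<in> carrier_mat N N \<Longrightarrow> hs_norm N (unitary_conj W A) = hs_norm N A"
  unfolding unitary_conj_def
  by (metis hs_norm_unitary_right hs_norm_unitary_left unitary_mat_adj unitary_carrier mult_carrier_mat)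

lemma unitary_conj_add:
  assumes "unitary N W" "A \<in> carrier_mat N N" "B \<in> carrier_mat N N"
  shows "unitary_conj W (A + B) = unitary_conj W A + unitary_conj W B"
  using assms unitary_carrier[OF assms(1)] unfolding unitary_conj_def
  by (simp add: mult_add_distrib_mat[of _ N N _ N] add_mult_distrib_mat[of _ N N _ _ N])

lemma unitary_conj_minus:
  assumes "unitary N W" "A \<in> carrier_mat N N" "B \<in> carrier_mat N N"
  shows "unitary_conj W (A - B) = unitary_conj W A - unitary_conj W B"
  using assms unitary_carrier[OF assms(1)] unfolding unitary_conj_def
  by (simp add: mult_minus_distrib_mat[of _ N N _ N] minus_mult_distrib_mat[of _ N N _ _ N])

lemma unitary_conj_smult:
  assumes "unitary N W" "A \<in> carrier_mat N N"
  shows "unitary_conj W (c \<cdot>\<^sub>m A) = c \<cdot>\<^sub>m unitary_conj W A"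
  using assms unitary_carrier[OF assms(1)] unfolding unitary_conj_def
  by (simp add: mult_smult_distrib[of _ N N _ N] mult_smult_assoc_mat[of _ N N _ N])

lemma unitary_conj_mult:
  assumes W: "unitary N W" and c: "A \<in> carrier_mat N N" "B \<in> carrier_mat N N"
  shows "unitary_conj W (A * B) = unitary_conj W A * unitary_conj W B"
proof -
  have w: "W \<in> carrier_mat N N" "mat_adj W \<in> carrier_mat N N" "W * mat_adj W = 1\<^sub>m N"
    using W by (auto simp: unitary_def)
  have "unitary_conj W A * unitary_conj W B = mat_adj W * A * (W * mat_adj W) * B * W"
    unfolding unitary_conj_def using w(1,2) c by (simp add: assoc_mult_mat[of _ N N _ N _ N] sq_mult[of _ N])
  also have "\<dots> = unitary_conj W (A * B)"
    unfolding unitary_conj_def w(3) using w(1,2) c by (simp add: assoc_mult_mat[of _ N N _ N _ N] sq_mult[of _ N])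
  finally show ?thesis ..
qed

lemma unitary_conj_one: "unitary N W \<Longrightarrow> unitary_conj W (1\<^sub>m N) = 1\<^sub>m N"
  by (auto simp: unitary_conj_def unitary_def)

lemma unitary_conj_ntrace:
  assumes W: "unitary N W" and A: "A \<in> carrier_mat N N"
  shows "ntrace N (unitary_conj W A) = ntrace N A"
proof -
  have w: "W \<in> carrier_mat N N" "mat_adj W \<in> carrier_mat N N" "W * mat_adj W = 1\<^sub>m N"
    using W by (auto simp: unitary_def)
  have "ntrace N (unitary_conj W A) = ntrace N (W * (mat_adj W * A))"
    unfolding unitary_conj_def using w A by (intro ntrace_comm) auto
  also have "W * (mat_adj W * A) = A"
    using w A assoc_mult_mat[of W N N "mat_adj W" N A N] by simp
  finally show ?thesis .
qed

text \<open>A bound on the operator norm, encoded by its effect on left multiplication. Such a bound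
  is what makes products stable, since the normalised Hilbert-Schmidt norm of a product can exceed
  the product of the norms by a factor up to sqrt N.\<close>

definition left_bounded :: "nat \<Rightarrow> real \<Rightarrow> complex mat \<Rightarrow> bool" where
  "left_bounded N B X \<longleftrightarrow> (\<forall>Z\<in>carrier_mat N N. hs_norm N (X * Z) \<le> B * hs_norm N Z)"

lemma left_bounded_unitary_conj:
  assumes W: "unitary N W" and X: "X \<in> carrier_mat N N" and "left_bounded N B X"
  shows "left_bounded N B (unitary_conj W X)"
  unfolding left_bounded_def
proof
  fix Z :: "complex mat" assume Z: "Z \<in> carrier_mat N N"
  have w: "W \<in> carrier_mat N N" "mat_adj W \<in> carrier_mat N N" using W by (auto simp: unitary_def)
  have "unitary_conj W X * Z = mat_adj W * (X * (W * Z))"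
    unfolding unitary_conj_def using w X Z by (simp add: assoc_mult_mat[of _ N N _ N _ N] sq_mult[of _ N])
  then have "hs_norm N (unitary_conj W X * Z) = hs_norm N (X * (W * Z))"
    using hs_norm_unitary_left[OF unitary_mat_adj[OF W], of "X * (W * Z)"] w X Z by simp
  also have "\<dots> \<le> B * hs_norm N (W * Z)" using assms(3) w Z by (auto simp: left_bounded_def)
  also have "hs_norm N (W * Z) = hs_norm N Z" by (rule hs_norm_unitary_left[OF W Z])
  finally show "hs_norm N (unitary_conj W X * Z) \<le> B * hs_norm N Z" .
qed

section \<open>Functions of position as diagonal matrices\<close>

definition position_op :: "nat \<Rightarrow> (real \<Rightarrow> complex) \<Rightarrow> complex mat" where
  "position_op N f = Matrix.mat N N (\<lambda>(i, j). if i = j then f (real i / real N) else 0)"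

definition rms :: "nat \<Rightarrow> (real \<Rightarrow> complex) \<Rightarrow> real" where
  "rms N f = L2_set (\<lambda>j. cmod (f (real j / real N))) {..<N} / sqrt N"

lemma position_op_carrier [simp]: "position_op N f \<in> carrier_mat N N" by (simp add: position_op_def)

lemma position_op_index [simp]: "i < N \<Longrightarrow> j < N \<Longrightarrow> position_op N f $$ (i, j) = (if i = j then f (real i / real N) else 0)"
  by (simp add: position_op_def)

lemma position_op_dim [simp]: "dim_row (position_op N f) = N" "dim_col (position_op N f) = N"
  by (simp_all add: position_op_def)

lemma position_op_left:
  assumes "A \<in> carrier_mat N m" "i < N" "j < m"
  shows "(position_op N f * A) $$ (i, j) = f (real i / real N) * A $$ (i, j)"
proof -
  have "(position_op N f * A) $$ (i, j) = (\<Sum>k<N. position_op N f $$ (i, k) * A $$ (k, j))"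
    using assms by (intro index_mult_mat_sum) auto
  also have "\<dots> = (\<Sum>k<N. if k = i then f (real i / real N) * A $$ (i, j) else 0)"
    using assms by (intro sum.cong) auto
  finally show ?thesis using assms by simp
qed

lemma position_op_right:
  assumes "A \<in> carrier_mat m N" "i < m" "j < N"
  shows "(A * position_op N f) $$ (i, j) = A $$ (i, j) * f (real j / real N)"
proof -
  have "(A * position_op N f) $$ (i, j) = (\<Sum>k<N. A $$ (i, k) * position_op N f $$ (k, j))"
    using assms by (intro index_mult_mat_sum) auto
  also have "\<dots> = (\<Sum>k<N. if k = j then A $$ (i, j) * f (real j / real N) else 0)"
    using assms by (intro sum.cong) auto
  finally show ?thesis using assms by simp
qed

lemma rms_nonneg [simp]: "0 \<le> rms N f" by (simp add: rms_def)

lemma rms_power2: "(rms N f)\<^sup>2 * N = (\<Sum>j<N. (cmod (f (real j / real N)))\<^sup>2)"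
  by (cases "N = 0") (simp_all add: rms_def power_divide L2_set_def sum_nonneg)

lemma hs_norm_position_op: "hs_norm N (position_op N f) = rms N f"
proof (cases "N = 0")
  case True then show ?thesis by (simp add: hs_norm_def rms_def)
next
  case False
  have "(hs_norm N (position_op N f))\<^sup>2 * N = (\<Sum>i<N. \<Sum>j<N. if j = i then (cmod (f (real i / real N)))\<^sup>2 else 0)"
    unfolding hs_norm_power2 by (intro sum.cong) auto
  also have "\<dots> = (rms N f)\<^sup>2 * N" by (simp add: rms_power2)
  finally have "(hs_norm N (position_op N f))\<^sup>2 = (rms N f)\<^sup>2" using False by simp
  then show ?thesis by simp
qed

lemma rms_triangle: "rms N (\<lambda>x. f x + g x) \<le> rms N f + rms N g"
proof -
  have "L2_set (\<lambda>j. cmod (f (real j / real N) + g (real j / real N))) {..<N}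
     \<le> L2_set (\<lambda>j. cmod (f (real j / real N)) + cmod (g (real j / real N))) {..<N}"
    by (intro L2_set_mono) (auto simp: norm_triangle_ineq)
  also have "\<dots> \<le> L2_set (\<lambda>j. cmod (f (real j / real N))) {..<N} + L2_set (\<lambda>j. cmod (g (real j / real N))) {..<N}"
    by (rule L2_set_triangle_ineq)
  finally show ?thesis by (simp add: rms_def add_divide_distrib[symmetric] divide_right_mono)
qed

lemma rms_mult_bound:
  assumes "\<And>x. cmod (f x) \<le> B" shows "rms N (\<lambda>x. f x * g x) \<le> B * rms N g"
proof -
  have B: "B \<ge> 0" using assms[of 0] norm_ge_zero order_trans by blast
  have "L2_set (\<lambda>j. cmod (f (real j / real N) * g (real j / real N))) {..<N}
     \<le> L2_set (\<lambda>j. B * cmod (g (real j / real N))) {..<N}"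
    using assms by (intro L2_set_mono) (auto simp: norm_mult mult_right_mono)
  also have "\<dots> = B * L2_set (\<lambda>j. cmod (g (real j / real N))) {..<N}"
    using B by (simp add: L2_set_right_distrib)
  finally show ?thesis by (simp add: rms_def divide_right_mono)
qed

lemma rms_bound:
  assumes "\<And>j. j < N \<Longrightarrow> cmod (f (real j / real N)) \<le> B" "0 \<le> B" shows "rms N f \<le> B"
proof (cases "N = 0")
  case True then show ?thesis using assms by (simp add: rms_def)
next
  case False
  have "L2_set (\<lambda>j. cmod (f (real j / real N))) {..<N} \<le> L2_set (\<lambda>j. B) {..<N}"
    using assms by (intro L2_set_mono) auto
  also have "\<dots> = sqrt N * B" using assms by (simp add: L2_set_constant)
  finally show ?thesis using False by (simp add: rms_def field_simps)
qed

lemma left_bounded_position_op: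
  assumes "\<And>x. cmod (f x) \<le> B" shows "left_bounded N B (position_op N f)"
  unfolding left_bounded_def
proof
  fix Z :: "complex mat" assume Z: "Z \<in> carrier_mat N N"
  have B: "B \<ge> 0" using assms[of 0] norm_ge_zero order_trans by blast
  have "(\<Sum>i<N. \<Sum>j<N. (cmod ((position_op N f * Z) $$ (i, j)))\<^sup>2) \<le> (\<Sum>i<N. \<Sum>j<N. B\<^sup>2 * (cmod (Z $$ (i, j)))\<^sup>2)"
    using assms Z
    by (intro sum_mono) (auto simp: position_op_left norm_mult power_mult_distrib intro!: mult_right_mono power_mono simp del: index_mult_mat(1))
  also have "\<dots> = (B * hs_norm N Z)\<^sup>2 * N"
    unfolding power_mult_distrib mult.assoc hs_norm_power2 by (simp add: sum_distrib_left)
  finally show "hs_norm N (position_op N f * Z) \<le> B * hs_norm N Z" using B by (intro hs_norm_leI) auto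
qed

lemma hs_norm_mult_position_op:
  assumes "\<And>x. cmod (f x) \<le> B" and Z: "Z \<in> carrier_mat N N"
  shows "hs_norm N (Z * position_op N f) \<le> B * hs_norm N Z"
proof -
  have B: "B \<ge> 0" using assms(1)[of 0] norm_ge_zero order_trans by blast
  have "(\<Sum>i<N. \<Sum>j<N. (cmod ((Z * position_op N f) $$ (i, j)))\<^sup>2) \<le> (\<Sum>i<N. \<Sum>j<N. B\<^sup>2 * (cmod (Z $$ (i, j)))\<^sup>2)"
    using assms
    by (intro sum_mono) (auto simp: position_op_right norm_mult power_mult_distrib mult.commute[of "B\<^sup>2"] intro!: mult_left_mono power_mono simp del: index_mult_mat(1))
  also have "\<dots> = (B * hs_norm N Z)\<^sup>2 * N"
    unfolding power_mult_distrib mult.assoc hs_norm_power2 by (simp add: sum_distrib_left)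
  finally show ?thesis using B by (intro hs_norm_leI) auto
qed

lemma position_op_add: "position_op N (\<lambda>x. f x + g x) = position_op N f + position_op N g"
  by (rule eq_matI) auto

lemma position_op_minus: "position_op N (\<lambda>x. f x - g x) = position_op N f - position_op N g"
  by (rule eq_matI) auto

lemma position_op_smult: "position_op N (\<lambda>x. c * f x) = c \<cdot>\<^sub>m position_op N f"
  by (rule eq_matI) auto

lemma position_op_mult: "position_op N (\<lambda>x. f x * g x) = position_op N f * position_op N g"
  by (rule eq_matI) (auto simp: position_op_left[OF position_op_carrier] simp del: index_mult_mat(1))

lemma position_op_const: "position_op N (\<lambda>x. c) = c \<cdot>\<^sub>m 1\<^sub>m N"
  by (rule eq_matI) auto

lemma echar_0 [simp]: "echar 0 x = 1" and echar_k0 [simp]: "echar k 0 = 1" and norm_echar [simp]: "cmod (echar k x) = 1"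
  by (simp_all add: echar_def)

lemma echar_add: "echar (k + l) x = echar k x * echar l x"
  by (simp add: echar_def cis_mult ring_distribs)

lemma echar_plus: "echar k (x + y) = echar k x * echar k y"
  by (simp add: echar_def cis_mult ring_distribs)

lemma echar_minus: "echar (- k) x = cnj (echar k x)"
  by (simp add: echar_def cis_cnj)

lemma echar_int [simp]: "echar k (of_int m) = 1"
proof -
  have "echar k (of_int m) = cis (2 * pi * of_int (k * m))" by (simp add: echar_def mult_ac)
  also have "\<dots> = 1" by (rule cis_multiple_2pi) simp
  finally show ?thesis .
qed

lemma echar_periodic: "echar k (x + 1) = echar k x"
  using echar_int[of k 1] by (simp add: echar_plus)

section \<open>The discrete Fourier transform and the baker's map\<close>

lemma echar_eq_1_iff:
  assumes "N > 0"
  shows "echar k (1 / real N) = 1 \<longleftrightarrow> int N dvd k"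
proof
  assume "echar k (1 / real N) = 1"
  then have "cos (2 * pi * of_int k * (1 / real N)) = 1"
    by (metis echar_def cis.sel(1) one_complex.sel(1))
  then obtain m :: int where "2 * pi * of_int k * (1 / real N) = of_int m * 2 * pi"
    using cos_one_2pi_int by blast
  then have "real_of_int k = of_int m * real N"
    using assms by (simp add: field_simps)
  then have "real_of_int k = of_int (m * int N)" by simp
  then have "k = m * int N" by (simp only: of_int_eq_iff)
  then show "int N dvd k" by simp
next
  assume "int N dvd k"
  then obtain m where m: "k = int N * m" by blast
  have "echar k (1 / real N) = echar 1 (of_int m)"
    using assms unfolding echar_def m by (intro arg_cong[of _ _ cis]) simp
  then show "echar k (1 / real N) = 1" by simp
qed

lemma echar_power: "echar k (real j * x) = echar k x ^ j"
  unfolding echar_def Complex.DeMoivre by (intro arg_cong[of _ _ cis]) simp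

lemma root_sum:
  assumes N: "N > 0"
  shows "(\<Sum>j<N. echar k (real j / real N)) = (if int N dvd k then of_nat N else 0)"
proof -
  have e: "echar k (real j / real N) = echar k (1 / real N) ^ j" for j
    using echar_power[of k j "1 / real N"] by simp
  show ?thesis
  proof (cases "int N dvd k")
    case True
    then show ?thesis using echar_eq_1_iff[OF N, of k] by (simp add: e)
  next
    case False
    then have ne: "echar k (1 / real N) \<noteq> 1" using echar_eq_1_iff[OF N] by simp
    have "echar k (1 / real N) ^ N = 1" using e[of N] N echar_int[of k 1] by simp
    then show ?thesis using False ne by (simp add: e geometric_sum)
  qed
qed

lemma dft_carrier [simp]: "dft N \<in> carrier_mat N N"
  by (simp add: dft_def)

lemma dft_index: "i < N \<Longrightarrow> j < N \<Longrightarrow>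
    dft N $$ (i, j) = of_real (1 / sqrt (real N)) * echar (- int i) (real j / real N)"
  by (simp add: dft_def echar_def mult_ac)

lemma dft_index': "i < N \<Longrightarrow> j < N \<Longrightarrow>
    dft N $$ (i, j) = of_real (1 / sqrt (real N)) * echar (- int j) (real i / real N)"
  by (simp add: dft_def echar_def mult_ac)

text \<open>A function of momentum is the conjugate of a diagonal matrix by \<open>dft N\<close>. It
  is given here by its kernel, a circulant matrix, so that a character of momentum is visibly a
  cyclic shift.\<close>

definition momentum_op :: "nat \<Rightarrow> (real \<Rightarrow> complex) \<Rightarrow> complex mat" where
  "momentum_op N f = Matrix.mat N N (\<lambda>(a, b).
     (\<Sum>j<N. f (real j / real N) * echar (int a - int b) (real j / real N)) / of_nat N)"

lemma momentum_op_carrier [simp]: "momentum_op N f \<in> carrier_mat N N" by (simp add: momentum_op_def)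

lemma momentum_op_dim [simp]: "dim_row (momentum_op N f) = N" "dim_col (momentum_op N f) = N" by (simp_all add: momentum_op_def)

lemma sqrt_sq_of_nat: "complex_of_real (sqrt (real N)) * complex_of_real (sqrt (real N)) = of_nat N"
  by (metis abs_of_nat of_real_mult of_real_of_nat_eq real_sqrt_mult_self)

lemma momentum_op_eq: "momentum_op N f = mat_adj (dft N) * position_op N f * dft N"
proof (rule eq_matI)
  fix a b assume "a < dim_row (mat_adj (dft N) * position_op N f * dft N)" "b < dim_col (mat_adj (dft N) * position_op N f * dft N)"
  then have ab: "a < N" "b < N" by (auto simp: dft_def)
  have ca: "mat_adj (dft N) \<in> carrier_mat N N" by simp
  have "(mat_adj (dft N) * position_op N f * dft N) $$ (a, b) = (\<Sum>j<N. (mat_adj (dft N) * position_op N f) $$ (a, j) * dft N $$ (j, b))"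
    using ab ca by (intro index_mult_mat_sum) auto
  also have "\<dots> = (\<Sum>j<N. f (real j / real N) * echar (int a - int b) (real j / real N) / of_nat N)"
  proof (intro sum.cong refl)
    fix j assume "j \<in> {..<N}"
    then have j: "j < N" by simp
    have "(mat_adj (dft N) * position_op N f) $$ (a, j) * dft N $$ (j, b)
      = cnj (dft N $$ (j, a)) * f (real j / real N) * dft N $$ (j, b)"
      using ab j ca by (subst position_op_right[of _ N]) (auto simp: dft_def)
    also have "\<dots> = echar (int a) (real j / real N) * f (real j / real N) * echar (- int b) (real j / real N) / of_nat N"
      using ab j by (simp add: dft_index' echar_minus sqrt_sq_of_nat)
    also have "\<dots> = f (real j / real N) * echar (int a - int b) (real j / real N) / of_nat N"
      using echar_add[of "int a" "- int b" "real j / real N"] by simp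
    finally show "(mat_adj (dft N) * position_op N f) $$ (a, j) * dft N $$ (j, b) = \<dots>" .
  qed
  finally show "momentum_op N f $$ (a, b) = (mat_adj (dft N) * position_op N f * dft N) $$ (a, b)"
    using ab by (simp add: momentum_op_def sum_divide_distrib)
qed (auto simp: dft_def)

text \<open>Exchanging the Fourier matrix with its inverse changes the sign of \<open>a - b\<close>
  in the kernel, which is transposition. This order occurs when a function of position meets the
  factor \<open>F_N^{-1}\<close> of the baker's map.\<close>

lemma momentum_op_transpose_eq: "transpose_mat (momentum_op N f) = dft N * position_op N f * mat_adj (dft N)"
proof (rule eq_matI)
  fix a b assume "a < dim_row (dft N * position_op N f * mat_adj (dft N))" "b < dim_col (dft N * position_op N f * mat_adj (dft N))"
  then have ab: "a < N" "b < N" by (auto simp: dft_def)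
  have ca: "mat_adj (dft N) \<in> carrier_mat N N" by simp
  have "(dft N * position_op N f * mat_adj (dft N)) $$ (a, b) = (\<Sum>j<N. (dft N * position_op N f) $$ (a, j) * mat_adj (dft N) $$ (j, b))"
    using ab ca by (intro index_mult_mat_sum) auto
  also have "\<dots> = (\<Sum>j<N. f (real j / real N) * echar (int b - int a) (real j / real N) / of_nat N)"
  proof (intro sum.cong refl)
    fix j assume "j \<in> {..<N}"
    then have j: "j < N" by simp
    have "(dft N * position_op N f) $$ (a, j) * mat_adj (dft N) $$ (j, b)
      = dft N $$ (a, j) * f (real j / real N) * cnj (dft N $$ (b, j))"
      using ab j ca by (subst position_op_right[of _ N]) (auto simp: dft_def)
    also have "\<dots> = echar (- int a) (real j / real N) * f (real j / real N) * echar (int b) (real j / real N) / of_nat N"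
      using ab j by (simp add: dft_index echar_minus sqrt_sq_of_nat)
    also have "\<dots> = f (real j / real N) * echar (int b - int a) (real j / real N) / of_nat N"
      using echar_add[of "int b" "- int a" "real j / real N"] by simp
    finally show "(dft N * position_op N f) $$ (a, j) * mat_adj (dft N) $$ (j, b) = \<dots>" .
  qed
  finally show "transpose_mat (momentum_op N f) $$ (a, b) = (dft N * position_op N f * mat_adj (dft N)) $$ (a, b)"
    using ab by (simp add: momentum_op_def sum_divide_distrib)
qed (auto simp: dft_def)

lemma momentum_op_echar:
  assumes "a < N" "b < N"
  shows "momentum_op N (echar k) $$ (a, b) = (if int N dvd k + int a - int b then 1 else 0)"
proof -
  have "(\<Sum>j<N. echar k (real j / real N) * echar (int a - int b) (real j / real N)) = (\<Sum>j<N. echar (k + int a - int b) (real j / real N))"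
    by (simp add: echar_add[symmetric] add_diff_eq)
  then show ?thesis using assms root_sum[of N "k + int a - int b"] by (simp add: momentum_op_def)
qed

lemma dvd_diff_bounded:
  assumes "a < N" "b < N" shows "int N dvd int a - int b \<longleftrightarrow> a = b"
proof
  assume "int N dvd int a - int b"
  then have "int a mod int N = int b mod int N" by (simp add: mod_eq_dvd_iff)
  then show "a = b" using assms by simp
qed simp

lemma momentum_op_1: "momentum_op N (\<lambda>x. 1) = 1\<^sub>m N"
proof -
  have "(\<lambda>x. 1) = echar 0" by (simp add: fun_eq_iff)
  then show ?thesis
    using dvd_diff_bounded momentum_op_echar[of _ N _ 0] by (intro eq_matI) auto
qed

text \<open>The momentum operator of the constant 1 is the product of the adjoint of
  \<open>dft N\<close> with \<open>dft N\<close>, and the orthogonality of characters has already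
  identified it with the identity.\<close>

lemma dft_unitary: "unitary N (dft N)"
proof -
  have "mat_adj (dft N) * position_op N (\<lambda>x. 1) * dft N = 1\<^sub>m N"
    using momentum_op_eq[of N "\<lambda>x. 1"] momentum_op_1 by simp
  moreover have "position_op N (\<lambda>x. 1) = 1\<^sub>m N" by (rule eq_matI) auto
  ultimately have "mat_adj (dft N) * dft N = 1\<^sub>m N"
    using right_mult_one_mat[of "mat_adj (dft N)" N N] by simp
  moreover from this have "dft N * mat_adj (dft N) = 1\<^sub>m N"
    by (rule mat_mult_left_right_inverse[rotated 2]) auto
  ultimately show ?thesis by (simp add: unitary_def)
qed

lemma momentum_op_unitary_conj: "momentum_op N f = unitary_conj (dft N) (position_op N f)"
  by (simp add: unitary_conj_def momentum_op_eq)

lemma momentum_op_transpose_unitary_conj: "transpose_mat (momentum_op N f) = unitary_conj (mat_adj (dft N)) (position_op N f)"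
  by (simp add: unitary_conj_def momentum_op_transpose_eq)

lemma hs_norm_momentum_op: "hs_norm N (momentum_op N f) = rms N f"
  using unitary_conj_hs_norm[OF dft_unitary position_op_carrier] hs_norm_position_op by (simp add: momentum_op_unitary_conj)

lemma momentum_op_add: "momentum_op N (\<lambda>x. f x + g x) = momentum_op N f + momentum_op N g"
  by (simp add: momentum_op_unitary_conj position_op_add unitary_conj_add[OF dft_unitary])

lemma momentum_op_minus: "momentum_op N (\<lambda>x. f x - g x) = momentum_op N f - momentum_op N g"
  by (simp add: momentum_op_unitary_conj position_op_minus unitary_conj_minus[OF dft_unitary])

lemma momentum_op_smult: "momentum_op N (\<lambda>x. c * f x) = c \<cdot>\<^sub>m momentum_op N f"
  by (simp add: momentum_op_unitary_conj position_op_smult unitary_conj_smult[OF dft_unitary])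

section \<open>Direct sums of two equal blocks and the baker's map\<close>

definition block_double :: "nat \<Rightarrow> complex mat \<Rightarrow> complex mat" where
  "block_double n A = four_block_mat A (0\<^sub>m n n) (0\<^sub>m n n) A"

lemma block_double_carrier [simp]: "A \<in> carrier_mat n n \<Longrightarrow> block_double n A \<in> carrier_mat (2 * n) (2 * n)"
  by (simp add: block_double_def mult_2)

lemma block_double_dim: "A \<in> carrier_mat n n \<Longrightarrow> dim_row (block_double n A) = 2 * n" "A \<in> carrier_mat n n \<Longrightarrow> dim_col (block_double n A) = 2 * n"
  by (auto simp: block_double_def)

lemma block_double_index:
  assumes "A \<in> carrier_mat n n" "i < 2 * n" "j < 2 * n"
  shows "block_double n A $$ (i, j) =
    (if i < n \<and> j < n then A $$ (i, j) else if i \<ge> n \<and> j \<ge> n then A $$ (i - n, j - n) else 0)"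
  using assms by (auto simp: block_double_def)

lemma block_double_mult:
  assumes "A \<in> carrier_mat n n" "B \<in> carrier_mat n n"
  shows "block_double n A * block_double n B = block_double n (A * B)"
  unfolding block_double_def using assms
  by (subst mult_four_block_mat[of _ n n _ n _ n _ _ n _ n]) auto

lemma block_double_add:
  assumes "A \<in> carrier_mat n n" "B \<in> carrier_mat n n"
  shows "block_double n (A + B) = block_double n A + block_double n B"
  by (rule eq_matI) (use assms in \<open>auto simp: block_double_index block_double_dim\<close>)

lemma block_double_smult:
  assumes "A \<in> carrier_mat n n"
  shows "block_double n (c \<cdot>\<^sub>m A) = c \<cdot>\<^sub>m block_double n A"
  by (rule eq_matI) (use assms in \<open>auto simp: block_double_index block_double_dim\<close>)

lemma block_double_mat_adj:
  assumes "A \<in> carrier_mat n n"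
  shows "block_double n (mat_adj A) = mat_adj (block_double n A)"
proof (rule eq_matI)
  fix i j assume "i < dim_row (mat_adj (block_double n A))" "j < dim_col (mat_adj (block_double n A))"
  then have ij: "i < 2 * n" "j < 2 * n" using assms by (auto simp: block_double_dim)
  then show "block_double n (mat_adj A) $$ (i, j) = mat_adj (block_double n A) $$ (i, j)"
    using block_double_index[OF mat_adj_carrier[OF assms] ij] block_double_index[OF assms ij(2,1)] block_double_dim[OF assms] carrier_matD[OF assms]
    by auto
qed (simp_all only: block_double_dim[OF mat_adj_carrier[OF assms]] block_double_dim[OF assms] mat_adj_dim)

lemma block_double_transpose:
  assumes "A \<in> carrier_mat n n"
  shows "block_double n (transpose_mat A) = transpose_mat (block_double n A)"
  by (rule eq_matI) (use assms in \<open>auto simp: block_double_index block_double_dim\<close>)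

lemma block_double_one: "block_double n (1\<^sub>m n) = 1\<^sub>m (2 * n)"
  by (rule eq_matI) (auto simp: block_double_index block_double_dim)

lemma block_double_unitary: "unitary n A \<Longrightarrow> unitary (2 * n) (block_double n A)"
  using block_double_mat_adj[of A n] block_double_mult[of A n "mat_adj A"] block_double_mult[of "mat_adj A" n A] block_double_one[of n]
  by (simp add: unitary_def)

lemma block_double_unitary_conj:
  assumes "unitary n W" "A \<in> carrier_mat n n"
  shows "unitary_conj (block_double n W) (block_double n A) = block_double n (unitary_conj W A)"
  using assms(2) unitary_carrier[OF assms(1)] block_double_mat_adj[of W n]
    block_double_mult[of "mat_adj W" n A] block_double_mult[of "mat_adj W * A" n W]
  by (simp add: unitary_conj_def sq_mult[of _ n])

lemma sum_lessThan_double: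
  fixes n :: nat
  shows "(\<Sum>i<2*n. g i) = (\<Sum>i<n. g i) + (\<Sum>i<n. g (i + n))"
proof -
  have "(\<Sum>i<n + n. g i) = (\<Sum>i<n. g i) + (\<Sum>i\<in>{n..<n+n}. g i)"
    by (metis atLeast0LessThan le_add1 sum.atLeastLessThan_concat zero_le)
  also have "(\<Sum>i\<in>{n..<n+n}. g i) = (\<Sum>i<n. g (i + n))"
    using sum.shift_bounds_nat_ivl[of g 0 n n] by (simp add: atLeast0LessThan)
  finally show ?thesis by (simp add: mult_2)
qed

lemma block_double_hs_norm:
  assumes "A \<in> carrier_mat n n"
  shows "hs_norm (2 * n) (block_double n A) = hs_norm n A"
proof (cases "n = 0")
  case True then show ?thesis by (simp add: hs_norm_def)
next
  case False
  have "(hs_norm (2*n) (block_double n A))\<^sup>2 * real (2*n) = 2 * (\<Sum>i<n. \<Sum>j<n. (cmod (A $$ (i, j)))\<^sup>2)"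
    unfolding hs_norm_power2 sum_lessThan_double using assms
    by (simp add: block_double_index sum_lessThan_double)
  also have "\<dots> = (hs_norm n A)\<^sup>2 * real (2*n)" using hs_norm_power2[of n A] by simp
  finally have "(hs_norm (2*n) (block_double n A))\<^sup>2 = (hs_norm n A)\<^sup>2" using False by simp
  then show ?thesis by simp
qed

text \<open>Here and below \<open>n\<close> is half the dimension \<open>N\<close>.\<close>

definition baker_map :: "nat \<Rightarrow> complex mat" where
  "baker_map n = mat_adj (dft (2 * n)) * block_double n (dft n)"

lemma baker_map_unitary: "unitary (2 * n) (baker_map n)"
  unfolding baker_map_def by (intro unitary_mult unitary_mat_adj block_double_unitary dft_unitary)

text \<open>The adjoint witnesses that \<open>W\<close> is a unit of the matrix ring, which rules
  out \<open>None\<close>; a left inverse of a unitary matrix can only be its adjoint.\<close>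

lemma mat_inverse_unitary:
  assumes "unitary N W" shows "mat_inverse W = Some (mat_adj W)"
proof (cases "mat_inverse W")
  case None
  from mat_inverse(1)[OF unitary_carrier[OF assms] None] have "W \<notin> Units (ring_mat TYPE(complex) N ())" .
  moreover have "W \<in> Units (ring_mat TYPE(complex) N ())"
    using assms by (auto simp: Units_def ring_mat_simps unitary_def intro!: bexI[of _ "mat_adj W"])
  ultimately show ?thesis by blast
next
  case (Some B)
  from mat_inverse(2)[OF unitary_carrier[OF assms] Some]
  have B: "B * W = 1\<^sub>m N" "B \<in> carrier_mat N N" by auto
  have w: "W \<in> carrier_mat N N" "mat_adj W \<in> carrier_mat N N" "W * mat_adj W = 1\<^sub>m N" 
    using assms by (auto simp: unitary_def)
  have "B = B * (W * mat_adj W)" using w B by simp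
  also have "\<dots> = B * W * mat_adj W" using w(1,2) B(2) by (simp add: assoc_mult_mat[of _ N N _ N _ N])
  also have "\<dots> = mat_adj W" using w B by simp
  finally show ?thesis using Some by simp
qed

lemma baker_eq: "baker (2 * n) = baker_map n"
  by (simp add: baker_def baker_map_def block_double_def mat_inverse_unitary[OF dft_unitary])

lemma unitary_conj_baker_map:
  assumes A: "A \<in> carrier_mat (2 * n) (2 * n)"
  shows "unitary_conj (baker_map n) A = unitary_conj (block_double n (dft n)) (unitary_conj (mat_adj (dft (2 * n))) A)"
proof -
  have c: "dft (2*n) \<in> carrier_mat (2*n) (2*n)" "mat_adj (dft (2*n)) \<in> carrier_mat (2*n) (2*n)"
    "block_double n (dft n) \<in> carrier_mat (2*n) (2*n)" "mat_adj (block_double n (dft n)) \<in> carrier_mat (2*n) (2*n)" by auto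
  show ?thesis
    unfolding unitary_conj_def baker_map_def mat_adj_mult[OF c(2,3)] using c A
    by (simp add: assoc_mult_mat[of _ "2*n" "2*n" _ "2*n" _ "2*n"] sq_mult[of _ "2*n"])
qed

lemma unitary_conj_mat_adj_cancel:
  assumes W: "unitary N W" and A: "A \<in> carrier_mat N N"
  shows "unitary_conj (mat_adj W) (unitary_conj W A) = A"
proof -
  have w: "W \<in> carrier_mat N N" "mat_adj W \<in> carrier_mat N N" "W * mat_adj W = 1\<^sub>m N" 
    using W by (auto simp: unitary_def)
  have "unitary_conj (mat_adj W) (unitary_conj W A) = (W * mat_adj W) * A * (W * mat_adj W)"
    unfolding unitary_conj_def using w(1,2) A by (simp add: assoc_mult_mat[of _ N N _ N _ N] sq_mult[of _ N])
  then show ?thesis using w A by simp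
qed

text \<open>The indicator that the first binary digit of \<open>x\<close> is 0 (for
  \<open>\<epsilon> = 0\<close>) or 1 (for any other \<open>\<epsilon>\<close>). It is made periodic
  through \<open>frac\<close> because the evolution of position functions is stated for functions of
  period 1.\<close>

definition half_ind :: "nat \<Rightarrow> real \<Rightarrow> complex" where
  "half_ind \<epsilon> x = (if (frac x < 1 / 2) = (\<epsilon> = 0) then 1 else 0)"

lemma half_ind_periodic: "half_ind \<epsilon> (x + 1) = half_ind \<epsilon> x"
  by (simp add: half_ind_def frac_1_eq)

lemma half_ind_bound: "cmod (half_ind \<epsilon> x) \<le> 1"
  by (simp add: half_ind_def)

lemma frac_div: "i < m \<Longrightarrow> frac (real i / real m) = real i / real m"
  by (subst frac_eq) auto

lemma half_ind_index: "i < 2 * n \<Longrightarrow> half_ind \<epsilon> (real i / real (2 * n)) = (if (i < n) = (\<epsilon> = 0) then 1 else 0)"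
  unfolding half_ind_def frac_div by (auto simp: field_simps)

text \<open>On the grid of size \<open>2 * n\<close> the indicator is the projection onto one of the
  two blocks, and a block-diagonal matrix commutes with it.\<close>

lemma unitary_conj_block_double_half_ind: "unitary_conj (block_double n (dft n)) (position_op (2 * n) (half_ind \<epsilon>)) = position_op (2 * n) (half_ind \<epsilon>)"
proof -
  let ?S = "block_double n (dft n)" and ?D = "position_op (2 * n) (half_ind \<epsilon>)"
  have u: "unitary (2*n) ?S" by (intro block_double_unitary dft_unitary)
  have S: "?S \<in> carrier_mat (2*n) (2*n)" "mat_adj ?S \<in> carrier_mat (2*n) (2*n)" by auto
  have "?D * ?S = ?S * ?D"
  proof (rule eq_matI)
    fix i j assume "i < dim_row (?S * ?D)" "j < dim_col (?S * ?D)"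
    then have ij: "i < 2*n" "j < 2*n" using S by auto
    then show "(?D * ?S) $$ (i, j) = (?S * ?D) $$ (i, j)"
      using half_ind_index[OF ij(1), of \<epsilon>] half_ind_index[OF ij(2), of \<epsilon>]
      by (subst position_op_left[OF S(1) ij], subst position_op_right[OF S(1) ij]) (auto simp: block_double_index[OF dft_carrier])
  qed (simp_all add: block_double_dim[OF dft_carrier])
  then have "unitary_conj ?S ?D = mat_adj ?S * ?S * ?D"
    unfolding unitary_conj_def using S
    by (simp add: assoc_mult_mat[of _ "2*n" "2*n" _ "2*n" _ "2*n"])
  then show ?thesis using u by (simp add: unitary_def)
qed

text \<open>One step of the exact evolution of a momentum observable: the left and right halves
  of position space see the lower and upper halves of the momentum interval.\<close>

lemma unitary_conj_baker_map_momentum_op: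
  "unitary_conj (baker_map n) (momentum_op (2 * n) g) =
     position_op (2 * n) (half_ind 0) * block_double n (momentum_op n (\<lambda>x. g (x / 2))) +
     position_op (2 * n) (half_ind 1) * block_double n (momentum_op n (\<lambda>x. g ((x + 1) / 2)))"
proof -
  let ?g0 = "\<lambda>x. g (x / 2)" and ?g1 = "\<lambda>x. g ((x + 1) / 2)"
  have u: "unitary (2*n) (block_double n (dft n))" by (intro block_double_unitary dft_unitary)
  \<comment> \<open>The two halves of the diagonal sample \<open>g\<close> on [0, 1/2) and on [1/2,
    1). Each half is rescaled to the whole unit interval, repeated in both blocks, and cut back to
    its own block by the indicator.\<close>
  have "position_op (2*n) g = position_op (2*n) (half_ind 0) * block_double n (position_op n ?g0) + position_op (2*n) (half_ind 1) * block_double n (position_op n ?g1)"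
  proof (rule eq_matI)
    fix i j assume "i < dim_row (position_op (2*n) (half_ind 0) * block_double n (position_op n ?g0) + position_op (2*n) (half_ind 1) * block_double n (position_op n ?g1))"
      "j < dim_col (position_op (2*n) (half_ind 0) * block_double n (position_op n ?g0) + position_op (2*n) (half_ind 1) * block_double n (position_op n ?g1))"
    then have ij: "i < 2*n" "j < 2*n" by (auto simp: block_double_dim[OF position_op_carrier])
    have c: "block_double n (position_op n ?g0) \<in> carrier_mat (2*n) (2*n)" "block_double n (position_op n ?g1) \<in> carrier_mat (2*n) (2*n)"
      by auto
    have e0: "g (real i / real n / 2) = g (real i / real (2 * n))"
      by (rule arg_cong[of _ _ g]) simp
    have e1: "g ((real (i - n) / real n + 1) / 2) = g (real i / real (2 * n))" if "\<not> i < n"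
      by (rule arg_cong[of _ _ g]) (use ij that in \<open>simp add: field_simps of_nat_diff\<close>)
    have "(position_op (2*n) (half_ind 0) * block_double n (position_op n ?g0) + position_op (2*n) (half_ind 1) * block_double n (position_op n ?g1)) $$ (i, j)
      = (position_op (2*n) (half_ind 0) * block_double n (position_op n ?g0)) $$ (i, j) + (position_op (2*n) (half_ind 1) * block_double n (position_op n ?g1)) $$ (i, j)"
      using ij by (intro index_add_mat) (auto simp: block_double_dim[OF position_op_carrier])
    also have "\<dots> = half_ind 0 (real i / real (2 * n)) * block_double n (position_op n ?g0) $$ (i, j)
        + half_ind 1 (real i / real (2 * n)) * block_double n (position_op n ?g1) $$ (i, j)"
      by (simp only: position_op_left[OF c(1) ij] position_op_left[OF c(2) ij])
    also have "\<dots> = position_op (2*n) g $$ (i, j)"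
      unfolding half_ind_index[OF ij(1)] using ij e0 e1 unfolding block_double_index[OF position_op_carrier ij] position_op_index[OF ij] by auto
    finally show "position_op (2*n) g $$ (i, j) = (position_op (2*n) (half_ind 0) * block_double n (position_op n ?g0) + position_op (2*n) (half_ind 1) * block_double n (position_op n ?g1)) $$ (i, j)" ..
  qed (auto simp: block_double_dim[OF position_op_carrier])
  \<comment> \<open>A momentum observable is already conjugated by \<open>F_N\<close>, and the
    factor \<open>F_N^{-1}\<close> of the map undoes this. Only the block Fourier matrix remains,
    acting on a diagonal matrix.\<close>
  moreover have "unitary_conj (baker_map n) (momentum_op (2*n) g) = unitary_conj (block_double n (dft n)) (position_op (2*n) g)"
    using unitary_conj_baker_map[OF momentum_op_carrier, of n g] unitary_conj_mat_adj_cancel[OF dft_unitary position_op_carrier, of "2*n" g] by (simp only: momentum_op_unitary_conj)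
  ultimately show ?thesis
    by (simp add: unitary_conj_add[OF u] unitary_conj_mult[OF u] sq_mult[of _ "2*n"] unitary_conj_block_double_half_ind block_double_unitary_conj[OF dft_unitary] momentum_op_unitary_conj)
qed

text \<open>The full-size transform turns a function of position into a circulant matrix of size
  \<open>2 * n\<close>, whereas the block transform that follows can undo only circulants of size
  \<open>n\<close>. This mismatch is the error made by the evolution of positions.\<close>

lemma unitary_conj_baker_map_position_op: "unitary_conj (baker_map n) (position_op (2 * n) f) = unitary_conj (block_double n (dft n)) (transpose_mat (momentum_op (2 * n) f))"
  by (simp add: unitary_conj_baker_map momentum_op_transpose_unitary_conj)

text \<open>With half-size circulants in both blocks the inversion is exact: it leaves
  \<open>f(j/n)\<close> on the diagonal twice in a row, which by periodicity is \<open>f(2q)\<close>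
  sampled on the grid of size \<open>2 * n\<close>.\<close>

lemma block_double_position_op:
  assumes "\<And>x. f (x + 1) = f x"
  shows "unitary_conj (block_double n (dft n)) (block_double n (transpose_mat (momentum_op n f))) = position_op (2 * n) (\<lambda>x. f (2 * x))"
proof -
  have "unitary_conj (block_double n (dft n)) (block_double n (transpose_mat (momentum_op n f))) = block_double n (unitary_conj (dft n) (unitary_conj (mat_adj (dft n)) (position_op n f)))"
    by (simp add: block_double_unitary_conj[OF dft_unitary] momentum_op_transpose_unitary_conj[symmetric])
  also have "unitary_conj (dft n) (unitary_conj (mat_adj (dft n)) (position_op n f)) = position_op n f"
    using unitary_conj_mat_adj_cancel[OF unitary_mat_adj[OF dft_unitary], of "position_op n f" n] by simp
  also have "block_double n (position_op n f) = position_op (2 * n) (\<lambda>x. f (2 * x))"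
  proof (rule eq_matI)
    fix i j assume "i < dim_row (position_op (2 * n) (\<lambda>x. f (2 * x)))" "j < dim_col (position_op (2 * n) (\<lambda>x. f (2 * x)))"
    then have ij: "i < 2*n" "j < 2*n" by auto
    have "real i / real n = real (i - n) / real n + 1" if "i \<ge> n"
      using that ij by (simp add: field_simps of_nat_diff)
    then show "block_double n (position_op n f) $$ (i, j) = position_op (2 * n) (\<lambda>x. f (2 * x)) $$ (i, j)"
      using ij assms[of "real (i - n) / real n"] by (auto simp: block_double_index)
  qed (auto simp: block_double_dim[OF position_op_carrier])
  finally show ?thesis .
qed

section \<open>Trigonometric approximation in discrete mean square\<close>

text \<open>The closure under sums and scalar multiples is built in, so that limit statements linear
  in the function follow from the case of one character by induction.\<close>

inductive trig_poly :: "(real \<Rightarrow> complex) \<Rightarrow> bool" where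
  base: "trig_poly (echar k)"
| add: "trig_poly f \<Longrightarrow> trig_poly g \<Longrightarrow> trig_poly (\<lambda>x. f x + g x)"
| smult: "trig_poly f \<Longrightarrow> trig_poly (\<lambda>x. c * f x)"

lemma trig_poly_const: "trig_poly (\<lambda>x. c)"
  using trig_poly.smult[OF trig_poly.base[of 0], of c] by simp

lemma trig_poly_bounded: "trig_poly f \<Longrightarrow> \<exists>B. \<forall>x. cmod (f x) \<le> B"
proof (induction rule: trig_poly.induct)
  case (base k)
  show ?case by (intro exI[of _ 1]) simp
next
  case (add f g)
  then obtain B C where "\<forall>x. cmod (f x) \<le> B" "\<forall>x. cmod (g x) \<le> C" by blast
  then show ?case by (intro exI[of _ "B + C"]) (meson add_mono norm_triangle_ineq order_trans)
next
  case (smult f c)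
  then obtain B where "\<forall>x. cmod (f x) \<le> B" by blast
  then show ?case by (intro exI[of _ "cmod c * B"]) (simp add: norm_mult mult_left_mono)
qed

lemma trig_poly_echar_mult: "trig_poly f \<Longrightarrow> trig_poly (\<lambda>x. echar k x * f x)"
proof (induction rule: trig_poly.induct)
  case (base l)
  have "(\<lambda>x. echar k x * echar l x) = echar (k + l)" by (simp add: echar_add fun_eq_iff)
  then show ?case using trig_poly.base by simp
next
  case (add f g)
  from trig_poly.add[OF add.IH] show ?case by (simp add: distrib_left)
next
  case (smult f c)
  from trig_poly.smult[OF smult.IH, of c] show ?case by (simp add: mult_ac)
qed

lemma trig_poly_mult: "trig_poly f \<Longrightarrow> trig_poly g \<Longrightarrow> trig_poly (\<lambda>x. f x * g x)"
proof (induction rule: trig_poly.induct)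
  case (base k)
  then show ?case by (rule trig_poly_echar_mult)
next
  case (add f h)
  from trig_poly.add[OF add.IH(1)[OF add.prems] add.IH(2)[OF add.prems]] show ?case
    by (simp add: distrib_right)
next
  case (smult f c)
  from trig_poly.smult[OF smult.IH[OF smult.prems], of c] show ?case by (simp add: mult_ac)
qed

lemma trig_poly_Re_Im: "trig_poly (\<lambda>x. of_real (Re (echar 1 x)))" "trig_poly (\<lambda>x. of_real (Im (echar 1 x)))"
proof -
  have "(\<lambda>x. 1/2 * (echar 1 x + echar (-1) x)) = (\<lambda>x. of_real (Re (echar 1 x)))"
    by (auto simp: fun_eq_iff echar_minus complex_eq_iff)
  moreover have "trig_poly (\<lambda>x. 1/2 * (echar 1 x + echar (-1) x))"
    by (intro trig_poly.smult trig_poly.add trig_poly.base)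
  ultimately show "trig_poly (\<lambda>x. of_real (Re (echar 1 x)))" by simp
  have "(\<lambda>x. (-\<i>/2) * (echar 1 x + (-1) * echar (-1) x)) = (\<lambda>x. of_real (Im (echar 1 x)))"
    by (auto simp: fun_eq_iff echar_minus complex_eq_iff)
  moreover have "trig_poly (\<lambda>x. (-\<i>/2) * (echar 1 x + (-1) * echar (-1) x))"
    by (intro trig_poly.smult trig_poly.add trig_poly.base)
  ultimately show "trig_poly (\<lambda>x. of_real (Im (echar 1 x)))" by simp
qed

lemma trig_poly_of_real_poly:
  fixes q :: "complex \<Rightarrow> real"
  assumes "real_polynomial_function q"
  shows "trig_poly (\<lambda>x. of_real (q (echar 1 x)))"
  using assms
proof (induction rule: real_polynomial_function.induct)
  case (linear f)
  have "f z = Re z * f 1 + Im z * f \<i>" for z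
  proof -
    interpret bounded_linear f by fact
    have "f z = f (Re z *\<^sub>R 1 + Im z *\<^sub>R \<i>)"
      by (rule arg_cong[of _ _ f]) (simp add: complex_eq_iff)
    also have "\<dots> = Re z *\<^sub>R f 1 + Im z *\<^sub>R f \<i>" by (subst add) (simp only: scaleR)
    also have "\<dots> = Re z * f 1 + Im z * f \<i>" by simp
    finally show ?thesis .
  qed
  then have "(\<lambda>x. of_real (f (echar 1 x))) =
     (\<lambda>x. of_real (f 1) * of_real (Re (echar 1 x)) + of_real (f \<i>) * complex_of_real (Im (echar 1 x)))"
    by (metis of_real_add of_real_mult mult.commute)
  then show ?case
    using trig_poly.add[OF trig_poly.smult[OF trig_poly_Re_Im(1)] trig_poly.smult[OF trig_poly_Re_Im(2)]]
    by simp
next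
  case (const c)
  show ?case by (rule trig_poly_const)
next
  case (add f g)
  from trig_poly.add[OF add.IH] show ?case by simp
next
  case (mult f g)
  from trig_poly_mult[OF mult.IH] show ?case by simp
qed

text \<open>Coordinates on the unit circle are the cosine and the sine, and trigonometric
  polynomials form an algebra. Polynomial approximation on the circle therefore yields trigonometric
  approximation.\<close>

lemma trig_poly_of_poly:
  fixes p :: "complex \<Rightarrow> complex"
  assumes "polynomial_function p"
  shows "trig_poly (\<lambda>x. p (echar 1 x))"
proof -
  have "real_polynomial_function (Re \<circ> p)" "real_polynomial_function (Im \<circ> p)"
    using assms bounded_linear_Re bounded_linear_Im by (auto simp: polynomial_function_def)
  from trig_poly.add[OF trig_poly_of_real_poly[OF this(1)] trig_poly.smult[OF trig_poly_of_real_poly[OF this(2)], of \<i>]]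
  show ?thesis by (simp add: complex_eq[symmetric])
qed

text \<open>\<open>P\<close> depends on \<open>\<epsilon>\<close> but not on \<open>N\<close>: all
  estimates for shifts by \<open>k\<close> are limits for fixed \<open>k\<close>. Only the values on
  the grid enter, in mean square, which admits functions with jumps.\<close>

definition trig_approximable :: "(real \<Rightarrow> complex) \<Rightarrow> bool" where
  "trig_approximable f \<longleftrightarrow> (\<forall>\<epsilon>>0. \<exists>P. trig_poly P \<and> (\<forall>\<^sub>F N in sequentially. rms N (\<lambda>x. f x - P x) \<le> \<epsilon>))"

lemma trig_approximable_trig: "trig_poly f \<Longrightarrow> trig_approximable f"
  unfolding trig_approximable_def by (intro allI impI exI[of _ f]) (simp add: rms_def L2_set_def)

lemma trig_approximable_add:
  assumes "trig_approximable f" "trig_approximable g" shows "trig_approximable (\<lambda>x. f x + g x)"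
  unfolding trig_approximable_def
proof (intro allI impI)
  fix \<epsilon> :: real assume "\<epsilon> > 0"
  then have h: "\<epsilon> / 2 > 0" by simp
  from h assms obtain P Q where P: "trig_poly P" "\<forall>\<^sub>F N in sequentially. rms N (\<lambda>x. f x - P x) \<le> \<epsilon> / 2"
    and Q: "trig_poly Q" "\<forall>\<^sub>F N in sequentially. rms N (\<lambda>x. g x - Q x) \<le> \<epsilon> / 2"
    unfolding trig_approximable_def by meson
  have "\<forall>\<^sub>F N in sequentially. rms N (\<lambda>x. (f x + g x) - (P x + Q x)) \<le> \<epsilon>"
    using P(2) Q(2)
  proof eventually_elim
    case (elim N)
    then show ?case using rms_triangle[of N "\<lambda>x. f x - P x" "\<lambda>x. g x - Q x"]
      by (simp add: algebra_simps)
  qed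
  then show "\<exists>P. trig_poly P \<and> (\<forall>\<^sub>F N in sequentially. rms N (\<lambda>x. f x + g x - P x) \<le> \<epsilon>)"
    using trig_poly.add[OF P(1) Q(1)] by blast
qed

lemma trig_approximable_mult:
  assumes "trig_approximable f" "trig_approximable g" and B: "\<And>x. cmod (f x) \<le> B" shows "trig_approximable (\<lambda>x. f x * g x)"
  unfolding trig_approximable_def
proof (intro allI impI)
  fix \<epsilon> :: real assume e: "\<epsilon> > 0"
  have B0: "B \<ge> 0" using B[of 0] norm_ge_zero order_trans by blast
  \<comment> \<open>The splitting is f g - P Q = f (g - Q) + Q (f - P). \<open>Q\<close> has to be
    chosen first, since the tolerance for \<open>P\<close> depends on the bound \<open>C\<close> of
    \<open>Q\<close>. Adding 1 keeps the denominators positive.\<close>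
  have "\<epsilon> / (2 * (B + 1)) > 0" using e B0 by simp
  with assms obtain Q where Q: "trig_poly Q" "\<forall>\<^sub>F N in sequentially. rms N (\<lambda>x. g x - Q x) \<le> \<epsilon> / (2 * (B + 1))"
    unfolding trig_approximable_def by meson
  obtain C where C: "\<And>x. cmod (Q x) \<le> C" using trig_poly_bounded[OF Q(1)] by blast
  have C0: "C \<ge> 0" using C[of 0] norm_ge_zero order_trans by blast
  have "\<epsilon> / (2 * (C + 1)) > 0" using e C0 by simp
  with assms obtain P where P: "trig_poly P" "\<forall>\<^sub>F N in sequentially. rms N (\<lambda>x. f x - P x) \<le> \<epsilon> / (2 * (C + 1))"
    unfolding trig_approximable_def by meson
  have "\<forall>\<^sub>F N in sequentially. rms N (\<lambda>x. f x * g x - P x * Q x) \<le> \<epsilon>"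
    using P(2) Q(2)
  proof eventually_elim
    case (elim N)
    have "(\<lambda>x. f x * g x - P x * Q x) = (\<lambda>x. f x * (g x - Q x) + Q x * (f x - P x))"
      by (auto simp: algebra_simps)
    then have "rms N (\<lambda>x. f x * g x - P x * Q x) \<le> rms N (\<lambda>x. f x * (g x - Q x)) + rms N (\<lambda>x. Q x * (f x - P x))"
      using rms_triangle[of N "\<lambda>x. f x * (g x - Q x)" "\<lambda>x. Q x * (f x - P x)"] by simp
    also have "\<dots> \<le> B * rms N (\<lambda>x. g x - Q x) + C * rms N (\<lambda>x. f x - P x)"
      by (intro add_mono rms_mult_bound B C)
    also have "\<dots> \<le> B * (\<epsilon> / (2 * (B + 1))) + C * (\<epsilon> / (2 * (C + 1)))"
      using elim B0 C0 by (intro add_mono mult_left_mono) auto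
    also have "\<dots> \<le> \<epsilon> / 2 + \<epsilon> / 2"
      using e B0 C0 by (intro add_mono) (auto simp: field_simps)
    finally show ?case by simp
  qed
  then show "\<exists>P. trig_poly P \<and> (\<forall>\<^sub>F N in sequentially. rms N (\<lambda>x. f x * g x - P x) \<le> \<epsilon>)"
    using trig_poly_mult[OF P(1) Q(1)] by blast
qed

lemma Arg2pi_echar: "0 \<le> x \<Longrightarrow> x < 1 \<Longrightarrow> Arg2pi (echar 1 x) = 2 * pi * x"
  by (rule Arg2pi_unique[of 1]) (auto simp: echar_def cis_conv_exp)

lemma echar_eq_1_Ints: "echar 1 x = 1 \<Longrightarrow> x \<in> \<int>"
proof -
  assume "echar 1 x = 1"
  then have "cos (2 * pi * x) = 1" by (simp add: echar_def complex_eq_iff)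
  then obtain m :: int where "2 * pi * x = of_int m * 2 * pi" using cos_one_2pi_int by blast
  then have "x = of_int m" by simp
  then show ?thesis by simp
qed

lemma card_nat_near:
  fixes a r :: real
  shows "real (card {j::nat. \<bar>real j - a\<bar> < r}) \<le> 2 * \<bar>r\<bar> + 1" "finite {j::nat. \<bar>real j - a\<bar> < r}"
proof -
  have "int ` {j::nat. \<bar>real j - a\<bar> < r} \<subseteq> {\<lfloor>a - \<bar>r\<bar>\<rfloor> + 1..\<lceil>a + \<bar>r\<bar>\<rceil> - 1}" (is "_ \<subseteq> ?I")
    by (auto simp: less_ceiling_iff floor_less_iff add1_zle_eq; linarith)
  then have f: "finite (int ` {j::nat. \<bar>real j - a\<bar> < r})" and
    c: "card (int ` {j::nat. \<bar>real j - a\<bar> < r}) \<le> card ?I"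
    using finite_subset card_mono by blast+
  show "finite {j::nat. \<bar>real j - a\<bar> < r}" using f finite_imageD inj_on_of_nat by blast
  have "card (int ` {j::nat. \<bar>real j - a\<bar> < r}) = card {j::nat. \<bar>real j - a\<bar> < r}"
    by (rule card_image) simp
  moreover have "real (card ?I) \<le> 2 * \<bar>r\<bar> + 1"
  proof -
    have "real_of_int (\<lceil>a + \<bar>r\<bar>\<rceil> - \<lfloor>a - \<bar>r\<bar>\<rfloor> - 1) \<le> 2 * \<bar>r\<bar> + 1" by linarith
    then show ?thesis by (cases "\<lceil>a + \<bar>r\<bar>\<rceil> - 1 \<ge> \<lfloor>a - \<bar>r\<bar>\<rfloor> + 1") auto
  qed
  ultimately show "real (card {j::nat. \<bar>real j - a\<bar> < r}) \<le> 2 * \<bar>r\<bar> + 1" using c by linarith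
qed

text \<open>On the compact interval from \<open>\<eta>\<close> to \<open>1 - \<eta>\<close> the
  distance of \<open>echar 1\<close> from 1 has a positive minimum, which serves as
  \<open>\<delta>\<close>.\<close>

lemma echar_near_1:
  assumes "\<eta> > 0"
  obtains \<delta> where "\<delta> > 0" "\<And>y. cmod (echar 1 y - 1) < \<delta> \<Longrightarrow> \<exists>c::int. \<bar>y - c\<bar> < \<eta>"
proof (cases "\<eta> \<le> 1 / 2")
  case False
  have "\<exists>c::int. \<bar>y - c\<bar> < \<eta>" for y using False by (intro exI[of _ "round y"]) (use of_int_round_abs_le[of y] in linarith)
  then show ?thesis using that[of 1] by auto
next
  case True
  have "continuous_on {\<eta>..1-\<eta>} (\<lambda>y. cmod (echar 1 y - 1))"
    unfolding echar_def by (intro continuous_intros)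
  then obtain t where t: "t \<in> {\<eta>..1-\<eta>}" "\<And>y. y \<in> {\<eta>..1-\<eta>} \<Longrightarrow> cmod (echar 1 t - 1) \<le> cmod (echar 1 y - 1)"
    using continuous_attains_inf[of "{\<eta>..1-\<eta>}" "\<lambda>y. cmod (echar 1 y - 1)"] True by auto
  have "echar 1 t \<noteq> 1"
  proof
    assume "echar 1 t = 1"
    then have "t \<in> \<int>" by (rule echar_eq_1_Ints)
    then obtain m :: int where "t = m" by (auto elim: Ints_cases)
    with t(1) assms have "0 < real_of_int m" "real_of_int m < 1" by auto
    then show False by simp
  qed
  show ?thesis
  proof (rule that[of "cmod (echar 1 t - 1)"])
    show "cmod (echar 1 t - 1) > 0" using \<open>echar 1 t \<noteq> 1\<close> by simp
    fix y assume y: "cmod (echar 1 y - 1) < cmod (echar 1 t - 1)"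
    have "echar 1 y = echar 1 (frac y)"
      using echar_plus[of 1 "frac y" "of_int \<lfloor>y\<rfloor>"] by (simp add: frac_def)
    then have "frac y \<notin> {\<eta>..1-\<eta>}" using t(2)[of "frac y"] y by auto
    then consider "frac y < \<eta>" | "frac y > 1 - \<eta>" by fastforce
    then show "\<exists>c::int. \<bar>y - c\<bar> < \<eta>"
    proof cases
      case 1 then show ?thesis by (intro exI[of _ "\<lfloor>y\<rfloor>"]) (simp add: frac_def; linarith)
    next
      case 2 then show ?thesis using frac_lt_1[of y] by (intro exI[of _ "\<lfloor>y\<rfloor> + 1"]) (simp add: frac_def; linarith)
    qed
  qed
qed

text \<open>A cut-off that vanishes at the possible jumps \<open>c/L\<close> makes \<open>f\<close>
  a continuous function on the unit circle, to which Stone-Weierstrass applies. The cut-off alters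
  \<open>f\<close> only near the jumps, on a small proportion of the grid points, and there by at
  most \<open>B\<close>. The point 0 counts as a jump, so periodicity is not assumed.\<close>

lemma trig_approximable_piecewise:
  assumes B: "\<And>x. cmod (f x) \<le> B" and L: "L \<ge> (1::nat)"
    and cont: "\<And>x. 0 < x \<Longrightarrow> x < 1 \<Longrightarrow> real L * x \<notin> \<int> \<Longrightarrow> isCont f x"
  shows "trig_approximable f"
  unfolding trig_approximable_def
proof (intro allI impI)
  fix \<epsilon> :: real assume e: "\<epsilon> > 0"
  have B0: "B \<ge> 0" using B[of 0] norm_ge_zero order_trans by blast
  \<comment> \<open>This makes \<open>B\<^sup>2 * (5 * \<eta>)\<close> equal to the square of
    \<open>B * \<epsilon> / (2 * (B + 1))\<close>, hence at most that of
    \<open>\<epsilon> / 2\<close>. The 5 is the 4 of the count \<open>near\<close> below plus 1 for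
    absorbing its additive constant \<open>L + 1\<close> once \<open>N\<close> is large.\<close>
  define \<eta> where "\<eta> = (\<epsilon> / (2 * (B + 1)))\<^sup>2 / 5"
  have eta: "\<eta> > 0" using e B0 by (simp add: \<eta>_def)
  obtain \<delta> where d: "\<delta> > 0" "\<And>y. cmod (echar 1 y - 1) < \<delta> \<Longrightarrow> \<exists>c::int. \<bar>y - c\<bar> < \<eta>"
    using echar_near_1[OF eta] by blast
  \<comment> \<open>The cut-off is 0 exactly at the \<open>L\<close>-th roots of unity, which are
    the images of the points \<open>c/L\<close>, and 1 as soon as \<open>z ^ L\<close> is at
    distance \<open>\<delta>\<close> or more from 1.\<close>
  define cut where "cut z = min 1 (cmod (z ^ L - 1) / \<delta>)" for z
  define H where "H z = f (Arg2pi z / (2 * pi)) * of_real (cut z)" for z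
  have chi: "0 \<le> cut z" "cut z \<le> 1" for z using d by (auto simp: cut_def)
  have Hcont: "continuous_on (sphere 0 1) H"
    unfolding continuous_on_eq_continuous_within
  proof
    fix z :: complex assume "z \<in> sphere 0 1"
    then have z: "cmod z = 1" by simp
    have chic: "isCont cut z" unfolding cut_def using d by (intro continuous_intros) auto
    show "continuous (at z within sphere 0 1) H"
    proof (cases "z ^ L = 1")
      case True
      \<comment> \<open>At a root of unity \<open>f\<close> may jump, but it is bounded by
        \<open>B\<close>, so the vanishing of the cut-off forces \<open>H\<close> to 0.\<close>
      have "((\<lambda>w. B * cut w) \<longlongrightarrow> B * cut z) (at z)" using chic by (intro tendsto_intros) (auto simp: isCont_def)
      then have "((\<lambda>w. B * cut w) \<longlongrightarrow> 0) (at z)" using True by (simp add: cut_def)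
      then have "(H \<longlongrightarrow> 0) (at z)"
        by (rule Lim_null_comparison[rotated]) (use B chi in \<open>auto simp: H_def norm_mult intro!: mult_right_mono always_eventually\<close>)
      moreover have "H z = 0" using True by (simp add: H_def cut_def)
      ultimately have "isCont H z" by (simp add: isCont_def)
      then show ?thesis using continuous_at_imp_continuous_at_within by blast
    next
      case False
      define x where "x = Arg2pi z / (2 * pi)"
      have zx: "echar 1 x = z" using z complex_norm_eq_1_exp[of z] by (simp add: x_def echar_def cis_conv_exp)
      have "echar 1 (real L * x) = z ^ L" using echar_power[of 1 L x] zx by simp
      then have Lx: "real L * x \<notin> \<int>" using False by (auto elim!: Ints_cases)
      \<comment> \<open>\<open>Arg2pi\<close> jumps on the nonnegative real axis. It meets the
        circle only in 1, which is an \<open>L\<close>-th root of unity and so belongs to the other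
        case.\<close>
      have "z \<notin> \<real>\<^sub>\<ge>\<^sub>0"
      proof
        assume "z \<in> \<real>\<^sub>\<ge>\<^sub>0"
        then obtain r where "z = of_real r" "r \<ge> 0" by (auto elim: nonneg_Reals_cases)
        then have "z = 1" using z by simp
        then show False using False by simp
      qed
      then have A: "isCont Arg2pi z" by (rule continuous_at_Arg2pi)
      have "0 \<le> x" "x < 1" using Arg2pi_ge_0[of z] Arg2pi_lt_2pi[of z] by (auto simp: x_def)
      moreover have "x \<noteq> 0" using Lx by auto
      ultimately have "isCont f x" using cont[of x] Lx by simp
      then have "isCont (\<lambda>w. f (Arg2pi w / (2 * pi))) z"
        using A by (intro isCont_o2[of z "\<lambda>w. Arg2pi w / (2 * pi)" f]) (auto simp: x_def)
      then have "isCont H z" unfolding H_def using chic by (intro continuous_intros)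
      then show ?thesis using continuous_at_imp_continuous_at_within by blast
    qed
  qed
  obtain p where p: "polynomial_function p" "\<And>z. z \<in> sphere 0 1 \<Longrightarrow> cmod (H z - p z) < \<epsilon> / 2"
    using Stone_Weierstrass_polynomial_function[OF _ Hcont, of "\<epsilon> / 2"] e by auto
  \<comment> \<open>Such a \<open>j\<close> lies within \<open>\<eta> * N / L\<close> of one of the
    \<open>L + 1\<close> points \<open>c * N / L\<close>, and each of them accounts for at most
    \<open>2 * \<eta> * N / L + 1\<close> indices; finally
    \<open>(L + 1) / L \<le> 2\<close>.\<close>
  have near: "card {j. j < N \<and> cmod (echar L (real j / real N) - 1) < \<delta>} \<le> 4 * \<eta> * N + (L + 1)" for N
  proof (cases "N = 0")
    case True then show ?thesis by simp
  next
    case False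
    have "{j. j < N \<and> cmod (echar L (real j / real N) - 1) < \<delta>} \<subseteq>
      (\<Union>c\<in>{..L}. {j. \<bar>real j - real c * N / L\<bar> < \<eta> * N / L})"
    proof
      fix j assume "j \<in> {j. j < N \<and> cmod (echar L (real j / real N) - 1) < \<delta>}"
      then have j: "j < N" and "cmod (echar 1 (real L * (real j / real N)) - 1) < \<delta>"
        using echar_power[of 1 L "real j / real N"] echar_power[of L 1 "real j / real N"] by (auto simp: echar_def mult_ac)
      from d(2)[OF this(2)] obtain c :: int where c: "\<bar>real L * (real j / real N) - c\<bar> < \<eta>" by blast
      \<comment> \<open>The nearby integer \<open>c\<close> may fall outside 0..\<open>L\<close>.
        The point \<open>L * j / N\<close> lies in that range, so clamping \<open>c\<close> to it
        does not increase the distance.\<close>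
      define c' where "c' = (if c < 0 then 0 else if c > int L then int L else c)"
      have x: "0 \<le> real L * (real j / real N)" "real L * (real j / real N) \<le> L"
        using j L by (auto simp: field_simps)
      have c': "\<bar>real L * (real j / real N) - c'\<bar> < \<eta>"
      proof -
        consider "c < 0" | "c > int L" | "0 \<le> c" "c \<le> int L" by linarith
        then show ?thesis
        proof cases
          case 1
          then have "real_of_int c \<le> 0" by simp
          then show ?thesis using c x 1 by (simp add: c'_def)
        next
          case 2
          then have "real_of_int c \<ge> real L" by linarith
          then show ?thesis using c x 2 by (simp add: c'_def)
        qed (use c in \<open>simp add: c'_def\<close>)
      qed
      have "0 \<le> c'" "c' \<le> int L" by (auto simp: c'_def)
      then obtain m where m: "c' = int m" "m \<le> L" by (metis nat_0_le nat_le_iff)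
      have "real j - real m * N / L = (real L * (real j / real N) - c') * (N / L)"
        using False L m by (simp add: field_simps)
      then have "\<bar>real j - real m * N / L\<bar> = \<bar>real L * (real j / real N) - c'\<bar> * (N / L)"
        by (simp add: abs_mult)
      also have "\<dots> < \<eta> * (N / L)" using c' False L by (intro mult_strict_right_mono) auto
      finally show "j \<in> (\<Union>c\<in>{..L}. {j. \<bar>real j - real c * N / L\<bar> < \<eta> * N / L})" using m by auto
    qed
    moreover have "finite (\<Union>c\<in>{..L}. {j. \<bar>real j - real c * N / L\<bar> < \<eta> * N / L})"
      by (rule finite_UN_I[OF finite_atMost card_nat_near(2)])
    ultimately have "card {j. j < N \<and> cmod (echar L (real j / real N) - 1) < \<delta>} \<le>
      card (\<Union>c\<in>{..L}. {j. \<bar>real j - real c * N / L\<bar> < \<eta> * N / L})"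
      by (rule card_mono[rotated])
    also have "\<dots> \<le> (\<Sum>c\<in>{..L}. card {j. \<bar>real j - real c * N / L\<bar> < \<eta> * N / L})"
      by (intro card_UN_le) auto
    finally have "real (card {j. j < N \<and> cmod (echar L (real j / real N) - 1) < \<delta>}) \<le>
      (\<Sum>c\<in>{..L}. real (card {j. \<bar>real j - real c * N / L\<bar> < \<eta> * N / L}))" by (simp only: of_nat_le_iff of_nat_sum[symmetric])
    also have "\<dots> \<le> (\<Sum>c\<in>{..L}. 2 * \<bar>\<eta> * N / L\<bar> + 1)" by (intro sum_mono card_nat_near)
    also have "\<dots> = (real L + 1) / L * (2 * \<eta> * N) + (L + 1)" using eta L by (simp add: field_simps)
    also have "\<dots> \<le> 2 * (2 * \<eta> * N) + (L + 1)"
      using eta L by (intro add_mono mult_right_mono) (auto simp: field_simps)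
    finally show ?thesis by simp
  qed
  have large: "\<forall>\<^sub>F N in sequentially. real (L + 1) / \<eta> \<le> real N"
    using filterlim_real_sequentially unfolding filterlim_at_top by blast
  have "\<forall>\<^sub>F N in sequentially. rms N (\<lambda>x. f x - p (echar 1 x)) \<le> \<epsilon>"
    using large eventually_gt_at_top[of 0]
  proof eventually_elim
    case (elim N)
    have H: "cmod (f (real j / real N) - H (echar 1 (real j / real N))) \<le>
      B * (if cmod (echar L (real j / real N) - 1) < \<delta> then 1 else 0)" if "j < N" for j
    proof -
      have "Arg2pi (echar 1 (real j / real N)) / (2 * pi) = real j / real N"
        using that by (subst Arg2pi_echar) auto
      then have "f (real j / real N) - H (echar 1 (real j / real N)) = f (real j / real N) * of_real (1 - cut (echar 1 (real j / real N)))"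
        by (simp add: H_def algebra_simps)
      moreover have "echar 1 (real j / real N) ^ L = echar L (real j / real N)"
        using echar_power[of 1 L "real j / real N"] by (simp add: echar_def mult_ac)
      then have "\<bar>1 - cut (echar 1 (real j / real N))\<bar> \<le> (if cmod (echar L (real j / real N) - 1) < \<delta> then 1 else 0)"
        using chi[of "echar 1 (real j / real N)"] d by (auto simp: cut_def)
      ultimately show ?thesis
        using B[of "real j / real N"] B0 by (simp only: norm_mult norm_of_real) (intro mult_mono; auto)
    qed
    have "(rms N (\<lambda>x. f x - H (echar 1 x)))\<^sup>2 * N \<le> (\<Sum>j<N. (B * (if cmod (echar L (real j / real N) - 1) < \<delta> then 1 else 0))\<^sup>2)"
      unfolding rms_power2 using H by (intro sum_mono power_mono) auto
    also have "\<dots> = (\<Sum>j<N. if cmod (echar L (real j / real N) - 1) < \<delta> then B\<^sup>2 else 0)"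
      by (intro sum.cong) auto
    also have "\<dots> = B\<^sup>2 * card {j. j < N \<and> cmod (echar L (real j / real N) - 1) < \<delta>}"
      by (subst sum.inter_filter[symmetric]) (auto simp: mult.commute)
    also have "\<dots> \<le> B\<^sup>2 * (5 * \<eta> * N)"
    proof (intro mult_left_mono)
      have "real (L + 1) \<le> \<eta> * N" using elim(1) eta by (simp add: field_simps)
      then show "real (card {j. j < N \<and> cmod (echar L (real j / real N) - 1) < \<delta>}) \<le> 5 * \<eta> * N" using near[of N] by simp
    qed simp
    also have "\<dots> = (B * (\<epsilon> / (2 * (B + 1))))\<^sup>2 * N" unfolding \<eta>_def power_mult_distrib by simp
    also have "\<dots> \<le> (\<epsilon> / 2)\<^sup>2 * N"
      using e B0 by (intro mult_right_mono power_mono) (auto simp: field_simps)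
    finally have "(rms N (\<lambda>x. f x - H (echar 1 x)))\<^sup>2 \<le> (\<epsilon> / 2)\<^sup>2" using elim by simp
    then have "rms N (\<lambda>x. f x - H (echar 1 x)) \<le> \<epsilon> / 2" using e power2_le_imp_le[of _ "\<epsilon> / 2"] by simp
    moreover have "rms N (\<lambda>x. H (echar 1 x) - p (echar 1 x)) \<le> \<epsilon> / 2"
      using p(2) e by (intro rms_bound) (auto simp: less_imp_le)
    ultimately show ?case using rms_triangle[of N "\<lambda>x. f x - H (echar 1 x)" "\<lambda>x. H (echar 1 x) - p (echar 1 x)"] by simp
  qed
  then show "\<exists>P. trig_poly P \<and> (\<forall>\<^sub>F N in sequentially. rms N (\<lambda>x. f x - P x) \<le> \<epsilon>)"
    using trig_poly_of_poly[OF p(1)] by blast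
qed

section \<open>Egorov property for position observables\<close>

lemma tendsto_0I:
  fixes g :: "'a \<Rightarrow> real"
  assumes "\<And>\<epsilon>. \<epsilon> > 0 \<Longrightarrow> \<forall>\<^sub>F n in F. g n \<le> \<epsilon>" "\<And>n. 0 \<le> g n"
  shows "(g \<longlongrightarrow> 0) F"
proof (rule tendstoI)
  fix e :: real assume "e > 0"
  with assms(1)[of "e / 2"] have "\<forall>\<^sub>F n in F. g n \<le> e / 2" by simp
  then show "\<forall>\<^sub>F n in F. dist (g n) 0 < e"
    by eventually_elim (use \<open>e > 0\<close> assms(2) in \<open>auto simp: dist_real_def\<close>)
qed

text \<open>The gap between two half-size functions of momentum and one of full size. It is the only
  source of error in one step of the evolution, for position and for momentum observables
  alike.\<close>

definition doubling_error :: "nat \<Rightarrow> (real \<Rightarrow> complex) \<Rightarrow> complex mat" where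
  "doubling_error n f = block_double n (momentum_op n f) - momentum_op (2 * n) f"

lemma doubling_error_carrier [simp]: "doubling_error n f \<in> carrier_mat (2 * n) (2 * n)"
  by (simp add: doubling_error_def minus_carrier_mat)

lemma doubling_error_add: "doubling_error n (\<lambda>x. f x + g x) = doubling_error n f + doubling_error n g"
  by (rule eq_matI) (auto simp: doubling_error_def momentum_op_add block_double_add[OF momentum_op_carrier momentum_op_carrier] block_double_dim[OF momentum_op_carrier])

lemma doubling_error_smult: "doubling_error n (\<lambda>x. c * f x) = c \<cdot>\<^sub>m doubling_error n f"
  by (rule eq_matI) (auto simp: doubling_error_def momentum_op_smult block_double_smult[OF momentum_op_carrier] block_double_dim[OF momentum_op_carrier] right_diff_distrib)

lemma dvd_shift:
  assumes "j < N" "int N dvd x - int j" shows "j = nat (x mod int N)"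
proof -
  have "x mod int N = int j mod int N" using assms(2) by (simp add: mod_eq_dvd_iff)
  then show ?thesis using assms(1) by simp
qed

text \<open>Both matrices are shifts by \<open>k\<close>, modulo \<open>n\<close> in each block and modulo \<open>2n\<close>; they differ
  only in the rows at distance at most \<open>\<bar>k\<bar>\<close> from the ends of a block.\<close>

lemma doubling_error_echar:
  fixes k :: int
  defines "m \<equiv> nat \<bar>k\<bar>"
  assumes n: "n > 0"
  shows "(hs_norm (2 * n) (doubling_error n (echar k)))\<^sup>2 * real (2 * n) \<le> 8 * m"
proof -
  \<comment> \<open>In row \<open>i\<close> the only nonzero entry of the full-size shift is in
    column \<open>\<alpha> i\<close>, that of the block shift in column
    \<open>\<beta> i\<close>.\<close>
  define \<alpha> where "\<alpha> i = nat ((k + int i) mod int (2 * n))" for i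
  define \<beta> where "\<beta> i = (if i < n then nat ((k + int i) mod int n) else n + nat ((k + int (i - n)) mod int n))" for i
  \<comment> \<open>Rows within \<open>m\<close> of the start or the end of a block, where adding
    \<open>k\<close> may lead out of the block. Truncated subtraction keeps the count
    \<open>4 * m\<close> valid even if \<open>m\<close> exceeds \<open>n\<close>.\<close>
  define Bad where "Bad = {..<m} \<union> {n - m..<n} \<union> {n..<n + m} \<union> {2 * n - m..<2 * n}"
  have cBad: "card Bad \<le> 4 * m"
  proof -
    have "card Bad \<le> card {..<m} + card {n - m..<n} + card {n..<n + m} + card {2 * n - m..<2 * n}"
      unfolding Bad_def by (meson card_Un_le add_right_mono order_trans)
    then show ?thesis by simp
  qed
  have ent: "(cmod (doubling_error n (echar k) $$ (i, j)))\<^sup>2 \<le>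
      (if i \<in> Bad then (if j = \<alpha> i then 1 else 0) + (if j = \<beta> i then 1 else 0) else 0)"
    if ij: "i < 2 * n" "j < 2 * n" for i j
  proof -
    define u where "u = (if i < n \<longleftrightarrow> j < n then int n dvd k + int i - int j else False)"
    define v where "v = (int (2 * n) dvd k + int i - int j)"
    have d: "int n dvd k + int (i - n) - int (j - n) \<longleftrightarrow> int n dvd k + int i - int j" if "i \<ge> n" "j \<ge> n"
      using that by (simp add: of_nat_diff add_diff_eq)
    have e: "doubling_error n (echar k) $$ (i, j) = (if u then 1 else 0) - (if v then 1 else 0)"
    proof -
      have "doubling_error n (echar k) $$ (i, j) = block_double n (momentum_op n (echar k)) $$ (i, j) - momentum_op (2 * n) (echar k) $$ (i, j)"
        unfolding doubling_error_def using ij by (intro index_minus_mat) auto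
      also have "block_double n (momentum_op n (echar k)) $$ (i, j) = (if u then 1 else 0)"
        unfolding block_double_index[OF momentum_op_carrier ij] u_def using ij d by (auto simp: momentum_op_echar)
      also have "momentum_op (2 * n) (echar k) $$ (i, j) = (if v then 1 else 0)"
        unfolding v_def by (rule momentum_op_echar[OF ij])
      finally show ?thesis .
    qed
    have v1: "j = \<alpha> i" if v using that ij dvd_shift[of j "2 * n" "k + int i"] by (simp add: v_def \<alpha>_def)
    have u1: "j = \<beta> i" if u
    proof (cases "i < n")
      case True
      then show ?thesis using that dvd_shift[of j n "k + int i"] by (auto simp: u_def \<beta>_def split: if_splits)
    next
      case False
      with that have j: "j \<ge> n" "int n dvd k + int i - int j" by (auto simp: u_def split: if_splits)
      then have "j - n = nat ((k + int (i - n)) mod int n)"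
        using False ij d[OF _ j(1)] by (intro dvd_shift) simp_all
      then show ?thesis using False j by (simp add: \<beta>_def)
    qed
    \<comment> \<open>Away from the ends, \<open>i + k\<close> stays in the block of
      \<open>i\<close>. Neither reduction wraps around, and both shifts have their entry in column
      \<open>i + k\<close>.\<close>
    have good: "u = v" if "i \<notin> Bad"
    proof -
      define t where "t = nat (int i + k)"
      have t: "int t = int i + k" "t < 2 * n" "i < n \<longleftrightarrow> t < n"
        using that ij unfolding t_def Bad_def m_def by auto
      have v: "v \<longleftrightarrow> t = j" 
        using dvd_diff_bounded[of t "2 * n" j] t ij by (simp add: v_def add.commute)
      have u: "u \<longleftrightarrow> t = j"
      proof (cases "i < n \<longleftrightarrow> j < n")
        case False then show ?thesis using t by (auto simp: u_def)
      next
        case True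
        show ?thesis
        proof (cases "i < n")
          case T: True
          then show ?thesis using True t dvd_diff_bounded[of t n j] by (simp add: u_def add.commute)
        next
          case F: False
          then have "int n dvd int (t - n) - int (j - n) \<longleftrightarrow> t - n = j - n"
            using True t ij by (intro dvd_diff_bounded) auto
          moreover have "int (t - n) - int (j - n) = k + int i - int j"
            using F True t by (simp add: of_nat_diff)
          ultimately show ?thesis using F True t by (auto simp: u_def)
        qed
      qed
      show ?thesis using u v by simp
    qed
    show ?thesis unfolding e using v1 u1 good by auto
  qed
  have "(hs_norm (2 * n) (doubling_error n (echar k)))\<^sup>2 * real (2 * n) \<le> (\<Sum>i<2*n. \<Sum>j<2*n.
     if i \<in> Bad then (if j = \<alpha> i then 1 else 0) + (if j = \<beta> i then 1 else 0) else 0)"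
    unfolding hs_norm_power2 using ent by (intro sum_mono) auto
  \<comment> \<open>A bad row contributes at most one entry from each of the two shifts; with at
    most \<open>4 * m\<close> bad rows this gives \<open>8 * m\<close>.\<close>
  also have "\<dots> \<le> (\<Sum>i<2*n. if i \<in> Bad then 2 else 0)"
    by (intro sum_mono) (auto simp: sum.distrib)
  also have "\<dots> = 2 * real (card ({..<2*n} \<inter> Bad))"
    by (subst sum.inter_restrict[symmetric]) auto
  also have "\<dots> \<le> 2 * real (4 * m)"
  proof -
    have "finite Bad" by (simp add: Bad_def)
    then have "card ({..<2*n} \<inter> Bad) \<le> card Bad" by (intro card_mono) auto
    then show ?thesis using cBad by linarith
  qed
  finally show ?thesis by simp
qed

lemma doubling_error_echar_tendsto: "(\<lambda>n. hs_norm (2 * n) (doubling_error n (echar k))) \<longlonglongrightarrow> 0"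
proof -
  have b: "\<forall>\<^sub>F n in sequentially. hs_norm (2 * n) (doubling_error n (echar k)) \<le> sqrt (4 * nat \<bar>k\<bar> / real n)"
    using eventually_gt_at_top[of 0]
  proof eventually_elim
    case (elim n)
    then show ?case using doubling_error_echar[of n k] by (intro real_le_rsqrt) (simp add: field_simps)
  qed
  have "(\<lambda>n. sqrt (4 * nat \<bar>k\<bar> / real n)) \<longlonglongrightarrow> sqrt 0"
    by (intro tendsto_real_sqrt lim_const_over_n)
  then show ?thesis using b
    by (intro real_tendsto_sandwich[OF _ b tendsto_const[of 0]]) auto
qed

lemma doubling_error_trig: "trig_poly f \<Longrightarrow> (\<lambda>n. hs_norm (2 * n) (doubling_error n f)) \<longlonglongrightarrow> 0"
proof (induction rule: trig_poly.induct)
  case (base k)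
  show ?case by (rule doubling_error_echar_tendsto)
next
  case (add f g)
  have "(\<lambda>n. hs_norm (2 * n) (doubling_error n f) + hs_norm (2 * n) (doubling_error n g)) \<longlonglongrightarrow> 0"
    using tendsto_add[OF add.IH] by simp
  then show ?case
    by (rule Lim_null_comparison[rotated]) (auto simp: doubling_error_add hs_norm_triangle)
next
  case (smult f c)
  have "(\<lambda>n. cmod c * hs_norm (2 * n) (doubling_error n f)) \<longlonglongrightarrow> 0"
    using tendsto_mult[OF tendsto_const smult.IH] by simp
  then show ?case by (simp add: doubling_error_smult hs_norm_smult)
qed

text \<open>The doubling error is linear in the function, and its norm is at most the sum of the
  mean squares on the two grids. Replacing \<open>f\<close> by a trigonometric polynomial thus costs
  little.\<close>

lemma doubling_error_trig_approximable:
  assumes "trig_approximable f" shows "(\<lambda>n. hs_norm (2 * n) (doubling_error n f)) \<longlonglongrightarrow> 0"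
proof (rule tendsto_0I)
  fix \<epsilon> :: real assume e: "\<epsilon> > 0"
  then have "\<epsilon> / 3 > 0" by simp
  with assms obtain P where P: "trig_poly P" "\<forall>\<^sub>F N in sequentially. rms N (\<lambda>x. f x - P x) \<le> \<epsilon> / 3"
    unfolding trig_approximable_def by blast
  \<comment> \<open>The blocks sample \<open>f\<close> on the grid of size \<open>n\<close>, the
    full matrix on that of size \<open>2 * n\<close>, so the approximation has to hold on
    both.\<close>
  have "filterlim (\<lambda>n::nat. 2 * n) sequentially sequentially"
    by (intro filterlim_subseq) (simp add: strict_mono_def)
  from eventually_compose_filterlim[OF P(2) this]
  have P2: "\<forall>\<^sub>F n in sequentially. rms (2 * n) (\<lambda>x. f x - P x) \<le> \<epsilon> / 3" .
  have "\<forall>\<^sub>F n in sequentially. hs_norm (2 * n) (doubling_error n P) < \<epsilon> / 3"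
    using order_tendstoD(2)[OF doubling_error_trig[OF P(1)], of "\<epsilon> / 3"] e by simp
  with P(2) P2 show "\<forall>\<^sub>F n in sequentially. hs_norm (2 * n) (doubling_error n f) \<le> \<epsilon>"
  proof eventually_elim
    case (elim n)
    let ?h = "\<lambda>x. f x - P x"
    have "hs_norm (2 * n) (doubling_error n ?h) \<le> hs_norm (2 * n) (block_double n (momentum_op n ?h)) + hs_norm (2 * n) ((-1) \<cdot>\<^sub>m momentum_op (2 * n) ?h)"
    proof -
      have "doubling_error n ?h = block_double n (momentum_op n ?h) + (-1) \<cdot>\<^sub>m momentum_op (2 * n) ?h"
        by (rule eq_matI) (auto simp: doubling_error_def block_double_dim[OF momentum_op_carrier])
      then show ?thesis using hs_norm_triangle[of "block_double n (momentum_op n ?h)" "2 * n" "(-1) \<cdot>\<^sub>m momentum_op (2 * n) ?h"] by simp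
    qed
    also have "\<dots> = rms n ?h + rms (2 * n) ?h"
      by (simp add: hs_norm_smult block_double_hs_norm[OF momentum_op_carrier] hs_norm_momentum_op)
    finally have "hs_norm (2 * n) (doubling_error n ?h) \<le> 2 * \<epsilon> / 3" using elim by simp
    moreover have "doubling_error n f = doubling_error n ?h + doubling_error n P" using doubling_error_add[of n ?h P] by simp
    ultimately show ?case using elim hs_norm_triangle[of "doubling_error n ?h" "2 * n" "doubling_error n P"] by simp
  qed
qed simp

section \<open>Asymptotic equality of sequences of operators\<close>

definition op_seq :: "(nat \<Rightarrow> complex mat) \<Rightarrow> bool" where
  "op_seq A \<longleftrightarrow> (\<forall>n. A n \<in> carrier_mat (2 * n) (2 * n))"

definition hs_eq :: "(nat \<Rightarrow> complex mat) \<Rightarrow> (nat \<Rightarrow> complex mat) \<Rightarrow> bool" where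
  "hs_eq A B \<longleftrightarrow> (\<lambda>n. hs_norm (2 * n) (A n - B n)) \<longlonglongrightarrow> 0"

lemma op_seqD [simp]: "op_seq A \<Longrightarrow> A n \<in> carrier_mat (2 * n) (2 * n)"
  by (simp add: op_seq_def)

lemma hs_eq_refl: "op_seq A \<Longrightarrow> hs_eq A A"
proof -
  assume "op_seq A"
  then have "A n - A n = 0 \<cdot>\<^sub>m A n" for n by (intro eq_matI) (auto simp: op_seq_def)
  then have "hs_norm (2 * n) (A n - A n) = 0" for n using hs_norm_smult[of "A n" "2 * n" 0] \<open>op_seq A\<close> by simp
  then show ?thesis by (simp add: hs_eq_def)
qed

lemma hs_eq_trans:
  assumes "op_seq A" "op_seq B" "op_seq C" "hs_eq A B" "hs_eq B C"
  shows "hs_eq A C"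
  unfolding hs_eq_def
proof (rule Lim_null_comparison)
  show "\<forall>\<^sub>F n in sequentially. norm (hs_norm (2 * n) (A n - C n)) \<le> hs_norm (2 * n) (A n - B n) + hs_norm (2 * n) (B n - C n)"
    using assms(1-3) by (simp add: hs_norm_diff_triangle)
  show "(\<lambda>n. hs_norm (2 * n) (A n - B n) + hs_norm (2 * n) (B n - C n)) \<longlonglongrightarrow> 0"
    using tendsto_add[OF assms(4,5)[unfolded hs_eq_def]] by simp
qed

lemma hs_eq_add:
  assumes "op_seq A" "op_seq B" "op_seq A'" "op_seq B'" "hs_eq A A'" "hs_eq B B'"
  shows "hs_eq (\<lambda>n. A n + B n) (\<lambda>n. A' n + B' n)"
  unfolding hs_eq_def
proof (rule Lim_null_comparison)
  have "A n + B n - (A' n + B' n) = (A n - A' n) + (B n - B' n)" for n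
    by (rule eq_matI) (use assms(1-4) in \<open>auto simp: op_seq_def carrier_matD[of _ "2*n" "2*n"]\<close>)
  then have "hs_norm (2 * n) (A n + B n - (A' n + B' n)) \<le> hs_norm (2 * n) (A n - A' n) + hs_norm (2 * n) (B n - B' n)" for n
    using hs_norm_triangle[of "A n - A' n" "2 * n" "B n - B' n"] assms(1-4) by (simp add: minus_carrier_mat)
  then show "\<forall>\<^sub>F n in sequentially. norm (hs_norm (2 * n) (A n + B n - (A' n + B' n))) \<le> hs_norm (2 * n) (A n - A' n) + hs_norm (2 * n) (B n - B' n)"
    by simp
  show "(\<lambda>n. hs_norm (2 * n) (A n - A' n) + hs_norm (2 * n) (B n - B' n)) \<longlonglongrightarrow> 0"
    using tendsto_add[OF assms(5,6)[unfolded hs_eq_def]] by simp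
qed

text \<open>The difference is \<open>A * (B - f) + (A - A') * f\<close>, with \<open>f\<close>
  standing for its position operator. Thus \<open>A\<close> is needed bounded as an operator and
  \<open>f\<close> as a function, but no operator bound on \<open>A'\<close> or \<open>B\<close>
  enters.\<close>

lemma hs_norm_mult_diff:
  assumes c: "A \<in> carrier_mat N N" "A' \<in> carrier_mat N N" "B \<in> carrier_mat N N"
    and l: "left_bounded N K A" and f: "\<And>x. cmod (f x) \<le> K'"
  shows "hs_norm N (A * B - A' * position_op N f) \<le> K * hs_norm N (B - position_op N f) + K' * hs_norm N (A - A')"
proof -
  have "hs_norm N (A * B - A' * position_op N f) \<le> hs_norm N (A * B - A * position_op N f) + hs_norm N (A * position_op N f - A' * position_op N f)"
    using c by (intro hs_norm_diff_triangle) auto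
  also have "A * B - A * position_op N f = A * (B - position_op N f)"
    using c by (intro mult_minus_distrib_mat[symmetric]) auto
  also have "A * position_op N f - A' * position_op N f = (A - A') * position_op N f"
    using c by (intro minus_mult_distrib_mat[symmetric]) auto
  also have "hs_norm N (A * (B - position_op N f)) + hs_norm N ((A - A') * position_op N f) \<le> K * hs_norm N (B - position_op N f) + K' * hs_norm N (A - A')"
    using l c by (intro add_mono hs_norm_mult_position_op f) (auto simp: left_bounded_def minus_carrier_mat)
  finally show ?thesis .
qed

lemma hs_eq_mult:
  assumes "op_seq A" "op_seq A'" "op_seq B" "hs_eq A A'" "hs_eq B (\<lambda>n. position_op (2 * n) f)"
    and l: "\<And>n. left_bounded (2 * n) K (A n)" and f: "\<And>x. cmod (f x) \<le> K'"
  shows "hs_eq (\<lambda>n. A n * B n) (\<lambda>n. A' n * position_op (2 * n) f)"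
  unfolding hs_eq_def
proof (rule Lim_null_comparison)
  show "\<forall>\<^sub>F n in sequentially. norm (hs_norm (2 * n) (A n * B n - A' n * position_op (2 * n) f)) \<le>
    K * hs_norm (2 * n) (B n - position_op (2 * n) f) + K' * hs_norm (2 * n) (A n - A' n)"
    using hs_norm_mult_diff[OF _ _ _ l f] assms(1-3) by simp
  show "(\<lambda>n. K * hs_norm (2 * n) (B n - position_op (2 * n) f) + K' * hs_norm (2 * n) (A n - A' n)) \<longlonglongrightarrow> 0"
    using tendsto_add[OF tendsto_mult[OF tendsto_const assms(5)[unfolded hs_eq_def]]
      tendsto_mult[OF tendsto_const assms(4)[unfolded hs_eq_def]]] by simp
qed

section \<open>Evolution by iterates of the baker's map\<close>

definition evolve :: "nat \<Rightarrow> nat \<Rightarrow> complex mat \<Rightarrow> complex mat" where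
  "evolve m n A = (unitary_conj (baker_map n) ^^ m) A"

lemma evolve_0 [simp]: "evolve 0 n A = A" by (simp add: evolve_def)

lemma evolve_Suc: "evolve (Suc m) n A = unitary_conj (baker_map n) (evolve m n A)" by (simp add: evolve_def)

lemma evolve_Suc2: "evolve (Suc m) n A = evolve m n (unitary_conj (baker_map n) A)" by (simp add: evolve_def funpow_swap1)

lemma evolve_carrier [simp]: "A \<in> carrier_mat (2 * n) (2 * n) \<Longrightarrow> evolve m n A \<in> carrier_mat (2 * n) (2 * n)"
  by (induction m) (auto simp: evolve_Suc unitary_conj_carrier[OF baker_map_unitary])

lemma evolve_op_seq: "op_seq A \<Longrightarrow> op_seq (\<lambda>n. evolve m n (A n))"
  by (simp add: op_seq_def)

lemma evolve_hs_norm: "A \<in> carrier_mat (2 * n) (2 * n) \<Longrightarrow> hs_norm (2 * n) (evolve m n A) = hs_norm (2 * n) A"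
  by (induction m) (auto simp: evolve_Suc unitary_conj_hs_norm[OF baker_map_unitary])

lemma evolve_minus: "A \<in> carrier_mat (2 * n) (2 * n) \<Longrightarrow> B \<in> carrier_mat (2 * n) (2 * n) \<Longrightarrow>
    evolve m n (A - B) = evolve m n A - evolve m n B"
  by (induction m) (auto simp: evolve_Suc unitary_conj_minus[OF baker_map_unitary])

lemma evolve_add: "A \<in> carrier_mat (2 * n) (2 * n) \<Longrightarrow> B \<in> carrier_mat (2 * n) (2 * n) \<Longrightarrow>
    evolve m n (A + B) = evolve m n A + evolve m n B"
  by (induction m) (auto simp: evolve_Suc unitary_conj_add[OF baker_map_unitary])

lemma evolve_mult: "A \<in> carrier_mat (2 * n) (2 * n) \<Longrightarrow> B \<in> carrier_mat (2 * n) (2 * n) \<Longrightarrow>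
    evolve m n (A * B) = evolve m n A * evolve m n B"
  by (induction m) (auto simp: evolve_Suc unitary_conj_mult[OF baker_map_unitary])

lemma evolve_left_bounded: "A \<in> carrier_mat (2 * n) (2 * n) \<Longrightarrow> left_bounded (2 * n) K A \<Longrightarrow> left_bounded (2 * n) K (evolve m n A)"
  by (induction m) (auto simp: evolve_Suc intro!: left_bounded_unitary_conj[OF baker_map_unitary])

lemma evolve_asym: 
  assumes "op_seq A" "op_seq B" "hs_eq A B"
  shows "hs_eq (\<lambda>n. evolve m n (A n)) (\<lambda>n. evolve m n (B n))"
proof -
  have "hs_norm (2 * n) (evolve m n (A n) - evolve m n (B n)) = hs_norm (2 * n) (A n - B n)" for n
    using assms by (simp add: evolve_minus[symmetric] evolve_hs_norm minus_carrier_mat)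
  then show ?thesis using assms(3) by (simp add: hs_eq_def)
qed

lemma op_seq_position_op [simp]: "op_seq (\<lambda>n. position_op (2 * n) f)" by (simp add: op_seq_def)
lemma op_seq_momentum_op [simp]: "op_seq (\<lambda>n. momentum_op (2 * n) f)" by (simp add: op_seq_def)
lemma op_seq_mult: "op_seq A \<Longrightarrow> op_seq B \<Longrightarrow> op_seq (\<lambda>n. A n * B n)"
  by (simp add: op_seq_def sq_mult)
lemma op_seq_add: "op_seq A \<Longrightarrow> op_seq B \<Longrightarrow> op_seq (\<lambda>n. A n + B n)"
  by (simp add: op_seq_def)

text \<open>Before any limit, the error is unitarily conjugate, up to sign and transposition, to the
  doubling error of \<open>f\<close>, so the two norms are equal.\<close>

lemma egorov_position_step:
  assumes "trig_approximable f" "\<And>x. f (x + 1) = f x"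
  shows "hs_eq (\<lambda>n. unitary_conj (baker_map n) (position_op (2 * n) f)) (\<lambda>n. position_op (2 * n) (\<lambda>x. f (2 * x)))"
proof -
  have "hs_norm (2 * n) (unitary_conj (baker_map n) (position_op (2 * n) f) - position_op (2 * n) (\<lambda>x. f (2 * x))) = hs_norm (2 * n) (doubling_error n f)" for n
  proof -
    let ?W = "block_double n (dft n)"
    have u: "unitary (2 * n) ?W" by (intro block_double_unitary dft_unitary)
    have tc: "transpose_mat (momentum_op n f) \<in> carrier_mat n n" "transpose_mat (momentum_op (2*n) f) \<in> carrier_mat (2*n) (2*n)" by auto
    have "unitary_conj (baker_map n) (position_op (2 * n) f) - position_op (2 * n) (\<lambda>x. f (2 * x)) =
      unitary_conj ?W (transpose_mat (momentum_op (2 * n) f) - block_double n (transpose_mat (momentum_op n f)))"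
      using tc block_double_position_op[of f n] assms(2) by (simp add: unitary_conj_minus[OF u] unitary_conj_baker_map_position_op)
    then have "hs_norm (2 * n) (unitary_conj (baker_map n) (position_op (2 * n) f) - position_op (2 * n) (\<lambda>x. f (2 * x))) =
       hs_norm (2 * n) (transpose_mat (momentum_op (2 * n) f) - block_double n (transpose_mat (momentum_op n f)))"
      using tc by (simp add: unitary_conj_hs_norm[OF u] minus_carrier_mat)
    also have "\<dots> = hs_norm (2 * n) (block_double n (transpose_mat (momentum_op n f)) - transpose_mat (momentum_op (2 * n) f))"
      using tc by (intro hs_norm_sym) auto
    also have "block_double n (transpose_mat (momentum_op n f)) - transpose_mat (momentum_op (2 * n) f) = transpose_mat (doubling_error n f)"
      unfolding doubling_error_def block_double_transpose[OF momentum_op_carrier]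
      by (rule eq_matI) (auto simp: block_double_dim[OF momentum_op_carrier])
    also have "hs_norm (2 * n) \<dots> = hs_norm (2 * n) (doubling_error n f)" by (rule hs_norm_transpose) simp
    finally show ?thesis .
  qed
  then show ?thesis using doubling_error_trig_approximable[OF assms(1)] by (simp add: hs_eq_def)
qed

text \<open>The induction peels off the first step and continues with \<open>f(2x)\<close>;
  therefore \<open>f\<close> varies in the induction and all its dyadic dilates must be
  approximable.\<close>

lemma egorov_position:
  assumes "\<And>i. trig_approximable (\<lambda>x. f (2 ^ i * x))" "\<And>x. f (x + 1) = f x"
  shows "hs_eq (\<lambda>n. evolve m n (position_op (2 * n) f)) (\<lambda>n. position_op (2 * n) (\<lambda>x. f (2 ^ m * x)))"
  using assms
proof (induction m arbitrary: f)
  case 0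
  show ?case by (simp add: hs_eq_refl)
next
  case (Suc m)
  have R: "trig_approximable f" using Suc.prems(1)[of 0] by simp
  have 1: "hs_eq (\<lambda>n. evolve m n (unitary_conj (baker_map n) (position_op (2 * n) f))) (\<lambda>n. evolve m n (position_op (2 * n) (\<lambda>x. f (2 * x))))"
    by (intro evolve_asym egorov_position_step R Suc.prems) (auto simp: op_seq_def unitary_conj_carrier[OF baker_map_unitary])
  have p: "f (x + 2) = f x" for x using Suc.prems(2)[of x] Suc.prems(2)[of "x + 1"] by (simp add: add.assoc)
  have 2: "hs_eq (\<lambda>n. evolve m n (position_op (2 * n) (\<lambda>x. f (2 * x)))) (\<lambda>n. position_op (2 * n) (\<lambda>x. f (2 * (2 ^ m * x))))"
  proof (rule Suc.IH)
    show "trig_approximable (\<lambda>x. f (2 * (2 ^ i * x)))" for i using Suc.prems(1)[of "Suc i"] by (simp add: mult_ac)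
    show "f (2 * (x + 1)) = f (2 * x)" for x using p[of "2 * x"] by (simp add: distrib_left)
  qed
  have "hs_eq (\<lambda>n. evolve m n (unitary_conj (baker_map n) (position_op (2 * n) f))) (\<lambda>n. position_op (2 * n) (\<lambda>x. f (2 * (2 ^ m * x))))"
    by (rule hs_eq_trans[OF _ _ _ 1 2]) (auto intro!: evolve_op_seq simp: op_seq_def unitary_conj_carrier[OF baker_map_unitary])
  then show ?case by (simp add: evolve_Suc2 mult.assoc)
qed

section \<open>Egorov property for momentum observables\<close>

lemma trig_approximable_step:
  assumes "\<And>k. cmod (\<gamma> k) \<le> B" "L \<ge> (1::nat)"
  shows "trig_approximable (\<lambda>x. \<gamma> \<lfloor>real L * x\<rfloor>)"
proof (rule trig_approximable_piecewise[where B = B and L = L])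
  fix x :: real assume x: "real L * x \<notin> \<int>"
  have "((\<lambda>y. real L * y) \<longlongrightarrow> real L * x) (at x)" by (intro tendsto_intros)
  then have "\<forall>\<^sub>F y in at x. \<lfloor>real L * y\<rfloor> = \<lfloor>real L * x\<rfloor>"
    using x by (rule eventually_floor_eq)
  then have "\<forall>\<^sub>F y in at x. \<gamma> \<lfloor>real L * y\<rfloor> = \<gamma> \<lfloor>real L * x\<rfloor>" by eventually_elim simp
  then show "isCont (\<lambda>x. \<gamma> \<lfloor>real L * x\<rfloor>) x"
    unfolding isCont_def by (rule tendsto_eventually)
qed (use assms in auto)

text \<open>As a parity of \<open>\<lfloor>2 * x\<rfloor>\<close>, the digit composed with
  \<open>2 ^ i * x\<close> becomes a function of \<open>\<lfloor>2 ^ Suc i * x\<rfloor>\<close>, a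
  step function with jumps at dyadic points only.\<close>

lemma half_ind_floor: "half_ind \<epsilon> x = (if even \<lfloor>2 * x\<rfloor> = (\<epsilon> = 0) then 1 else 0)"
proof -
  have "\<lfloor>2 * x\<rfloor> = 2 * \<lfloor>x\<rfloor> + (if frac x < 1 / 2 then 0 else 1)"
    using frac_lt_1[of x] frac_ge_0[of x] by (intro floor_unique) (auto simp: frac_def)
  then show ?thesis by (simp add: half_ind_def)
qed

lemma trig_approximable_half_ind: "trig_approximable (\<lambda>x. half_ind \<epsilon> (2 ^ i * x))"
proof -
  have "trig_approximable (\<lambda>x. (\<lambda>k. if even k = (\<epsilon> = 0) then 1 else 0) \<lfloor>real (2 ^ Suc i) * x\<rfloor>)"
    by (rule trig_approximable_step[where B = 1]) (auto simp: Suc_le_eq)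
  then show ?thesis by (simp add: half_ind_floor mult_ac)
qed

lemma egorov_momentum_step:
  assumes "trig_approximable (\<lambda>x. g (x / 2))" "trig_approximable (\<lambda>x. g ((x + 1) / 2))"
  shows "hs_eq (\<lambda>n. unitary_conj (baker_map n) (momentum_op (2 * n) g))
    (\<lambda>n. position_op (2 * n) (half_ind 0) * momentum_op (2 * n) (\<lambda>x. g (x / 2)) +
         position_op (2 * n) (half_ind 1) * momentum_op (2 * n) (\<lambda>x. g ((x + 1) / 2)))"
proof -
  have *: "hs_eq (\<lambda>n. position_op (2 * n) (half_ind \<epsilon>) * block_double n (momentum_op n f)) (\<lambda>n. position_op (2 * n) (half_ind \<epsilon>) * momentum_op (2 * n) f)"
    if "trig_approximable f" for f \<epsilon>
    unfolding hs_eq_def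
  proof (rule Lim_null_comparison[OF always_eventually[OF allI] doubling_error_trig_approximable[OF that]])
    fix n
    have "position_op (2 * n) (half_ind \<epsilon>) * block_double n (momentum_op n f) - position_op (2 * n) (half_ind \<epsilon>) * momentum_op (2 * n) f = position_op (2 * n) (half_ind \<epsilon>) * doubling_error n f"
      unfolding doubling_error_def by (rule mult_minus_distrib_mat[symmetric]) auto
    moreover have "hs_norm (2 * n) (position_op (2 * n) (half_ind \<epsilon>) * doubling_error n f) \<le> 1 * hs_norm (2 * n) (doubling_error n f)"
      using left_bounded_position_op[of "half_ind \<epsilon>" 1 "2 * n"] half_ind_bound by (simp add: left_bounded_def)
    ultimately show "norm (hs_norm (2 * n) (position_op (2 * n) (half_ind \<epsilon>) * block_double n (momentum_op n f) - position_op (2 * n) (half_ind \<epsilon>) * momentum_op (2 * n) f)) \<le> hs_norm (2 * n) (doubling_error n f)"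
      by simp
  qed
  show ?thesis unfolding unitary_conj_baker_map_momentum_op
    by (intro hs_eq_add * assms) (auto simp: op_seq_def sq_mult)
qed

text \<open>\<open>\<gamma>\<close> lists the values on the dyadic intervals of length
  \<open>2 ^ -m\<close>. One step selects the lower or upper half of these values according to the
  first digit of the position and stretches that half over the unit interval, which leaves
  \<open>2 ^ m\<close> intervals out of \<open>2 ^ Suc m\<close>. When a single interval remains,
  the observable is a scalar; the digits collected on the way have evolved into functions of
  position.\<close>

lemma egorov_momentum:
  assumes "\<And>k. cmod (\<gamma> k) \<le> B"
  shows "\<exists>h C. trig_approximable h \<and> (\<forall>x. cmod (h x) \<le> C) \<and>
    hs_eq (\<lambda>n. evolve m n (momentum_op (2 * n) (\<lambda>x. \<gamma> \<lfloor>2 ^ m * x\<rfloor>))) (\<lambda>n. position_op (2 * n) h)"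
  using assms
proof (induction m arbitrary: \<gamma>)
  case 0
  \<comment> \<open>Grid points lie in [0, 1), where the floor is 0; so the observable is the scalar
    \<open>\<gamma> 0\<close>, which is the same in position as in momentum.\<close>
  have "position_op (2 * n) (\<lambda>x. \<gamma> \<lfloor>x\<rfloor>) = position_op (2 * n) (\<lambda>x. \<gamma> 0)" for n
  proof (rule eq_matI)
    fix i j assume "i < dim_row (position_op (2 * n) (\<lambda>x. \<gamma> 0))" "j < dim_col (position_op (2 * n) (\<lambda>x. \<gamma> 0))"
    then have ij: "i < 2 * n" "j < 2 * n" by auto
    then have "\<lfloor>real i / real (2 * n)\<rfloor> = 0" by (intro floor_unique) auto
    then show "position_op (2 * n) (\<lambda>x. \<gamma> \<lfloor>x\<rfloor>) $$ (i, j) = position_op (2 * n) (\<lambda>x. \<gamma> 0) $$ (i, j)"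
      unfolding position_op_index[OF ij] by (simp only:)
  qed auto
  then have "momentum_op (2 * n) (\<lambda>x. \<gamma> \<lfloor>x\<rfloor>) = position_op (2 * n) (\<lambda>x. \<gamma> 0)" for n
    by (simp add: momentum_op_unitary_conj position_op_const unitary_conj_smult[OF dft_unitary] unitary_conj_one[OF dft_unitary])
  then show ?case
    by (intro exI[of _ "\<lambda>x. \<gamma> 0"] exI[of _ "cmod (\<gamma> 0)"]) (simp add: hs_eq_refl trig_approximable_trig trig_poly_const)
next
  case (Suc m)
  \<comment> \<open>The values of the step function on the upper half of the momentum interval,
    renumbered from 0.\<close>
  define \<gamma>1 where "\<gamma>1 k = \<gamma> (k + 2 ^ m)" for k
  define G where "G = (\<lambda>x::real. \<gamma> \<lfloor>2 ^ Suc m * x\<rfloor>)"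
  obtain h0 C0 where h0: "trig_approximable h0" "\<And>x. cmod (h0 x) \<le> C0"
    "hs_eq (\<lambda>n. evolve m n (momentum_op (2 * n) (\<lambda>x. \<gamma> \<lfloor>2 ^ m * x\<rfloor>))) (\<lambda>n. position_op (2 * n) h0)"
    using Suc.IH[of \<gamma>] Suc.prems by blast
  obtain h1 C1 where h1: "trig_approximable h1" "\<And>x. cmod (h1 x) \<le> C1"
    "hs_eq (\<lambda>n. evolve m n (momentum_op (2 * n) (\<lambda>x. \<gamma>1 \<lfloor>2 ^ m * x\<rfloor>))) (\<lambda>n. position_op (2 * n) h1)"
    using Suc.IH[of \<gamma>1] Suc.prems unfolding \<gamma>1_def by blast
  have g0: "(\<lambda>x. G (x / 2)) = (\<lambda>x. \<gamma> \<lfloor>2 ^ m * x\<rfloor>)" by (simp add: G_def)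
  have g1: "(\<lambda>x. G ((x + 1) / 2)) = (\<lambda>x. \<gamma>1 \<lfloor>2 ^ m * x\<rfloor>)"
  proof
    fix x :: real
    have "2 ^ Suc m * ((x + 1) / 2) = 2 ^ m * x + of_int (2 ^ m)" by (simp add: field_simps)
    then show "G ((x + 1) / 2) = \<gamma>1 \<lfloor>2 ^ m * x\<rfloor>" unfolding G_def \<gamma>1_def by (metis floor_add_int)
  qed
  have R0: "trig_approximable (\<lambda>x. \<gamma> \<lfloor>2 ^ m * x\<rfloor>)" using trig_approximable_step[of \<gamma> B "2 ^ m"] Suc.prems by simp
  have R1: "trig_approximable (\<lambda>x. \<gamma>1 \<lfloor>2 ^ m * x\<rfloor>)" using trig_approximable_step[of \<gamma>1 B "2 ^ m"] Suc.prems by (simp add: \<gamma>1_def)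
  define X where "X \<epsilon> n = evolve m n (position_op (2 * n) (half_ind \<epsilon>))" for \<epsilon> n
  define Y where "Y f n = evolve m n (momentum_op (2 * n) f)" for f n
  have ops: "op_seq (X \<epsilon>)" "op_seq (Y f)" for \<epsilon> f by (auto simp: X_def Y_def op_seq_def)
  have Xa: "hs_eq (X \<epsilon>) (\<lambda>n. position_op (2 * n) (\<lambda>x. half_ind \<epsilon> (2 ^ m * x)))" for \<epsilon>
    unfolding X_def by (intro egorov_position trig_approximable_half_ind half_ind_periodic)
  \<comment> \<open>Conjugation by unitaries preserves the operator bound 1 of the indicator for
    every \<open>n\<close>. The product rule needs it for the evolved digit, since convergence in
    the Hilbert-Schmidt norm gives no such bound.\<close>
  have Xl: "left_bounded (2 * n) 1 (X \<epsilon> n)" for \<epsilon> n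
    unfolding X_def by (intro evolve_left_bounded left_bounded_position_op half_ind_bound) auto
  let ?f0 = "\<lambda>x::real. \<gamma> \<lfloor>2 ^ m * x\<rfloor>" and ?f1 = "\<lambda>x::real. \<gamma>1 \<lfloor>2 ^ m * x\<rfloor>"
  define h where "h x = half_ind 0 (2 ^ m * x) * h0 x + half_ind 1 (2 ^ m * x) * h1 x" for x
  have A1: "hs_eq (\<lambda>n. evolve (Suc m) n (momentum_op (2 * n) G)) (\<lambda>n. X 0 n * Y ?f0 n + X 1 n * Y ?f1 n)"
  proof -
    have "hs_eq (\<lambda>n. evolve m n (unitary_conj (baker_map n) (momentum_op (2 * n) G)))
      (\<lambda>n. evolve m n (position_op (2 * n) (half_ind 0) * momentum_op (2 * n) ?f0 + position_op (2 * n) (half_ind 1) * momentum_op (2 * n) ?f1))"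
      using egorov_momentum_step[of G] R0 R1 unfolding g0 g1
      by (intro evolve_asym) (auto simp: op_seq_def unitary_conj_carrier[OF baker_map_unitary] sq_mult)
    then show ?thesis by (simp add: X_def Y_def evolve_Suc2 evolve_add evolve_mult sq_mult)
  qed
  have A2: "hs_eq (\<lambda>n. X 0 n * Y ?f0 n + X 1 n * Y ?f1 n)
    (\<lambda>n. position_op (2 * n) (\<lambda>x. half_ind 0 (2 ^ m * x)) * position_op (2 * n) h0 + position_op (2 * n) (\<lambda>x. half_ind 1 (2 ^ m * x)) * position_op (2 * n) h1)"
  proof (intro hs_eq_add)
    show "hs_eq (\<lambda>n. X 0 n * Y ?f0 n) (\<lambda>n. position_op (2 * n) (\<lambda>x. half_ind 0 (2 ^ m * x)) * position_op (2 * n) h0)"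
      by (rule hs_eq_mult[OF ops(1) op_seq_position_op ops(2) Xa h0(3)[folded Y_def] Xl h0(2)])
    show "hs_eq (\<lambda>n. X 1 n * Y ?f1 n) (\<lambda>n. position_op (2 * n) (\<lambda>x. half_ind 1 (2 ^ m * x)) * position_op (2 * n) h1)"
      by (rule hs_eq_mult[OF ops(1) op_seq_position_op ops(2) Xa h1(3)[folded Y_def] Xl h1(2)])
  qed (auto intro: op_seq_mult ops)
  have eq: "position_op (2 * n) (\<lambda>x. half_ind 0 (2 ^ m * x)) * position_op (2 * n) h0 + position_op (2 * n) (\<lambda>x. half_ind 1 (2 ^ m * x)) * position_op (2 * n) h1 = position_op (2 * n) h" for n
    unfolding h_def by (simp only: position_op_add position_op_mult)
  have "hs_eq (\<lambda>n. evolve (Suc m) n (momentum_op (2 * n) G)) (\<lambda>n. position_op (2 * n) h)"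
    using A2 unfolding eq by (intro hs_eq_trans[OF _ _ _ A1]) (auto intro!: op_seq_add op_seq_mult ops evolve_op_seq)
  moreover have "trig_approximable h"
    unfolding h_def by (intro trig_approximable_add trig_approximable_mult[where B = 1] trig_approximable_half_ind half_ind_bound h0 h1)
  moreover have "cmod (h x) \<le> C0 + C1" for x
  proof -
    have "cmod (half_ind \<epsilon> y * z) \<le> cmod z" for \<epsilon> y z
      using half_ind_bound[of \<epsilon> y] by (simp add: norm_mult mult_left_le_one_le)
    then show ?thesis unfolding h_def
      by (intro norm_triangle_le add_mono) (use h0(2) h1(2) order_trans in blast)+
  qed
  ultimately show ?case unfolding G_def by blast
qed

section \<open>Quantum ergodicity of the translations\<close>

unbundle no vec_syntax

text \<open>Cauchy-Schwarz on the diagonal; the factor \<open>sqrt N\<close> it produces and that of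
  the normalised norm together cancel the \<open>N\<close> in the trace.\<close>

lemma ntrace_bound:
  assumes "A \<in> carrier_mat N N" shows "cmod (ntrace N A) \<le> hs_norm N A"
proof (cases "N = 0")
  case True then show ?thesis by (simp add: ntrace_def)
next
  case False
  have "cmod (\<Sum>i<N. A $$ (i, i)) \<le> (\<Sum>i<N. \<bar>cmod (A $$ (i, i))\<bar> * \<bar>1\<bar>)"
    by (simp add: norm_sum)
  also have "\<dots> \<le> L2_set (\<lambda>i. cmod (A $$ (i, i))) {..<N} * L2_set (\<lambda>i. 1) {..<N}"
    by (rule L2_set_mult_ineq)
  also have "\<dots> = L2_set (\<lambda>i. cmod (A $$ (i, i))) {..<N} * sqrt N" by (simp add: L2_set_constant)
  also have "L2_set (\<lambda>i. cmod (A $$ (i, i))) {..<N} \<le> L2_set (\<lambda>(i, j). cmod (A $$ (i, j))) ({..<N} \<times> {..<N})"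
  proof -
    have "(\<Sum>i<N. (cmod (A $$ (i, i)))\<^sup>2) = (\<Sum>x\<in>(\<lambda>i. (i, i)) ` {..<N}. (case x of (i, j) \<Rightarrow> cmod (A $$ (i, j)))\<^sup>2)"
      by (subst sum.reindex) (auto simp: inj_on_def)
    also have "\<dots> \<le> (\<Sum>x\<in>{..<N} \<times> {..<N}. (case x of (i, j) \<Rightarrow> cmod (A $$ (i, j)))\<^sup>2)"
      by (intro sum_mono2) auto
    finally show ?thesis by (simp add: L2_set_def)
  qed
  also have "L2_set (\<lambda>(i, j). cmod (A $$ (i, j))) ({..<N} \<times> {..<N}) = hs_norm N A * sqrt N"
    using False by (simp add: hs_norm_def)
  finally have "cmod (\<Sum>i<N. A $$ (i, i)) \<le> hs_norm N A * (sqrt N * sqrt N)"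
    by (simp add: mult_right_mono mult.assoc)
  then show ?thesis using False by (simp add: ntrace_def norm_divide field_simps)
qed

lemma ntrace_add: "A \<in> carrier_mat N N \<Longrightarrow> B \<in> carrier_mat N N \<Longrightarrow> ntrace N (A + B) = ntrace N A + ntrace N B"
  by (simp add: ntrace_def sum.distrib add_divide_distrib)

lemma ntrace_smult: "A \<in> carrier_mat N N \<Longrightarrow> ntrace N (c \<cdot>\<^sub>m A) = c * ntrace N A"
  by (simp add: ntrace_def sum_distrib_left)

lemma ntrace_one: "N > 0 \<Longrightarrow> ntrace N (1\<^sub>m N) = 1"
  by (simp add: ntrace_def)

lemma qinner_sum:
  assumes "A \<in> carrier_mat N N" "u \<in> carrier_vec N" "v \<in> carrier_vec N"
  shows "qinner u (A *\<^sub>v v) = (\<Sum>i<N. \<Sum>k<N. cnj (u $ i) * A $$ (i, k) * v $ k)"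
  using assms by (simp add: scalar_prod_def atLeast0LessThan sum_distrib_left mult_ac)

lemma qinner_add:
  assumes "A \<in> carrier_mat N N" "B \<in> carrier_mat N N" "u \<in> carrier_vec N" "v \<in> carrier_vec N"
  shows "qinner u ((A + B) *\<^sub>v v) = qinner u (A *\<^sub>v v) + qinner u (B *\<^sub>v v)"
  using assms by (simp add: qinner_sum[of _ N] sum.distrib distrib_left distrib_right)

lemma qinner_smult:
  assumes "A \<in> carrier_mat N N" "u \<in> carrier_vec N" "v \<in> carrier_vec N"
  shows "qinner u ((c \<cdot>\<^sub>m A) *\<^sub>v v) = c * qinner u (A *\<^sub>v v)"
  using assms by (simp add: qinner_sum[of _ N] sum_distrib_left mult_ac)

lemma qinner_mat_adj:
  assumes "W \<in> carrier_mat N N" "u \<in> carrier_vec N" "v \<in> carrier_vec N"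
  shows "qinner u (mat_adj W *\<^sub>v v) = qinner (W *\<^sub>v u) v"
proof -
  have "qinner u (mat_adj W *\<^sub>v v) = (\<Sum>i<N. \<Sum>k<N. cnj (u $ i) * cnj (W $$ (k, i)) * v $ k)"
    using assms by (simp add: qinner_sum[of _ N])
  also have "\<dots> = (\<Sum>k<N. \<Sum>i<N. v $ k * (cnj (W $$ (k, i)) * cnj (u $ i)))"
    by (subst sum.swap) (simp add: mult_ac)
  also have "\<dots> = qinner (W *\<^sub>v u) v"
    using assms by (simp add: scalar_prod_def atLeast0LessThan sum_distrib_left)
  finally show ?thesis .
qed

text \<open>In any orthonormal basis the diagonal is only part of the matrix, whose Hilbert-Schmidt
  norm does not depend on the basis. This converts smallness in that norm into smallness of the mean
  square of the diagonal elements.\<close>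

lemma hs_norm_diag_basis:
  assumes A: "A \<in> carrier_mat N N" and e: "\<And>j. j \<in> {1..N} \<Longrightarrow> e j \<in> carrier_vec N"
    and on: "\<And>i j. i \<in> {1..N} \<Longrightarrow> j \<in> {1..N} \<Longrightarrow> qinner (e i) (e j) = (if i = j then 1 else 0)"
  shows "(\<Sum>j\<in>{1..N}. (cmod (qinner (e j) (A *\<^sub>v e j)))\<^sup>2) \<le> (hs_norm N A)\<^sup>2 * N"
proof -
  \<comment> \<open>The basis vectors as columns; the successor accounts for basis indices starting
    at 1 and columns at 0.\<close>
  define \<Phi> where "\<Phi> = Matrix.mat N N (\<lambda>(i, j). e (Suc j) $ i)"
  have P: "\<Phi> \<in> carrier_mat N N" by (simp add: \<Phi>_def)
  have "mat_adj \<Phi> * \<Phi> = 1\<^sub>m N"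
  proof (rule eq_matI)
    fix i j assume "i < dim_row (1\<^sub>m N)" "j < dim_col (1\<^sub>m N)"
    then have ij: "i < N" "j < N" by auto
    have "(mat_adj \<Phi> * \<Phi>) $$ (i, j) = (\<Sum>k<N. mat_adj \<Phi> $$ (i, k) * \<Phi> $$ (k, j))"
      using ij P by (intro index_mult_mat_sum) auto
    also have "\<dots> = (\<Sum>k<N. e (Suc j) $ k * cnj (e (Suc i) $ k))"
      using ij by (intro sum.cong) (auto simp: \<Phi>_def)
    also have "\<dots> = qinner (e (Suc i)) (e (Suc j))"
      using e[of "Suc i"] e[of "Suc j"] ij by (simp add: scalar_prod_def atLeast0LessThan)
    finally show "(mat_adj \<Phi> * \<Phi>) $$ (i, j) = 1\<^sub>m N $$ (i, j)"
      using on[of "Suc i" "Suc j"] ij by simp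
  qed (auto simp: \<Phi>_def)
  moreover from this have "\<Phi> * mat_adj \<Phi> = 1\<^sub>m N"
    using P by (intro mat_mult_left_right_inverse[OF _ P]) auto
  ultimately have u: "unitary N \<Phi>" using P by (simp add: unitary_def)
  have q: "unitary_conj \<Phi> A $$ (j, j) = qinner (e (Suc j)) (A *\<^sub>v e (Suc j))" if j: "j < N" for j
  proof -
    have m: "mat_adj \<Phi> \<in> carrier_mat N N" "mat_adj \<Phi> * A \<in> carrier_mat N N"
      using P A by (auto simp: sq_mult[of _ N])
    have "unitary_conj \<Phi> A $$ (j, j) = (\<Sum>k<N. (mat_adj \<Phi> * A) $$ (j, k) * \<Phi> $$ (k, j))"
      unfolding unitary_conj_def using j m P by (intro index_mult_mat_sum) auto
    also have "\<dots> = (\<Sum>k<N. (\<Sum>i<N. mat_adj \<Phi> $$ (j, i) * A $$ (i, k)) * \<Phi> $$ (k, j))"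
      using j m A by (intro sum.cong refl arg_cong2[of _ _ _ _ "(*)"] index_mult_mat_sum) auto
    also have "\<dots> = (\<Sum>k<N. \<Sum>i<N. cnj (e (Suc j) $ i) * A $$ (i, k) * e (Suc j) $ k)"
      using j by (intro sum.cong) (auto simp: \<Phi>_def sum_distrib_right)
    also have "\<dots> = qinner (e (Suc j)) (A *\<^sub>v e (Suc j))"
      using e[of "Suc j"] j A by (subst qinner_sum[of _ N]) (auto intro: sum.swap)
    finally show ?thesis .
  qed
  have "(\<Sum>j\<in>{1..N}. (cmod (qinner (e j) (A *\<^sub>v e j)))\<^sup>2) = (\<Sum>j<N. (cmod (unitary_conj \<Phi> A $$ (j, j)))\<^sup>2)"
  proof -
    have "{1..N} = Suc ` {..<N}" by (auto simp: image_Suc_lessThan)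
    then show ?thesis by (simp add: sum.reindex q)
  qed
  also have "\<dots> \<le> (\<Sum>j<N. \<Sum>k<N. (cmod (unitary_conj \<Phi> A $$ (j, k)))\<^sup>2)"
    by (intro sum_mono member_le_sum[of _ "{..<N}"]) auto
  also have "\<dots> = (hs_norm N A)\<^sup>2 * N"
    using hs_norm_power2[of N "unitary_conj \<Phi> A"] unitary_conj_hs_norm[OF u A] by simp
  finally show ?thesis .
qed

text \<open>Discrete Parseval. Frequencies that differ by less than \<open>N\<close> remain distinct
  modulo \<open>N\<close>, so distinct characters stay orthogonal on the grid.\<close>

lemma rms_orthogonal:
  fixes a :: "nat \<Rightarrow> int"
  assumes "finite T" "inj_on a T" "\<And>t s. t \<in> T \<Longrightarrow> s \<in> T \<Longrightarrow> \<bar>a t - a s\<bar> < int N" "N > 0"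
  shows "(rms N (\<lambda>x. \<Sum>t\<in>T. echar (a t) x))\<^sup>2 = card T"
proof -
  have c: "complex_of_real ((cmod z)\<^sup>2) = z * cnj z" for z
    by (simp add: complex_norm_square del: of_real_power)
  have "complex_of_real ((rms N (\<lambda>x. \<Sum>t\<in>T. echar (a t) x))\<^sup>2 * N) =
    (\<Sum>j<N. \<Sum>t\<in>T. \<Sum>s\<in>T. echar (a t) (real j / real N) * echar (- a s) (real j / real N))"
    unfolding rms_power2 of_real_sum c cnj_sum sum_product echar_minus ..
  also have "\<dots> = (\<Sum>t\<in>T. \<Sum>s\<in>T. \<Sum>j<N. echar (a t - a s) (real j / real N))"
    by (subst sum.swap, rule sum.cong[OF refl], subst sum.swap) (simp add: echar_add[symmetric])
  also have "\<dots> = (\<Sum>t\<in>T. \<Sum>s\<in>T. if s = t then of_nat N else 0)"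
  proof (intro sum.cong refl)
    fix t s assume ts: "t \<in> T" "s \<in> T"
    have "int N dvd a t - a s \<longleftrightarrow> s = t"
    proof
      assume "int N dvd a t - a s"
      then have "a t - a s = 0" using assms(3)[OF ts] dvd_imp_le_int[of "a t - a s" "int N"] by fastforce
      then show "s = t" using assms(2) ts by (auto simp: inj_on_def)
    qed simp
    then show "(\<Sum>j<N. echar (a t - a s) (real j / real N)) = (if s = t then of_nat N else 0)"
      using root_sum[OF assms(4)] by simp
  qed
  also have "\<dots> = complex_of_real (card T * N)" using assms(1) by simp
  finally have "(rms N (\<lambda>x. \<Sum>t\<in>T. echar (a t) x))\<^sup>2 * N = card T * N" by (simp only: of_real_eq_iff)
  then show ?thesis using assms(4) by simp
qed

primrec ergodic_sum :: "nat \<Rightarrow> nat \<Rightarrow> complex mat \<Rightarrow> complex mat" where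
  "ergodic_sum 0 n A = 0\<^sub>m (2 * n) (2 * n)"
| "ergodic_sum (Suc M) n A = ergodic_sum M n A + evolve M n A"

lemma ergodic_sum_carrier [simp]: "A \<in> carrier_mat (2 * n) (2 * n) \<Longrightarrow> ergodic_sum M n A \<in> carrier_mat (2 * n) (2 * n)"
  by (induction M) auto

lemma ergodic_sum_echar:
  "hs_eq (\<lambda>n. ergodic_sum M n (position_op (2 * n) (echar k))) (\<lambda>n. position_op (2 * n) (\<lambda>x. \<Sum>t<M. echar (2 ^ t * k) x))"
proof (induction M)
  case 0
  have "position_op (2 * n) (\<lambda>x. 0) = 0\<^sub>m (2 * n) (2 * n)" for n by (rule eq_matI) auto
  then show ?case using hs_eq_refl[of "\<lambda>n. 0\<^sub>m (2 * n) (2 * n)"] by (simp add: op_seq_def)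
next
  case (Suc M)
  have p: "echar k (2 ^ i * x) = echar (2 ^ i * k) x" for i x by (simp add: echar_def mult_ac)
  have "hs_eq (\<lambda>n. evolve M n (position_op (2 * n) (echar k))) (\<lambda>n. position_op (2 * n) (\<lambda>x. echar k (2 ^ M * x)))"
  proof (rule egorov_position)
    show "trig_approximable (\<lambda>x. echar k (2 ^ i * x))" for i unfolding p by (intro trig_approximable_trig trig_poly.base)
  qed (rule echar_periodic)
  then have "hs_eq (\<lambda>n. evolve M n (position_op (2 * n) (echar k))) (\<lambda>n. position_op (2 * n) (echar (2 ^ M * k)))" unfolding p .
  from hs_eq_add[OF _ _ _ _ Suc.IH this] show ?case by (simp add: op_seq_def position_op_add[symmetric])
qed

section \<open>Quantum variance in eigenbases of the baker's map\<close>

locale quantum_eigenbases =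
  fixes e :: "nat \<Rightarrow> nat \<Rightarrow> complex vec"
  assumes e_carrier: "\<And>n j. j \<in> {1..2 * n} \<Longrightarrow> e n j \<in> carrier_vec (2 * n)"
    and e_on: "\<And>n i j. i \<in> {1..2 * n} \<Longrightarrow> j \<in> {1..2 * n} \<Longrightarrow> qinner (e n i) (e n j) = (if i = j then 1 else 0)"
    and e_eig: "\<And>n j. j \<in> {1..2 * n} \<Longrightarrow> \<exists>l. baker_map n *\<^sub>v e n j = l \<cdot>\<^sub>v e n j"
begin

text \<open>Centring by the trace in the given dimension, instead of its limit, makes this quantity
  exactly invariant under the evolution and exactly linear in \<open>A\<close>.\<close>

definition deviation :: "nat \<Rightarrow> complex mat \<Rightarrow> nat \<Rightarrow> complex" where
  "deviation n A j = qinner (e n j) (A *\<^sub>v e n j) - ntrace (2 * n) A"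

text \<open>The square root of the quantum variance. In this form it satisfies the triangle
  inequality, so approximation errors simply add up.\<close>

definition rms_deviation :: "nat \<Rightarrow> complex mat \<Rightarrow> real" where
  "rms_deviation n A = L2_set (\<lambda>j. cmod (deviation n A j)) {1..2 * n} / sqrt (2 * n)"

definition quantum_ergodic :: "(nat \<Rightarrow> complex mat) \<Rightarrow> bool" where
  "quantum_ergodic A \<longleftrightarrow> (\<lambda>n. rms_deviation n (A n)) \<longlonglongrightarrow> 0"

lemma rms_deviation_nonneg [simp]: "0 \<le> rms_deviation n A" by (simp add: rms_deviation_def)

lemma deviation_add:
  assumes "A \<in> carrier_mat (2 * n) (2 * n)" "B \<in> carrier_mat (2 * n) (2 * n)" "j \<in> {1..2 * n}"
  shows "deviation n (A + B) j = deviation n A j + deviation n B j"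
  using assms e_carrier[of j n] by (simp add: deviation_def ntrace_add qinner_add[of _ "2 * n"])

lemma deviation_smult:
  assumes "A \<in> carrier_mat (2 * n) (2 * n)" "j \<in> {1..2 * n}"
  shows "deviation n (c \<cdot>\<^sub>m A) j = c * deviation n A j"
  using assms e_carrier[of j n] by (simp add: deviation_def ntrace_smult qinner_smult[of _ "2 * n"] right_diff_distrib)

lemma eig_norm:
  assumes j: "j \<in> {1..2 * n}" and l: "baker_map n *\<^sub>v e n j = l \<cdot>\<^sub>v e n j"
  shows "cnj l * l = 1"
proof -
  let ?N = "2 * n"
  have U: "baker_map n \<in> carrier_mat ?N ?N" "mat_adj (baker_map n) * baker_map n = 1\<^sub>m ?N"
    using baker_map_unitary[of n] by (auto simp: unitary_def)
  have c: "e n j \<in> carrier_vec ?N" using e_carrier[OF j] .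
  have "qinner (baker_map n *\<^sub>v e n j) (baker_map n *\<^sub>v e n j) = qinner (e n j) (mat_adj (baker_map n) *\<^sub>v (baker_map n *\<^sub>v e n j))"
    using qinner_mat_adj[OF U(1) c, of "baker_map n *\<^sub>v e n j"] U c by simp
  also have "mat_adj (baker_map n) *\<^sub>v (baker_map n *\<^sub>v e n j) = e n j"
    using U c assoc_mult_mat_vec[of "mat_adj (baker_map n)" ?N ?N "baker_map n" ?N "e n j"] by simp
  also have "qinner (baker_map n *\<^sub>v e n j) (baker_map n *\<^sub>v e n j) = l * (cnj l * qinner (e n j) (e n j))"
    unfolding l using c by (simp add: scalar_prod_def sum_distrib_left mult_ac)
  finally show ?thesis using e_on[OF j j] by (simp add: mult.commute)
qed

text \<open>The eigenvalue occurs once conjugated and once not, and has modulus 1; the trace is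
  invariant under conjugation.\<close>

lemma deviation_unitary_conj:
  assumes A: "A \<in> carrier_mat (2 * n) (2 * n)" and j: "j \<in> {1..2 * n}"
  shows "deviation n (unitary_conj (baker_map n) A) j = deviation n A j"
proof -
  let ?N = "2 * n"
  have U: "baker_map n \<in> carrier_mat ?N ?N" "mat_adj (baker_map n) \<in> carrier_mat ?N ?N"
    using baker_map_unitary[of n] by (auto simp: unitary_def)
  have c: "e n j \<in> carrier_vec ?N" using e_carrier[OF j] .
  obtain l where l: "baker_map n *\<^sub>v e n j = l \<cdot>\<^sub>v e n j" using e_eig[OF j] by blast
  have "unitary_conj (baker_map n) A *\<^sub>v e n j = mat_adj (baker_map n) *\<^sub>v (A *\<^sub>v (baker_map n *\<^sub>v e n j))"
    unfolding unitary_conj_def using U A c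
    by (simp add: assoc_mult_mat_vec[of _ ?N ?N _ ?N] sq_mult[of _ ?N])
  then have "qinner (e n j) (unitary_conj (baker_map n) A *\<^sub>v e n j) = qinner (l \<cdot>\<^sub>v e n j) (A *\<^sub>v (l \<cdot>\<^sub>v e n j))"
    using qinner_mat_adj[OF U(1) c, of "A *\<^sub>v (baker_map n *\<^sub>v e n j)"] A l c by simp
  also have "\<dots> = (cnj l * l) * qinner (e n j) (A *\<^sub>v e n j)"
    using A c by (simp add: qinner_sum[of _ ?N] sum_distrib_left mult_ac)
  finally show ?thesis
    using eig_norm[OF j l] unitary_conj_ntrace[OF baker_map_unitary A] by (simp add: deviation_def)
qed

lemma deviation_evolve:
  assumes "A \<in> carrier_mat (2 * n) (2 * n)" "j \<in> {1..2 * n}"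
  shows "deviation n (evolve m n A) j = deviation n A j"
  using assms by (induction m) (auto simp: evolve_Suc deviation_unitary_conj)

lemma rms_deviation_cong: "(\<And>j. j \<in> {1..2 * n} \<Longrightarrow> cmod (deviation n A j) = cmod (deviation n B j)) \<Longrightarrow> rms_deviation n A = rms_deviation n B"
  unfolding rms_deviation_def by (intro arg_cong2[of _ _ _ _ "(/)"] L2_set_cong) auto

lemma rms_deviation_evolve: "A \<in> carrier_mat (2 * n) (2 * n) \<Longrightarrow> rms_deviation n (evolve m n A) = rms_deviation n A"
  by (intro rms_deviation_cong) (simp add: deviation_evolve)

lemma rms_deviation_add:
  assumes "A \<in> carrier_mat (2 * n) (2 * n)" "B \<in> carrier_mat (2 * n) (2 * n)"
  shows "rms_deviation n (A + B) \<le> rms_deviation n A + rms_deviation n B"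
proof -
  have "L2_set (\<lambda>j. cmod (deviation n (A + B) j)) {1..2 * n} \<le> L2_set (\<lambda>j. cmod (deviation n A j) + cmod (deviation n B j)) {1..2 * n}"
    using assms by (intro L2_set_mono) (auto simp: deviation_add norm_triangle_ineq)
  also have "\<dots> \<le> L2_set (\<lambda>j. cmod (deviation n A j)) {1..2 * n} + L2_set (\<lambda>j. cmod (deviation n B j)) {1..2 * n}"
    by (rule L2_set_triangle_ineq)
  finally show ?thesis by (simp add: rms_deviation_def add_divide_distrib[symmetric] divide_right_mono)
qed

lemma rms_deviation_smult:
  assumes "A \<in> carrier_mat (2 * n) (2 * n)"
  shows "rms_deviation n (c \<cdot>\<^sub>m A) = cmod c * rms_deviation n A"
proof -
  have "L2_set (\<lambda>j. cmod (deviation n (c \<cdot>\<^sub>m A) j)) {1..2 * n} = L2_set (\<lambda>j. cmod c * cmod (deviation n A j)) {1..2 * n}"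
    using assms by (intro L2_set_cong) (auto simp: deviation_smult norm_mult)
  then show ?thesis by (simp add: rms_deviation_def L2_set_right_distrib)
qed

text \<open>One of the two norms pays for the diagonal elements, the other for the trace.\<close>

lemma rms_deviation_le:
  assumes A: "A \<in> carrier_mat (2 * n) (2 * n)"
  shows "rms_deviation n A \<le> 2 * hs_norm (2 * n) A"
proof (cases "n = 0")
  case True then show ?thesis by (simp add: rms_deviation_def)
next
  case False
  have "L2_set (\<lambda>j. cmod (deviation n A j)) {1..2 * n} \<le>
    L2_set (\<lambda>j. cmod (qinner (e n j) (A *\<^sub>v e n j)) + cmod (ntrace (2 * n) A)) {1..2 * n}"
    unfolding deviation_def by (intro L2_set_mono norm_triangle_ineq4) auto
  also have "\<dots> \<le> L2_set (\<lambda>j. cmod (qinner (e n j) (A *\<^sub>v e n j))) {1..2 * n} + L2_set (\<lambda>j. cmod (ntrace (2 * n) A)) {1..2 * n}"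
    by (rule L2_set_triangle_ineq)
  also have "\<dots> \<le> hs_norm (2 * n) A * sqrt (2 * n) + hs_norm (2 * n) A * sqrt (2 * n)"
  proof (rule add_mono)
    have "L2_set (\<lambda>j. cmod (qinner (e n j) (A *\<^sub>v e n j))) {1..2 * n} \<le> sqrt ((hs_norm (2 * n) A)\<^sup>2 * (2 * n))"
      unfolding L2_set_def using hs_norm_diag_basis[of A "2 * n" "e n"] A e_carrier e_on
      by (intro real_sqrt_le_mono) simp
    also have "\<dots> = hs_norm (2 * n) A * sqrt (2 * n)" by (simp add: real_sqrt_mult)
    finally show "L2_set (\<lambda>j. cmod (qinner (e n j) (A *\<^sub>v e n j))) {1..2 * n} \<le> hs_norm (2 * n) A * sqrt (2 * n)" .
    show "L2_set (\<lambda>j. cmod (ntrace (2 * n) A)) {1..2 * n} \<le> hs_norm (2 * n) A * sqrt (2 * n)"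
      using ntrace_bound[OF A] by (simp add: L2_set_constant mult.commute mult_left_mono)
  qed
  finally show ?thesis using False by (simp add: rms_deviation_def field_simps)
qed

lemma rms_deviation_diff:
  assumes "A \<in> carrier_mat (2 * n) (2 * n)" "B \<in> carrier_mat (2 * n) (2 * n)"
  shows "rms_deviation n A \<le> 2 * hs_norm (2 * n) (A - B) + rms_deviation n B"
proof -
  have "A = (A - B) + B" by (rule eq_matI) (use assms in auto)
  then have "rms_deviation n A \<le> rms_deviation n (A - B) + rms_deviation n B" using rms_deviation_add[of "A - B" n B] assms by (metis minus_carrier_mat)
  then show ?thesis using rms_deviation_le[of "A - B" n] assms by (simp add: minus_carrier_mat)
qed

lemma rms_deviation_one: "rms_deviation n (1\<^sub>m (2 * n)) = 0"
proof -
  have "deviation n (1\<^sub>m (2 * n)) j = 0" if "j \<in> {1..2 * n}" for j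
    using that e_carrier[OF that] e_on[OF that that] ntrace_one[of "2 * n"] by (simp add: deviation_def)
  then have "L2_set (\<lambda>j. cmod (deviation n (1\<^sub>m (2 * n)) j)) {1..2 * n} = 0" by (intro L2_set_0') auto
  then show ?thesis by (simp add: rms_deviation_def)
qed

lemma deviation_ergodic_sum:
  assumes "A \<in> carrier_mat (2 * n) (2 * n)" "j \<in> {1..2 * n}"
  shows "deviation n (ergodic_sum M n A) j = of_nat M * deviation n A j"
proof (induction M)
  case 0
  have "deviation n (0\<^sub>m (2 * n) (2 * n)) j = 0"
    using deviation_smult[of "0\<^sub>m (2 * n) (2 * n)" n j 0] assms(2) by simp
  then show ?case by simp
next
  case (Suc M)
  then show ?case using assms by (simp add: deviation_add deviation_evolve distrib_right)
qed

text \<open>All evolved copies have the same deviation, so that of the sum over \<open>M\<close>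
  steps is \<open>M\<close> times larger. That sum is close to a sum of \<open>M\<close> orthogonal
  characters, of norm only \<open>sqrt M\<close>; dividing by \<open>M\<close> leaves a bound of
  order \<open>1 / sqrt M\<close>.\<close>

lemma quantum_ergodic_echar: "quantum_ergodic (\<lambda>n. position_op (2 * n) (echar k))"
proof (cases "k = 0")
  case True
  have "position_op (2 * n) (echar 0) = 1\<^sub>m (2 * n)" for n by (rule eq_matI) auto
  then show ?thesis using True by (simp add: quantum_ergodic_def rms_deviation_one)
next
  case False
  show ?thesis unfolding quantum_ergodic_def
  proof (rule tendsto_0I)
    fix \<epsilon> :: real assume e: "\<epsilon> > 0"
    \<comment> \<open>The constant 4 makes \<open>2 * sqrt M\<close> at most
      \<open>M * \<epsilon> / 2\<close>. The other half of \<open>M * \<epsilon>\<close> is twice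
      the error \<open>M * \<epsilon> / 4\<close> allowed for the evolution.\<close>
    obtain M :: nat where M: "M > 0" "sqrt M * \<epsilon> \<ge> 4"
    proof -
      obtain M :: nat where "real M > (4 / \<epsilon>)\<^sup>2" using reals_Archimedean2 by blast
      moreover from this have "sqrt M \<ge> 4 / \<epsilon>" by (intro real_le_rsqrt) simp
      ultimately show ?thesis using that[of M] e by (cases "M = 0") (auto simp: field_simps)
    qed
    let ?S = "\<lambda>x. \<Sum>t<M. echar (2 ^ t * k) x"
    have "\<forall>\<^sub>F n in sequentially. hs_norm (2 * n) (ergodic_sum M n (position_op (2 * n) (echar k)) - position_op (2 * n) ?S) < M * \<epsilon> / 4"
      using order_tendstoD(2)[OF ergodic_sum_echar[unfolded hs_eq_def], of "M * \<epsilon> / 4" M k] e M by simp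
    then show "\<forall>\<^sub>F n in sequentially. rms_deviation n (position_op (2 * n) (echar k)) \<le> \<epsilon>"
      \<comment> \<open>Beyond this \<open>n\<close> all frequencies \<open>2 ^ t * k\<close> with
        \<open>t < M\<close> differ by less than \<open>2 * n\<close>, so they do not alias on the
        grid.\<close>
      using eventually_ge_at_top[of "nat (2 ^ M * \<bar>k\<bar>) + 1"]
    proof eventually_elim
      case (elim n)
      have "(rms (2 * n) ?S)\<^sup>2 = card {..<M}"
      proof (rule rms_orthogonal)
        show "inj_on (\<lambda>t. 2 ^ t * k) {..<M}" using False by (auto simp: inj_on_def)
        fix t s assume ts: "t \<in> {..<M}" "s \<in> {..<M}"
        have "\<bar>2 ^ t * k - 2 ^ s * k\<bar> \<le> 2 ^ t * \<bar>k\<bar> + 2 ^ s * \<bar>k\<bar>"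
          using abs_triangle_ineq4[of "2 ^ t * k" "2 ^ s * k"] by (simp add: abs_mult)
        also have "\<dots> \<le> 2 ^ M * \<bar>k\<bar> + 2 ^ M * \<bar>k\<bar>"
          using ts by (intro add_mono mult_right_mono power_increasing) auto
        also have "\<dots> < int (2 * n)"
        proof -
          have "int (nat (2 ^ M * \<bar>k\<bar>)) = 2 ^ M * \<bar>k\<bar>" by simp
          then show ?thesis using elim(2) by linarith
        qed
        finally show "\<bar>2 ^ t * k - 2 ^ s * k\<bar> < int (2 * n)" .
      qed (use elim in auto)
      then have S: "rms (2 * n) ?S = sqrt M" by (simp add: real_sqrt_unique[symmetric])
      have "M * rms_deviation n (position_op (2 * n) (echar k)) = rms_deviation n (of_nat M \<cdot>\<^sub>m position_op (2 * n) (echar k))"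
        by (simp add: rms_deviation_smult)
      also have "\<dots> = rms_deviation n (ergodic_sum M n (position_op (2 * n) (echar k)))"
        by (intro rms_deviation_cong) (simp add: deviation_smult deviation_ergodic_sum)
      also have "\<dots> \<le> 2 * hs_norm (2 * n) (ergodic_sum M n (position_op (2 * n) (echar k)) - position_op (2 * n) ?S) + rms_deviation n (position_op (2 * n) ?S)"
        by (intro rms_deviation_diff) auto
      also have "rms_deviation n (position_op (2 * n) ?S) \<le> 2 * hs_norm (2 * n) (position_op (2 * n) ?S)" by (intro rms_deviation_le) auto
      also have "\<dots> = 2 * sqrt M" using S by (simp add: hs_norm_position_op)
      finally have "M * rms_deviation n (position_op (2 * n) (echar k)) \<le> 2 * (M * \<epsilon> / 4) + 2 * sqrt M" using elim(1) by linarith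
      also have "2 * sqrt M \<le> sqrt M * (sqrt M * \<epsilon>) / 2" using mult_left_mono[OF M(2), of "sqrt M"] by simp
      also have "2 * (M * \<epsilon> / 4) + sqrt M * (sqrt M * \<epsilon>) / 2 = M * \<epsilon>" by (simp flip: mult.assoc)
      finally show ?case using M by simp
    qed
  qed simp
qed

lemma quantum_ergodic_trig: "trig_poly f \<Longrightarrow> quantum_ergodic (\<lambda>n. position_op (2 * n) f)"
proof (induction rule: trig_poly.induct)
  case (base k)
  show ?case by (rule quantum_ergodic_echar)
next
  case (add f g)
  have "(\<lambda>n. rms_deviation n (position_op (2 * n) f) + rms_deviation n (position_op (2 * n) g)) \<longlonglongrightarrow> 0"
    using tendsto_add[OF add.IH[unfolded quantum_ergodic_def]] by simp
  then show ?case unfolding quantum_ergodic_def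
    by (rule Lim_null_comparison[rotated]) (auto simp: position_op_add rms_deviation_add)
next
  case (smult f c)
  have "(\<lambda>n. cmod c * rms_deviation n (position_op (2 * n) f)) \<longlonglongrightarrow> 0"
    using tendsto_mult[OF tendsto_const smult.IH[unfolded quantum_ergodic_def]] by simp
  then show ?case by (simp add: quantum_ergodic_def position_op_smult rms_deviation_smult)
qed

lemma filterlim_double: "filterlim (\<lambda>n::nat. 2 * n) sequentially sequentially"
  by (intro filterlim_subseq) (simp add: strict_mono_def)

lemma quantum_ergodic_trig_approximable:
  assumes "trig_approximable f" shows "quantum_ergodic (\<lambda>n. position_op (2 * n) f)"
  unfolding quantum_ergodic_def
proof (rule tendsto_0I)
  fix \<epsilon> :: real assume e: "\<epsilon> > 0"
  then have "\<epsilon> / 4 > 0" by simp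
  with assms obtain P where P: "trig_poly P" "\<forall>\<^sub>F N in sequentially. rms N (\<lambda>x. f x - P x) \<le> \<epsilon> / 4"
    unfolding trig_approximable_def by blast
  from eventually_compose_filterlim[OF P(2) filterlim_double]
  have P2: "\<forall>\<^sub>F n in sequentially. rms (2 * n) (\<lambda>x. f x - P x) \<le> \<epsilon> / 4" .
  have "\<forall>\<^sub>F n in sequentially. rms_deviation n (position_op (2 * n) P) < \<epsilon> / 2"
    using order_tendstoD(2)[OF quantum_ergodic_trig[OF P(1), unfolded quantum_ergodic_def], of "\<epsilon> / 2"] e by simp
  with P2 show "\<forall>\<^sub>F n in sequentially. rms_deviation n (position_op (2 * n) f) \<le> \<epsilon>"
  proof eventually_elim
    case (elim n)
    have "rms_deviation n (position_op (2 * n) f) \<le> 2 * hs_norm (2 * n) (position_op (2 * n) f - position_op (2 * n) P) + rms_deviation n (position_op (2 * n) P)"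
      by (intro rms_deviation_diff) auto
    then show ?case using elim by (simp add: position_op_minus[symmetric] hs_norm_position_op)
  qed
qed simp

lemma echar_step_approx:
  assumes "\<epsilon> > 0"
  obtains m where "\<And>x. 0 \<le> x \<Longrightarrow> x < 1 \<Longrightarrow> cmod (echar k x - echar k (of_int \<lfloor>2 ^ m * x\<rfloor> / 2 ^ m)) \<le> \<epsilon>"
proof -
  have "uniformly_continuous_on {0..1} (echar k)"
    unfolding echar_def by (intro compact_uniformly_continuous continuous_intros) auto
  then obtain \<delta> where d: "\<delta> > 0" "\<And>x y. x \<in> {0..1} \<Longrightarrow> y \<in> {0..1} \<Longrightarrow> dist y x < \<delta> \<Longrightarrow> dist (echar k y) (echar k x) < \<epsilon>"
    unfolding uniformly_continuous_on_def using assms by metis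
  obtain m where m: "(1 / 2 :: real) ^ m < \<delta>" using real_arch_pow_inv[OF d(1), of "1 / 2"] by auto
  show ?thesis
  proof (rule that[of m])
    fix x :: real assume x: "0 \<le> x" "x < 1"
    define y where "y = real_of_int \<lfloor>2 ^ m * x\<rfloor> / 2 ^ m"
    have "real_of_int \<lfloor>2 ^ m * x\<rfloor> \<ge> 0" using x by simp
    moreover have fl: "real_of_int \<lfloor>2 ^ m * x\<rfloor> \<le> 2 ^ m * x" "2 ^ m * x < real_of_int \<lfloor>2 ^ m * x\<rfloor> + 1" by linarith+
    ultimately have y: "0 \<le> y" "y \<le> x"
      by (auto simp: y_def field_simps)
    have "x - y = (2 ^ m * x - real_of_int \<lfloor>2 ^ m * x\<rfloor>) / 2 ^ m" by (simp add: y_def field_simps)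
    also have "2 ^ m * x - real_of_int \<lfloor>2 ^ m * x\<rfloor> < 1" using fl(2) by linarith
    finally have "x - y < (1 / 2) ^ m" by (simp add: power_divide divide_strict_right_mono)
    then have "dist (echar k x) (echar k y) < \<epsilon>"
      using x y m by (intro d(2)) (auto simp: dist_real_def)
    then show "cmod (echar k x - echar k (of_int \<lfloor>2 ^ m * x\<rfloor> / 2 ^ m)) \<le> \<epsilon>"
      by (simp add: dist_norm y_def)
  qed
qed

text \<open>Freezing the momentum phase at dyadic scale \<open>2 ^ -m\<close> costs little uniformly
  in \<open>n\<close>. Evolving the product for \<open>m\<close> steps leaves its deviation
  unchanged and makes both factors functions of position, where ergodicity is known.\<close>

lemma quantum_ergodic_product: "quantum_ergodic (\<lambda>n. momentum_op (2 * n) (echar k) * position_op (2 * n) (echar l))"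
  unfolding quantum_ergodic_def
proof (rule tendsto_0I)
  fix \<epsilon> :: real assume e: "\<epsilon> > 0"
  \<comment> \<open>Freezing the phase, evolving the momentum factor and evolving the position
    factor cost \<open>\<epsilon> / 8\<close> each. Their sum is doubled on passing to deviations,
    and the position function itself adds the remaining \<open>\<epsilon> / 4\<close>.\<close>
  then have "\<epsilon> / 8 > 0" by simp
  then obtain m where m: "\<And>x. 0 \<le> x \<Longrightarrow> x < 1 \<Longrightarrow> cmod (echar k x - echar k (of_int \<lfloor>2 ^ m * x\<rfloor> / 2 ^ m)) \<le> \<epsilon> / 8"
    using echar_step_approx by blast
  define g where "g x = echar k (of_int \<lfloor>2 ^ m * x\<rfloor> / 2 ^ m)" for x :: real
  obtain h C where h: "trig_approximable h" "\<And>x. cmod (h x) \<le> C" "hs_eq (\<lambda>n. evolve m n (momentum_op (2 * n) g)) (\<lambda>n. position_op (2 * n) h)"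
    using egorov_momentum[of "\<lambda>c. echar k (of_int c / 2 ^ m)" 1 m] unfolding g_def by auto
  have p: "echar l (2 ^ i * x) = echar (2 ^ i * l) x" for i x by (simp add: echar_def mult_ac)
  have "hs_eq (\<lambda>n. evolve m n (position_op (2 * n) (echar l))) (\<lambda>n. position_op (2 * n) (\<lambda>x. echar l (2 ^ m * x)))"
  proof (rule egorov_position)
    show "trig_approximable (\<lambda>x. echar l (2 ^ i * x))" for i unfolding p by (intro trig_approximable_trig trig_poly.base)
  qed (rule echar_periodic)
  then have pos: "hs_eq (\<lambda>n. evolve m n (position_op (2 * n) (echar l))) (\<lambda>n. position_op (2 * n) (echar (2 ^ m * l)))" unfolding p .
  let ?f = "\<lambda>x. h x * echar (2 ^ m * l) x"
  have "quantum_ergodic (\<lambda>n. position_op (2 * n) ?f)"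
    by (intro quantum_ergodic_trig_approximable trig_approximable_mult[where B = C] h trig_approximable_trig trig_poly.base)
  then have "\<forall>\<^sub>F n in sequentially. rms_deviation n (position_op (2 * n) ?f) < \<epsilon> / 4"
    unfolding quantum_ergodic_def using order_tendstoD(2)[of _ 0 _ "\<epsilon> / 4"] e by simp
  moreover have "\<forall>\<^sub>F n in sequentially. hs_norm (2 * n) (evolve m n (momentum_op (2 * n) g) - position_op (2 * n) h) < \<epsilon> / 8"
    using order_tendstoD(2)[OF h(3)[unfolded hs_eq_def], of "\<epsilon> / 8"] e by simp
  moreover have "\<forall>\<^sub>F n in sequentially. hs_norm (2 * n) (evolve m n (position_op (2 * n) (echar l)) - position_op (2 * n) (echar (2 ^ m * l))) < \<epsilon> / 8"
    using order_tendstoD(2)[OF pos[unfolded hs_eq_def], of "\<epsilon> / 8"] e by simp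
  ultimately show "\<forall>\<^sub>F n in sequentially. rms_deviation n (momentum_op (2 * n) (echar k) * position_op (2 * n) (echar l)) \<le> \<epsilon>"
  proof eventually_elim
    case (elim n)
    let ?X = "evolve m n (momentum_op (2 * n) (echar k))" and ?Y = "evolve m n (position_op (2 * n) (echar l))"
    have c: "?X \<in> carrier_mat (2 * n) (2 * n)" "?Y \<in> carrier_mat (2 * n) (2 * n)" by auto
    have l: "left_bounded (2 * n) 1 ?X"
      unfolding momentum_op_unitary_conj by (intro evolve_left_bounded left_bounded_unitary_conj[OF dft_unitary] left_bounded_position_op) (auto simp: unitary_conj_carrier[OF dft_unitary])
    have "hs_norm (2 * n) (?X - evolve m n (momentum_op (2 * n) g)) = rms (2 * n) (\<lambda>x. echar k x - g x)"
      by (simp add: evolve_minus[symmetric] momentum_op_minus[symmetric] evolve_hs_norm hs_norm_momentum_op)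
    also have "\<dots> \<le> \<epsilon> / 8"
    proof (rule rms_bound)
      fix j assume "j < 2 * n"
      then show "cmod (echar k (real j / real (2 * n)) - g (real j / real (2 * n))) \<le> \<epsilon> / 8"
        unfolding g_def by (intro m) auto
    qed (use e in simp)
    finally have "hs_norm (2 * n) (?X - position_op (2 * n) h) \<le> \<epsilon> / 8 + \<epsilon> / 8"
      using hs_norm_diff_triangle[of ?X "2 * n" "evolve m n (momentum_op (2 * n) g)" "position_op (2 * n) h"] elim by simp
    moreover have "hs_norm (2 * n) (?X * ?Y - position_op (2 * n) h * position_op (2 * n) (echar (2 ^ m * l)))
      \<le> 1 * hs_norm (2 * n) (?Y - position_op (2 * n) (echar (2 ^ m * l))) + 1 * hs_norm (2 * n) (?X - position_op (2 * n) h)"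
      by (rule hs_norm_mult_diff[OF c(1) _ c(2) l]) auto
    ultimately have "hs_norm (2 * n) (?X * ?Y - position_op (2 * n) ?f) \<le> 3 * \<epsilon> / 8"
      using elim by (simp add: position_op_mult)
    moreover have "rms_deviation n (?X * ?Y) \<le> 2 * hs_norm (2 * n) (?X * ?Y - position_op (2 * n) ?f) + rms_deviation n (position_op (2 * n) ?f)"
      using c by (intro rms_deviation_diff) (auto simp: sq_mult[of _ "2 * n"])
    moreover have "rms_deviation n (?X * ?Y) = rms_deviation n (momentum_op (2 * n) (echar k) * position_op (2 * n) (echar l))"
      by (simp add: evolve_mult[symmetric] rms_deviation_evolve sq_mult[of _ "2 * n"])
    ultimately show ?case using elim by simp
  qed
qed simp

text \<open>The shift by \<open>k1\<close> is the momentum operator of \<open>echar (- k1)\<close>,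
  with the sign from \<open>momentum_op_echar\<close>. The prefactor depends on \<open>N\<close>,
  but having modulus 1 it does not affect the variance.\<close>

lemma translation_eq:
  "translation N (k1, k2) = cis (pi * of_int k1 * of_int k2 / real N) \<cdot>\<^sub>m (momentum_op N (echar (- k1)) * position_op N (echar k2))"
proof (rule eq_matI)
  fix i j assume "i < dim_row (cis (pi * of_int k1 * of_int k2 / real N) \<cdot>\<^sub>m (momentum_op N (echar (- k1)) * position_op N (echar k2)))"
    "j < dim_col (cis (pi * of_int k1 * of_int k2 / real N) \<cdot>\<^sub>m (momentum_op N (echar (- k1)) * position_op N (echar k2)))"
  then have ij: "i < N" "j < N" by auto
  have "int N dvd - k1 + int i - int j \<longleftrightarrow> int i mod int N = (int j + k1) mod int N"
    by (simp add: mod_eq_dvd_iff algebra_simps)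
  then have "int N dvd - k1 + int i - int j \<longleftrightarrow> int i = (int j + k1) mod int N"
    using ij by simp
  then show "translation N (k1, k2) $$ (i, j) = (cis (pi * of_int k1 * of_int k2 / real N) \<cdot>\<^sub>m (momentum_op N (echar (- k1)) * position_op N (echar k2))) $$ (i, j)"
    using ij position_op_right[OF momentum_op_carrier ij, of "echar (- k1)" "echar k2"]
    by (simp add: translation_def momentum_op_echar echar_def mult_ac del: index_mult_mat(1))
qed (auto simp: translation_def)

lemma translation_carrier [simp]: "translation N k \<in> carrier_mat N N"
  by (cases k) (simp add: translation_def)

lemma quantum_ergodic_translation: "quantum_ergodic (\<lambda>n. translation (2 * n) k)"
proof (cases k)
  case (Pair k1 k2)
  then show ?thesis using quantum_ergodic_product[of "- k1" k2]
    by (simp add: quantum_ergodic_def translation_eq rms_deviation_smult sq_mult[of _ "2 * _"])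
qed

text \<open>A genuine shift has no diagonal entries, and a pure character has vanishing sum over the
  grid. The bounds on \<open>k\<close> ensure that neither becomes trivial modulo
  \<open>N\<close>.\<close>

lemma ntrace_translation:
  assumes "k \<noteq> (0, 0)" "int N > \<bar>fst k\<bar>" "int N > \<bar>snd k\<bar>"
  shows "ntrace N (translation N k) = 0"
proof -
  obtain k1 k2 where k: "k = (k1, k2)" by fastforce
  have N: "N > 0" using assms(2) by linarith
  have nd: "\<not> int N dvd x" if "x \<noteq> 0" "\<bar>x\<bar> < int N" for x using that dvd_imp_le_int[of x "int N"] by auto
  have "ntrace N (momentum_op N (echar (- k1)) * position_op N (echar k2)) = 0"
  proof (cases "k1 = 0")
    case False
    then have "(momentum_op N (echar (- k1)) * position_op N (echar k2)) $$ (i, i) = 0" if "i < N" for i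
      using that nd[of "- k1"] assms(2) k by (simp add: position_op_right[OF momentum_op_carrier] momentum_op_echar del: index_mult_mat(1))
    then show ?thesis by (simp add: ntrace_def del: index_mult_mat(1))
  next
    case True
    then have "(\<Sum>i<N. (momentum_op N (echar (- k1)) * position_op N (echar k2)) $$ (i, i)) = (\<Sum>i<N. echar k2 (real i / real N))"
      by (intro sum.cong) (auto simp: position_op_right[OF momentum_op_carrier] momentum_op_echar simp del: index_mult_mat(1))
    also have "\<dots> = 0" using root_sum[OF N, of k2] nd[of k2] assms k True by simp
    finally show ?thesis by (simp add: ntrace_def)
  qed
  then show ?thesis by (simp add: k translation_eq ntrace_smult sq_mult[of _ N])
qed

end

section \<open>Fourier coefficients of smooth functions\<close>

lemma C_k_continuous: "C_k k f \<Longrightarrow> continuous_on UNIV f"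
  by (cases k) auto

lemma echar_has_vector_derivative:
  "(echar k has_vector_derivative (2 * pi * of_int k) *\<^sub>R (\<i> * echar k x)) (at x)"
proof -
  have "((\<lambda>t. exp (t *\<^sub>R (2 * pi * of_int k * \<i>))) has_vector_derivative
    (2 * pi * of_int k * \<i>) * exp (x *\<^sub>R (2 * pi * of_int k * \<i>))) (at x)"
    by (rule exp_scaleR_has_vector_derivative_left)
  moreover have "echar k = (\<lambda>t. exp (t *\<^sub>R (2 * pi * of_int k * \<i>)))"
    by (auto simp: echar_def cis_conv_exp fun_eq_iff scaleR_conv_of_real mult_ac)
  ultimately show ?thesis by (simp add: scaleR_conv_of_real mult_ac)
qed

lemma integral_by_parts_echar:
  fixes u u' :: "real \<Rightarrow> complex"
  assumes d: "\<And>x. (u has_vector_derivative u' x) (at x)" and c: "continuous_on UNIV u'"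
    and p: "u 1 = u 0"
  shows "integral {0..1} (\<lambda>t. u' t * echar k t) = - (2 * pi * of_int k * \<i>) * integral {0..1} (\<lambda>t. u t * echar k t)"
proof -
  have cu: "continuous_on UNIV u"
    using d by (intro continuous_at_imp_continuous_on ballI has_vector_derivative_continuous)
  have ce: "continuous_on A (echar k)" for A unfolding echar_def by (intro continuous_intros)
  have "((\<lambda>t. u t * ((2 * pi * of_int k) *\<^sub>R (\<i> * echar k t)) + u' t * echar k t) has_integral (u 1 * echar k 1 - u 0 * echar k 0)) {0..1}"
    by (rule fundamental_theorem_of_calculus[OF _
          has_vector_derivative_at_within[OF has_vector_derivative_mult[OF d echar_has_vector_derivative]]]) simp
  moreover have "echar k 1 = 1" using echar_int[of k 1] by simp
  ultimately have "integral {0..1} (\<lambda>t. u t * ((2 * pi * of_int k) *\<^sub>R (\<i> * echar k t)) + u' t * echar k t) = 0"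
    using p by (simp add: integral_unique)
  moreover have "integral {0..1} (\<lambda>t. u t * ((2 * pi * of_int k) *\<^sub>R (\<i> * echar k t)) + u' t * echar k t)
    = integral {0..1} (\<lambda>t. (2 * pi * of_int k * \<i>) * (u t * echar k t)) + integral {0..1} (\<lambda>t. u' t * echar k t)"
    using cu c ce
    by (subst integral_add[symmetric])
      (auto intro!: integrable_continuous_real continuous_intros continuous_on_subset[OF cu] continuous_on_subset[OF c] simp: scaleR_conv_of_real mult_ac)
  moreover have "integral {0..1} (\<lambda>t. (2 * pi * of_int k * \<i>) * (u t * echar k t)) = (2 * pi * of_int k * \<i>) * integral {0..1} (\<lambda>t. u t * echar k t)"
    by (rule integral_mult_right)
  ultimately show ?thesis by (simp add: add_eq_0_iff2 add.commute)
qed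

lemma fourier_coeff_echar:
  "fourier_coeff f (k1, k2) = integral (cbox (0, 0) (1, 1)) (\<lambda>(q, p). f (q, p) * echar (- k2) q * echar k1 p)"
proof -
  have "cis (- 2 * pi * (q * of_int k2 - p * of_int k1)) = echar (- k2) q * echar k1 p" for q p
    unfolding echar_def cis_mult by (rule arg_cong[of _ _ cis]) (simp add: algebra_simps)
  then show ?thesis by (simp add: fourier_coeff_def torus_integral_def mult.assoc)
qed

lemma fourier_integrand_continuous:
  assumes "continuous_on UNIV f"
  shows "continuous_on A (\<lambda>(q, p). f (q, p) * echar a q * echar b p)"
proof -
  have "continuous_on A (\<lambda>x. f x * echar a (fst x) * echar b (snd x))"
    unfolding echar_def by (intro continuous_intros continuous_on_subset[OF assms]) auto
  then show ?thesis by (simp add: case_prod_unfold)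
qed

text \<open>Both orders of integration are recorded so that the variable to be integrated by parts
  can be taken as the inner one.\<close>

lemma fourier_coeff_iterated:
  assumes "continuous_on UNIV f"
  shows "fourier_coeff f (k1, k2) = integral {0..1} (\<lambda>q. integral {0..1} (\<lambda>p. f (q, p) * echar k1 p) * echar (- k2) q)" (is "_ = ?A")
    and "fourier_coeff f (k1, k2) = integral {0..1} (\<lambda>p. integral {0..1} (\<lambda>q. f (q, p) * echar (- k2) q) * echar k1 p)" (is "_ = ?B")
proof -
  let ?F = "\<lambda>(q, p). f (q, p) * echar (- k2) q * echar k1 p"
  have c: "continuous_on A ?F" for A by (rule fourier_integrand_continuous[OF assms])
  have 1: "fourier_coeff f (k1, k2) = integral (cbox 0 1) (\<lambda>q. integral (cbox 0 1) (\<lambda>p. ?F (q, p)))"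
    unfolding fourier_coeff_echar by (rule integral_prod_continuous[OF c])
  also have "\<dots> = integral (cbox 0 1) (\<lambda>p. integral (cbox 0 1) (\<lambda>q. ?F (q, p)))"
    using integral_swap_continuous[of 0 0 1 1 "\<lambda>q p. f (q, p) * echar (- k2) q * echar k1 p"] c by simp
  finally have 2: "fourier_coeff f (k1, k2) = integral (cbox 0 1) (\<lambda>p. integral (cbox 0 1) (\<lambda>q. ?F (q, p)))" .
  have "integral {0..1} (\<lambda>p. f (q, p) * echar (- k2) q * echar k1 p) = integral {0..1} (\<lambda>p. f (q, p) * echar k1 p) * echar (- k2) q" for q
    by (subst integral_mult_left[symmetric]) (simp add: mult_ac)
  then show "fourier_coeff f (k1, k2) = ?A" using 1 by simp
  have "integral {0..1} (\<lambda>q. f (q, p) * echar (- k2) q * echar k1 p) = integral {0..1} (\<lambda>q. f (q, p) * echar (- k2) q) * echar k1 p" for p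
    by (rule integral_mult_left)
  then show "fourier_coeff f (k1, k2) = ?B" using 2 by simp
qed

lemma has_vector_derivative_shift1:
  "(f has_vector_derivative f') (at (x + 1)) \<Longrightarrow> ((\<lambda>t. f (t + 1)) has_vector_derivative f') (at (x :: real))"
proof -
  assume "(f has_vector_derivative f') (at (x + 1))"
  moreover have "((\<lambda>t. t + 1) has_vector_derivative 1) (at x)"
    unfolding has_real_derivative_iff_has_vector_derivative[symmetric] by (auto intro!: derivative_eq_intros)
  ultimately show ?thesis
    using vector_diff_chain_at[of "\<lambda>t. t + 1" 1 x f f'] by (simp add: o_def)
qed

text \<open>The partial derivatives of \<open>C_k\<close> are again periodic, so that integration by parts
  produces no boundary terms.\<close>

lemma C_k_partial_q:
  assumes "C_k (Suc k) f" "torus_periodic f"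
  obtains g where "C_k k g" "torus_periodic g"
    "\<And>k1 k2. fourier_coeff g (k1, k2) = 2 * pi * of_int k2 * \<i> * fourier_coeff f (k1, k2)"
proof -
  obtain g where g: "\<And>q p. ((\<lambda>t. f (t, p)) has_vector_derivative g (q, p)) (at q)" "C_k k g"
    using assms(1) by auto
  have cf: "continuous_on UNIV f" and cg: "continuous_on UNIV g"
    using assms(1) g(2) C_k_continuous by auto
  have per: "f (q + 1, p) = f (q, p)" "f (q, p + 1) = f (q, p)" for q p
    using assms(2) by (auto simp: torus_periodic_def)
  have "g (q + 1, p) = g (q, p)" for q p
    using vector_derivative_unique_at[OF has_vector_derivative_shift1[OF g(1)[of p "q + 1"]], of "g (q, p)"] g(1)[of p q] per by simp
  moreover have "g (q, p + 1) = g (q, p)" for q p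
    using vector_derivative_unique_at[OF g(1)[of "p + 1" q], of "g (q, p)"] g(1)[of p q] per by simp
  ultimately have "torus_periodic g" by (simp add: torus_periodic_def)
  moreover have "fourier_coeff g (k1, k2) = 2 * pi * of_int k2 * \<i> * fourier_coeff f (k1, k2)" for k1 k2
  proof -
    have *: "integral {0..1} (\<lambda>q. g (q, p) * echar (- k2) q) = 2 * pi * of_int k2 * \<i> * integral {0..1} (\<lambda>q. f (q, p) * echar (- k2) q)" for p
    proof -
      have "continuous_on UNIV (\<lambda>q. g (q, p))" by (intro continuous_on_compose2[OF cg] continuous_intros) auto
      then show ?thesis using integral_by_parts_echar[OF g(1), of p "- k2"] per(1)[of 0 p] by simp
    qed
    then show ?thesis
      unfolding fourier_coeff_iterated(2)[OF cf] fourier_coeff_iterated(2)[OF cg]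
      by (simp only: * mult.assoc integral_mult_right)
  qed
  ultimately show ?thesis using that g(2) by blast
qed

lemma C_k_partial_p:
  assumes "C_k (Suc k) f" "torus_periodic f"
  obtains g where "C_k k g" "torus_periodic g"
    "\<And>k1 k2. fourier_coeff g (k1, k2) = - (2 * pi * of_int k1 * \<i>) * fourier_coeff f (k1, k2)"
proof -
  obtain g where g: "\<And>q p. ((\<lambda>t. f (q, t)) has_vector_derivative g (q, p)) (at p)" "C_k k g"
    using assms(1) by auto
  have cf: "continuous_on UNIV f" and cg: "continuous_on UNIV g"
    using assms(1) g(2) C_k_continuous by auto
  have per: "f (q + 1, p) = f (q, p)" "f (q, p + 1) = f (q, p)" for q p
    using assms(2) by (auto simp: torus_periodic_def)
  have "g (q, p + 1) = g (q, p)" for q p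
    using vector_derivative_unique_at[OF has_vector_derivative_shift1[OF g(1)[of q "p + 1"]], of "g (q, p)"] g(1)[of q p] per by simp
  moreover have "g (q + 1, p) = g (q, p)" for q p
    using vector_derivative_unique_at[OF g(1)[of "q + 1" p], of "g (q, p)"] g(1)[of q p] per by simp
  ultimately have "torus_periodic g" by (simp add: torus_periodic_def)
  moreover have "fourier_coeff g (k1, k2) = - (2 * pi * of_int k1 * \<i>) * fourier_coeff f (k1, k2)" for k1 k2
  proof -
    have *: "integral {0..1} (\<lambda>p. g (q, p) * echar k1 p) = - (2 * pi * of_int k1 * \<i>) * integral {0..1} (\<lambda>p. f (q, p) * echar k1 p)" for q
    proof -
      have "continuous_on UNIV (\<lambda>p. g (q, p))" by (intro continuous_on_compose2[OF cg] continuous_intros) auto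
      then show ?thesis using integral_by_parts_echar[OF g(1), of q k1] per(2)[of q 0] by simp
    qed
    then show ?thesis
      unfolding fourier_coeff_iterated(1)[OF cf] fourier_coeff_iterated(1)[OF cg]
      by (simp only: * mult.assoc integral_mult_right)
  qed
  ultimately show ?thesis using that g(2) by blast
qed

lemma fourier_coeff_bounded:
  assumes "continuous_on UNIV f"
  obtains B where "B \<ge> 0" "\<And>k. cmod (fourier_coeff f k) \<le> B"
proof -
  have "compact (f ` cbox (0, 0) (1, 1))"
    by (intro compact_continuous_image continuous_on_subset[OF assms] compact_cbox) auto
  then obtain B where B: "\<And>x. x \<in> cbox (0, 0) (1, 1) \<Longrightarrow> cmod (f x) \<le> B"
    using compact_imp_bounded bounded_iff by (metis imageI)
  have "(0, 0) \<in> cbox (0, 0) (1 :: real, 1 :: real)" by (simp add: cbox_Pair_eq)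
  from B[OF this] have B0: "B \<ge> 0" using norm_ge_zero order_trans by blast
  have "cmod (fourier_coeff f (k1, k2)) \<le> B" for k1 k2
  proof -
    have "(\<lambda>(q, p). f (q, p) * echar (- k2) q * echar k1 p) integrable_on cbox (0, 0) (1, 1)"
      by (intro integrable_continuous fourier_integrand_continuous assms)
    then have "cmod (integral (cbox (0, 0) (1, 1)) (\<lambda>(q, p). f (q, p) * echar (- k2) q * echar k1 p))
      \<le> B * measure lborel (cbox (0, 0) (1 :: real, 1 :: real))"
      using has_integral_bound[OF B0 integrable_integral, of "\<lambda>(q, p). f (q, p) * echar (- k2) q * echar k1 p" "(0, 0)" "(1, 1)"] B
      by (force simp: norm_mult)
    then show ?thesis by (simp add: fourier_coeff_echar content_Pair)
  qed
  then show ?thesis using that[OF B0] by auto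
qed

section \<open>Absolute summability of Fourier coefficients\<close>

lemma sum_inverse_square_int:
  obtains C :: real where "\<And>A :: int set. finite A \<Longrightarrow> (\<Sum>k\<in>A. 1 / (1 + (of_int k)\<^sup>2)) \<le> C"
proof -
  define g where "g n = 1 / (1 + (real n)\<^sup>2)" for n
  have g0: "g n \<ge> 0" for n by (simp add: g_def)
  have "summable (\<lambda>n. inverse (real n ^ 2))" by (rule inverse_power_summable) simp
  then have sg: "summable g"
  proof (rule summable_comparison_test_ev[rotated])
    show "\<forall>\<^sub>F n in sequentially. norm (g n) \<le> inverse (real n ^ 2)"
      using eventually_gt_at_top[of 0] by eventually_elim (auto simp: g_def inverse_eq_divide intro!: divide_left_mono mult_pos_pos add_pos_nonneg)
  qed
  show ?thesis
  proof (rule that[of "2 * suminf g"])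
    fix A :: "int set" assume A: "finite A"
    have s: "sum g B \<le> suminf g" if "finite B" for B using sum_le_suminf[OF sg that] g0 by auto
    have "(\<Sum>k\<in>A. 1 / (1 + (of_int k)\<^sup>2)) = (\<Sum>k\<in>A. g (nat \<bar>k\<bar>))"
      by (intro sum.cong) (auto simp: g_def)
    \<comment> \<open>The absolute value is injective on the nonnegative and on the negative
      integers separately; the two parts account for the factor 2.\<close>
    also have "\<dots> = (\<Sum>k\<in>A \<inter> {0..}. g (nat \<bar>k\<bar>)) + (\<Sum>k\<in>A - {0..}. g (nat \<bar>k\<bar>))"
      by (rule sum.Int_Diff[OF A])
    also have "(\<Sum>k\<in>A \<inter> {0..}. g (nat \<bar>k\<bar>)) = sum g ((\<lambda>k. nat \<bar>k\<bar>) ` (A \<inter> {0..}))"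
      by (subst sum.reindex) (auto simp: inj_on_def)
    also have "(\<Sum>k\<in>A - {0..}. g (nat \<bar>k\<bar>)) = sum g ((\<lambda>k. nat \<bar>k\<bar>) ` (A - {0..}))"
      by (subst sum.reindex) (auto simp: inj_on_def)
    also have "sum g ((\<lambda>k. nat \<bar>k\<bar>) ` (A \<inter> {0..})) + sum g ((\<lambda>k. nat \<bar>k\<bar>) ` (A - {0..})) \<le> 2 * suminf g"
      using s[of "(\<lambda>k. nat \<bar>k\<bar>) ` (A \<inter> {0..})"] s[of "(\<lambda>k. nat \<bar>k\<bar>) ` (A - {0..})"] A by simp
    finally show "(\<Sum>k\<in>A. 1 / (1 + (of_int k)\<^sup>2)) \<le> 2 * suminf g" .
  qed
qed

lemma summable_inverse_squares_lattice:
  "(\<lambda>(k1, k2). 1 / ((1 + (real_of_int k1)\<^sup>2) * (1 + (real_of_int k2)\<^sup>2))) summable_on UNIV"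
proof (rule nonneg_bdd_above_summable_on)
  obtain C where C: "\<And>A :: int set. finite A \<Longrightarrow> (\<Sum>k\<in>A. 1 / (1 + (real_of_int k)\<^sup>2)) \<le> C"
    using sum_inverse_square_int by blast
  have C0: "C \<ge> 0" using C[of "{}"] by simp
  let ?h = "\<lambda>k. 1 / (1 + (real_of_int k)\<^sup>2)"
  have "(\<Sum>(k1, k2)\<in>F. 1 / ((1 + (real_of_int k1)\<^sup>2) * (1 + (real_of_int k2)\<^sup>2))) \<le> C * C" if F: "finite F" for F
  proof -
    have "(\<Sum>(k1, k2)\<in>F. 1 / ((1 + (real_of_int k1)\<^sup>2) * (1 + (real_of_int k2)\<^sup>2)))
      \<le> (\<Sum>(k1, k2)\<in>fst ` F \<times> snd ` F. 1 / ((1 + (real_of_int k1)\<^sup>2) * (1 + (real_of_int k2)\<^sup>2)))"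
      using F by (intro sum_mono2) force+
    also have "\<dots> = sum ?h (fst ` F) * sum ?h (snd ` F)"
      unfolding sum_product sum.cartesian_product by (intro sum.cong) auto
    also have "\<dots> \<le> C * C"
      using F C0 by (intro mult_mono C) (auto intro: sum_nonneg)
    finally show ?thesis .
  qed
  then show "bdd_above (sum (\<lambda>(k1, k2). 1 / ((1 + (real_of_int k1)\<^sup>2) * (1 + (real_of_int k2)\<^sup>2))) ` {F. F \<subseteq> UNIV \<and> finite F})"
    by (intro bdd_aboveI2[of _ _ "C * C"]) auto
qed auto

text \<open>Expanding \<open>(1 + k1^2) * (1 + k2^2)\<close> gives four terms, controlled by the
  coefficients of \<open>a\<close>, of its second derivatives in \<open>q\<close> and in
  \<open>p\<close>, and of the mixed derivative of order two in each variable. Hence four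
  derivatives are taken: \<open>c\<close>, \<open>d\<close> and \<open>f\<close> below are these
  derivatives.\<close>

lemma fourier_coeff_abs_summable:
  assumes "smooth_torus a"
  shows "(\<lambda>k. cmod (fourier_coeff a k)) summable_on UNIV"
proof -
  have a: "torus_periodic a" "C_k 4 a" using assms by (auto simp: smooth_torus_def)
  then have a4: "C_k (Suc (Suc (Suc (Suc 0)))) a" by (simp add: eval_nat_numeral)
  obtain b where b: "C_k (Suc (Suc (Suc 0))) b" "torus_periodic b"
    "\<And>k1 k2. fourier_coeff b (k1, k2) = 2 * pi * of_int k2 * \<i> * fourier_coeff a (k1, k2)"
    using C_k_partial_q[OF a4 a(1)] by blast
  obtain c where c: "C_k (Suc (Suc 0)) c" "torus_periodic c"
    "\<And>k1 k2. fourier_coeff c (k1, k2) = 2 * pi * of_int k2 * \<i> * fourier_coeff b (k1, k2)"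
    using C_k_partial_q[OF b(1,2)] by blast
  have two_p: "\<exists>g. continuous_on UNIV g \<and>
    (\<forall>k1 k2. fourier_coeff g (k1, k2) = - (2 * pi * of_int k1 * \<i>) * (- (2 * pi * of_int k1 * \<i>) * fourier_coeff f (k1, k2)))"
    if f: "C_k (Suc (Suc k)) f" "torus_periodic f" for f k
  proof -
    obtain g where g: "C_k (Suc k) g" "torus_periodic g"
      "\<And>k1 k2. fourier_coeff g (k1, k2) = - (2 * pi * of_int k1 * \<i>) * fourier_coeff f (k1, k2)"
      using C_k_partial_p[OF f] by blast
    obtain h where h: "C_k k h" "torus_periodic h"
      "\<And>k1 k2. fourier_coeff h (k1, k2) = - (2 * pi * of_int k1 * \<i>) * fourier_coeff g (k1, k2)"
      by (rule C_k_partial_p[OF g(1,2)]) (rule that)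
    have "continuous_on UNIV h" using h(1) by (rule C_k_continuous)
    then show ?thesis using h(3) unfolding g(3) by blast
  qed
  obtain d where d: "continuous_on UNIV d"
    "\<And>k1 k2. fourier_coeff d (k1, k2) = - (2 * pi * of_int k1 * \<i>) * (- (2 * pi * of_int k1 * \<i>) * fourier_coeff a (k1, k2))"
    using two_p[OF a4 a(1)] by blast
  obtain f where f: "continuous_on UNIV f"
    "\<And>k1 k2. fourier_coeff f (k1, k2) = - (2 * pi * of_int k1 * \<i>) * (- (2 * pi * of_int k1 * \<i>) * fourier_coeff c (k1, k2))"
    using two_p[OF c(1,2)] by blast
  obtain A where A: "\<And>k. cmod (fourier_coeff a k) \<le> A"
    using fourier_coeff_bounded[OF C_k_continuous[OF a4]] by blast
  obtain C where C: "\<And>k. cmod (fourier_coeff c k) \<le> C"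
    using fourier_coeff_bounded[OF C_k_continuous[OF c(1)]] by blast
  obtain D where D: "\<And>k. cmod (fourier_coeff d k) \<le> D"
    using fourier_coeff_bounded[OF d(1)] by blast
  obtain F where F: "\<And>k. cmod (fourier_coeff f k) \<le> F"
    using fourier_coeff_bounded[OF f(1)] by blast
  have pi1: "1 \<le> (2 * pi)\<^sup>2" using pi_ge_two by (intro one_le_power) linarith
  have main: "cmod (fourier_coeff a (k1, k2)) \<le> (A + C + D + F) * (1 / ((1 + (real_of_int k1)\<^sup>2) * (1 + (real_of_int k2)\<^sup>2)))" for k1 k2
  proof -
    let ?x = "cmod (fourier_coeff a (k1, k2))" and ?s = "(real_of_int k1)\<^sup>2" and ?t = "(real_of_int k2)\<^sup>2"
    have up: "x \<le> (2 * pi)\<^sup>2 * x" if "x \<ge> 0" for x using mult_right_mono[OF pi1 that] by simp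
    have nc: "cmod (fourier_coeff c (k1, k2)) = (2 * pi)\<^sup>2 * (?t * ?x)"
      by (simp add: c(3) b(3) norm_mult power2_eq_square abs_mult_self_eq mult_ac)
    have nd: "cmod (fourier_coeff d (k1, k2)) = (2 * pi)\<^sup>2 * (?s * ?x)"
      by (simp add: d(2) norm_mult power2_eq_square abs_mult_self_eq mult_ac)
    have nf: "cmod (fourier_coeff f (k1, k2)) = (2 * pi)\<^sup>2 * (?s * ((2 * pi)\<^sup>2 * (?t * ?x)))"
      unfolding nc[symmetric] by (simp add: f(2) norm_mult power2_eq_square abs_mult_self_eq mult_ac)
    have "?t * ?x \<le> C" using C[of "(k1, k2)"] up[of "?t * ?x"] nc by simp
    moreover have "?s * ?x \<le> D" using D[of "(k1, k2)"] up[of "?s * ?x"] nd by simp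
    moreover have "?s * (?t * ?x) \<le> F"
    proof -
      have "?s * (?t * ?x) \<le> ?s * ((2 * pi)\<^sup>2 * (?t * ?x))" by (intro mult_left_mono up) auto
      also have "\<dots> \<le> (2 * pi)\<^sup>2 * (?s * ((2 * pi)\<^sup>2 * (?t * ?x)))" by (intro up) auto
      also have "\<dots> \<le> F" unfolding nf[symmetric] by (rule F)
      finally show ?thesis .
    qed
    ultimately have "(1 + ?s) * (1 + ?t) * ?x \<le> A + C + D + F"
      using A[of "(k1, k2)"] by (simp add: algebra_simps)
    moreover have "(1 + ?s) * (1 + ?t) > 0" by (intro mult_pos_pos add_pos_nonneg) auto
    ultimately show ?thesis by (simp add: field_simps)
  qed
  show ?thesis
  proof (rule summable_on_comparison_test)
    show "(\<lambda>k. (A + C + D + F) * (case k of (k1, k2) \<Rightarrow> 1 / ((1 + (real_of_int k1)\<^sup>2) * (1 + (real_of_int k2)\<^sup>2)))) summable_on UNIV"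
      by (intro summable_on_cmult_right summable_inverse_squares_lattice)
  qed (use main in \<open>auto split: prod.splits\<close>)
qed

lemma fourier_coeff_0: "fourier_coeff a (0, 0) = torus_integral a"
  by (simp add: fourier_coeff_def)

section \<open>Generic eigenstates\<close>

text \<open>Up to phases \<open>T(k)\<close> is a permutation matrix: row \<open>i\<close> meets
  only the column congruent to \<open>i - k1\<close>.\<close>

lemma translation_row_sum:
  assumes "i < N" shows "(\<Sum>j<N. cmod (translation N k $$ (i, j))) \<le> 1"
proof -
  obtain k1 k2 where k: "k = (k1, k2)" by fastforce
  have "cmod (translation N k $$ (i, j)) \<le> (if j = nat ((int i - k1) mod int N) then 1 else 0)" if "j < N" for j
  proof -
    have "j = nat ((int i - k1) mod int N)" if "int i = (int j + k1) mod int N"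
    proof (rule dvd_shift)
      show "int N dvd int i - k1 - int j"
        using that by (metis diff_diff_eq diff_right_commute diff_zero dvd_minus_mod mod_eq_dvd_iff mod_mod_trivial add.commute)
    qed fact
    then show ?thesis using assms \<open>j < N\<close> by (auto simp: k translation_def norm_mult)
  qed
  then have "(\<Sum>j<N. cmod (translation N k $$ (i, j))) \<le> (\<Sum>j<N. if j = nat ((int i - k1) mod int N) then 1 else 0)"
    by (intro sum_mono) auto
  then show ?thesis by (simp split: if_splits)
qed

lemma translation_col_sum:
  assumes "j < N" shows "(\<Sum>i<N. cmod (translation N k $$ (i, j))) \<le> 1"
proof -
  obtain k1 k2 where k: "k = (k1, k2)" by fastforce
  have "cmod (translation N k $$ (i, j)) \<le> (if i = nat ((int j + k1) mod int N) then 1 else 0)" if "i < N" for i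
    using assms that by (auto simp: k translation_def norm_mult)
  then have "(\<Sum>i<N. cmod (translation N k $$ (i, j))) \<le> (\<Sum>i<N. if i = nat ((int j + k1) mod int N) then 1 else 0)"
    by (intro sum_mono) auto
  then show ?thesis by (simp split: if_splits)
qed

text \<open>Schur's test: the elementary inequality for \<open>2 a b\<close> splits the double sum
  into one part governed by row sums and one governed by column sums.\<close>

lemma qinner_schur_bound:
  assumes T: "T \<in> carrier_mat N N" and u: "u \<in> carrier_vec N" "qinner u u = 1"
    and row: "\<And>i. i < N \<Longrightarrow> (\<Sum>j<N. cmod (T $$ (i, j))) \<le> 1"
    and col: "\<And>j. j < N \<Longrightarrow> (\<Sum>i<N. cmod (T $$ (i, j))) \<le> 1"
  shows "cmod (qinner u (T *\<^sub>v u)) \<le> 1"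
proof -
  let ?t = "\<lambda>i j. cmod (T $$ (i, j))" and ?u = "\<lambda>i. cmod (u $ i)"
  have "complex_of_real (\<Sum>i<N. (?u i)\<^sup>2) = qinner u u"
    using u(1) by (simp add: scalar_prod_def atLeast0LessThan complex_norm_square[symmetric] del: of_real_power)
  then have n: "(\<Sum>i<N. (?u i)\<^sup>2) = 1" using u(2) by (metis of_real_eq_1_iff)
  have "cmod (qinner u (T *\<^sub>v u)) \<le> (\<Sum>i<N. \<Sum>j<N. ?u i * ?t i j * ?u j)"
    unfolding qinner_sum[OF T u(1) u(1)]
    by (intro order_trans[OF norm_sum] sum_mono) (simp add: norm_mult)
  also have "\<dots> \<le> (\<Sum>i<N. \<Sum>j<N. (?u i)\<^sup>2 / 2 * ?t i j + (?u j)\<^sup>2 / 2 * ?t i j)"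
  proof (intro sum_mono)
    fix i j
    have "?u i * ?u j \<le> (?u i)\<^sup>2 / 2 + (?u j)\<^sup>2 / 2"
      using sum_squares_bound[of "?u i" "?u j"] by simp
    from mult_right_mono[OF this, of "?t i j"]
    show "?u i * ?t i j * ?u j \<le> (?u i)\<^sup>2 / 2 * ?t i j + (?u j)\<^sup>2 / 2 * ?t i j"
      by (simp add: algebra_simps)
  qed
  also have "\<dots> = (\<Sum>i<N. (?u i)\<^sup>2 / 2 * (\<Sum>j<N. ?t i j)) + (\<Sum>j<N. (?u j)\<^sup>2 / 2 * (\<Sum>i<N. ?t i j))"
    unfolding sum.distrib sum_distrib_left by (intro arg_cong2[of _ _ _ _ "(+)"] refl sum.swap)
  also have "\<dots> \<le> (\<Sum>i<N. (?u i)\<^sup>2 / 2 * 1) + (\<Sum>j<N. (?u j)\<^sup>2 / 2 * 1)"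
    by (intro add_mono sum_mono mult_left_mono row col) auto
  also have "\<dots> = 1" using n by (simp flip: sum_divide_distrib)
  finally show ?thesis .
qed

lemma translation_entry_bound: "i < N \<Longrightarrow> j < N \<Longrightarrow> cmod (translation N k $$ (i, j)) \<le> 1"
  using translation_row_sum[of i N k] member_le_sum[of j "{..<N}" "\<lambda>j. cmod (translation N k $$ (i, j))"] by simp

text \<open>An enumeration of the lattice provides the geometric weights that combine all
  \<open>T(k)\<close> into one quantity, and turns sums over the lattice into series to which
  Tannery's theorem applies.\<close>

definition lattice_enum :: "nat \<Rightarrow> int \<times> int" where
  "lattice_enum = from_nat_into UNIV"

lemma bij_lattice_enum: "bij lattice_enum"
proof -
  have "infinite (UNIV :: (int \<times> int) set)" by (simp add: finite_prod infinite_UNIV_int)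
  then show ?thesis unfolding lattice_enum_def by (intro bij_betw_from_nat_into) auto
qed

lemma fourier_coeff_enum_summable:
  assumes "smooth_torus a" shows "summable (\<lambda>i. cmod (fourier_coeff a (lattice_enum i)))"
proof -
  have "(\<lambda>i. cmod (fourier_coeff a (lattice_enum i))) summable_on UNIV"
    using fourier_coeff_abs_summable[OF assms]
    by (rule summable_on_reindex_bij_betw[OF bij_lattice_enum, THEN iffD2])
  then show ?thesis by (rule summable_on_UNIV_nonneg_real_iff[THEN iffD1, rotated]) simp
qed

section \<open>Selection of the generic eigenstates and equidistribution\<close>

context quantum_eigenbases
begin

text \<open>One number that controls the deviations of all translations in the state
  \<open>j\<close>. The weights add up to 1, and since a deviation of a \<open>T(k)\<close> is at
  most 2 in modulus, the division by 4 keeps the defect between 0 and 1.\<close>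

definition defect :: "nat \<Rightarrow> nat \<Rightarrow> real" where
  "defect n j = (\<Sum>i. (1 / 2) ^ Suc i * ((cmod (deviation n (translation (2 * n) (lattice_enum i)) j))\<^sup>2 / 4))"

definition mean_defect :: "nat \<Rightarrow> real" where
  "mean_defect n = (\<Sum>j\<in>{1..2 * n}. defect n j) / (2 * n)"

text \<open>With the square root of the mean as threshold, Chebyshev's inequality bounds the
  proportion of excluded states by that same square root, so the threshold and the proportion tend
  to 0 together.\<close>

definition generic :: "nat \<Rightarrow> nat set" where
  "generic n = {j \<in> {1..2 * n}. defect n j \<le> sqrt (mean_defect n)}"

lemma qinner_translation_bound:
  assumes "j \<in> {1..2 * n}"
  shows "cmod (qinner (e n j) (translation (2 * n) k *\<^sub>v e n j)) \<le> 1"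
  using e_on[OF assms assms]
  by (intro qinner_schur_bound[OF translation_carrier e_carrier[OF assms]] translation_row_sum translation_col_sum) auto

lemma deviation_translation_bound:
  assumes "j \<in> {1..2 * n}"
  shows "(cmod (deviation n (translation (2 * n) k) j))\<^sup>2 / 4 \<le> 1"
proof -
  have n: "2 * n > 0" using assms by auto
  have "cmod (\<Sum>i<2*n. translation (2 * n) k $$ (i, i)) \<le> (\<Sum>i<2*n. 1)"
    by (intro order_trans[OF norm_sum] sum_mono translation_entry_bound) auto
  then have "cmod (ntrace (2 * n) (translation (2 * n) k)) \<le> 1"
    using n by (simp add: ntrace_def norm_divide norm_mult)
  then have "cmod (deviation n (translation (2 * n) k) j) \<le> 1 + 1"
    unfolding deviation_def using qinner_translation_bound[OF assms, of k]
    by (intro order_trans[OF norm_triangle_ineq4] add_mono)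
  then have "(cmod (deviation n (translation (2 * n) k) j))\<^sup>2 \<le> 2\<^sup>2" by (intro power_mono) auto
  then show ?thesis by simp
qed

lemma defect_term_bound:
  assumes "j \<in> {1..2 * n}"
  shows "(1 / 2) ^ Suc i * ((cmod (deviation n (translation (2 * n) (lattice_enum i)) j))\<^sup>2 / 4) \<le> (1 / 2) ^ Suc i"
  using mult_left_mono[OF deviation_translation_bound[OF assms, of "lattice_enum i"], of "(1 / 2) ^ Suc i"] by simp

lemma defect_summable:
  assumes "j \<in> {1..2 * n}"
  shows "summable (\<lambda>i. (1 / 2) ^ Suc i * ((cmod (deviation n (translation (2 * n) (lattice_enum i)) j))\<^sup>2 / 4))"
  by (rule summable_comparison_test'[OF sums_summable[OF power_half_series]])
    (use defect_term_bound[OF assms] in auto)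

lemma defect_le_1:
  assumes "j \<in> {1..2 * n}" shows "defect n j \<le> 1"
proof -
  have "defect n j \<le> (\<Sum>i. (1 / 2) ^ Suc i)"
    unfolding defect_def
    by (intro suminf_le defect_term_bound defect_summable assms sums_summable[OF power_half_series])
  also have "\<dots> = 1" by (rule sums_unique[OF power_half_series, symmetric])
  finally show ?thesis .
qed

lemma defect_ge:
  assumes "j \<in> {1..2 * n}"
  shows "(1 / 2) ^ Suc i * ((cmod (deviation n (translation (2 * n) (lattice_enum i)) j))\<^sup>2 / 4) \<le> defect n j"
  using sum_le_suminf[OF defect_summable[OF assms], of "{i}"] by (simp add: defect_def)

lemma defect_nonneg:
  assumes "j \<in> {1..2 * n}" shows "defect n j \<ge> 0"
  unfolding defect_def by (intro suminf_nonneg defect_summable assms) auto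

lemma mean_defect_nonneg: "mean_defect n \<ge> 0"
  unfolding mean_defect_def by (intro divide_nonneg_nonneg sum_nonneg defect_nonneg) auto

lemma mean_defect_le_1: "mean_defect n \<le> 1"
proof (cases "n = 0")
  case False
  have "(\<Sum>j\<in>{1..2 * n}. defect n j) \<le> (\<Sum>j\<in>{1..2 * n}. 1)" by (intro sum_mono defect_le_1)
  then show ?thesis using False by (simp add: mean_defect_def field_simps)
qed (simp add: mean_defect_def)

lemma rms_deviation_power2: "(rms_deviation n A)\<^sup>2 = (\<Sum>j\<in>{1..2 * n}. (cmod (deviation n A j))\<^sup>2) / (2 * n)"
  by (simp add: rms_deviation_def power_divide L2_set_def sum_nonneg)

text \<open>Exchanging the finite sum over states with the series exhibits the mean defect as a
  weighted sum of quantum variances, each of which vanishes in the limit.\<close>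

lemma mean_defect_eq:
  "mean_defect n = (\<Sum>i. (1 / 2) ^ Suc i * ((rms_deviation n (translation (2 * n) (lattice_enum i)))\<^sup>2 / 4))"
proof -
  let ?f = "\<lambda>i j. (1 / 2) ^ Suc i * ((cmod (deviation n (translation (2 * n) (lattice_enum i)) j))\<^sup>2 / 4)"
  have "(\<Sum>j\<in>{1..2 * n}. defect n j) = (\<Sum>i. \<Sum>j\<in>{1..2 * n}. ?f i j)"
    unfolding defect_def by (rule suminf_sum[symmetric]) (rule defect_summable)
  moreover have "summable (\<lambda>i. \<Sum>j\<in>{1..2 * n}. ?f i j)"
    by (intro summable_sum defect_summable)
  ultimately have "mean_defect n = (\<Sum>i. (\<Sum>j\<in>{1..2 * n}. ?f i j) / (2 * n))"
    unfolding mean_defect_def by (simp only: suminf_divide)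
  also have "(\<lambda>i. (\<Sum>j\<in>{1..2 * n}. ?f i j) / (2 * n)) = (\<lambda>i. (1 / 2) ^ Suc i * ((rms_deviation n (translation (2 * n) (lattice_enum i)))\<^sup>2 / 4))"
    unfolding rms_deviation_power2 by (simp add: sum_distrib_left[symmetric] sum_divide_distrib[symmetric] mult_ac)
  finally show ?thesis .
qed

text \<open>Tannery's theorem: each term tends to 0 with \<open>n\<close> and is dominated by its
  weight, uniformly in \<open>n\<close>.\<close>

lemma mean_defect_tendsto: "mean_defect \<longlonglongrightarrow> 0"
proof -
  let ?a = "\<lambda>i n. (1 / 2) ^ Suc i * ((rms_deviation n (translation (2 * n) (lattice_enum i)))\<^sup>2 / 4)"
  have "(\<lambda>n. ?a i n) \<longlonglongrightarrow> (1 / 2) ^ Suc i * (0\<^sup>2 / 4)" for i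
    using quantum_ergodic_translation[of "lattice_enum i"] unfolding quantum_ergodic_def by (intro tendsto_intros) auto
  then have lim: "(\<lambda>n. ?a i n) \<longlonglongrightarrow> 0" for i by simp
  have b: "?a i n \<le> (1 / 2) ^ Suc i" for i n
  proof (cases "n = 0")
    case True then show ?thesis by (simp add: rms_deviation_def)
  next
    case False
    have "(\<Sum>j\<in>{1..2 * n}. (cmod (deviation n (translation (2 * n) (lattice_enum i)) j))\<^sup>2) \<le> (\<Sum>j\<in>{1..2 * n}. 4)"
      using deviation_translation_bound by (intro sum_mono) auto
    then have "(rms_deviation n (translation (2 * n) (lattice_enum i)))\<^sup>2 / 4 \<le> 1"
      using False by (simp add: rms_deviation_power2 field_simps)
    from mult_left_mono[OF this, of "(1 / 2) ^ Suc i"] show ?thesis by simp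
  qed
  have "(\<lambda>n. \<Sum>i. ?a i n) \<longlonglongrightarrow> (\<Sum>i. 0)"
    by (rule tannerys_theorem[THEN conjunct2, THEN conjunct2, OF lim _ sums_summable[OF power_half_series]])
      (use b in \<open>auto intro!: always_eventually\<close>)
  moreover have "mean_defect = (\<lambda>n. \<Sum>i. ?a i n)" by (rule ext) (rule mean_defect_eq)
  ultimately show ?thesis by (simp only: suminf_zero)
qed

lemma generic_card_le: "card (generic n) \<le> 2 * n"
proof -
  have "generic n \<subseteq> {1..2 * n}" by (auto simp: generic_def)
  from card_mono[OF _ this] show ?thesis by simp
qed

lemma generic_card:
  assumes "n > 0"
  shows "1 - sqrt (mean_defect n) \<le> card (generic n) / real (2 * n)"
proof -
  let ?s = "sqrt (mean_defect n)"
  let ?B = "{1..2 * n} - generic n"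
  have B: "j \<in> {1..2 * n}" "defect n j > ?s" if "j \<in> ?B" for j using that by (auto simp: generic_def)
  have "card ?B * ?s = (\<Sum>j\<in>?B. ?s)" by simp
  also have "\<dots> \<le> (\<Sum>j\<in>?B. defect n j)" using B by (intro sum_mono) (simp add: less_imp_le)
  also have "\<dots> \<le> (\<Sum>j\<in>{1..2 * n}. defect n j)" by (intro sum_mono2 defect_nonneg) auto
  also have "\<dots> = mean_defect n * (2 * n)" using assms by (simp add: mean_defect_def)
  also have "\<dots> = ?s * ?s * (2 * n)" using mean_defect_nonneg[of n] by simp
  finally have le: "card ?B * ?s \<le> ?s * ?s * (2 * n)" .
  have "real (card ?B) \<le> ?s * (2 * n)"
  proof (cases "?s = 0")
    case False
    then have "?s > 0" using mean_defect_nonneg[of n] by simp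
    moreover have "card ?B * ?s \<le> ?s * (2 * n) * ?s" using le by (simp only: mult_ac)
    ultimately show ?thesis by (rule mult_right_le_imp_le[rotated])
  next
    \<comment> \<open>A zero threshold cannot be cancelled from the inequality; but then every
      defect vanishes and no state is excluded.\<close>
    case True
    then have "(\<Sum>j\<in>{1..2 * n}. defect n j) = 0" using assms by (simp add: mean_defect_def)
    then have "\<forall>j\<in>{1..2 * n}. defect n j = 0"
      by (subst (asm) sum_nonneg_eq_0_iff) (auto intro: defect_nonneg)
    then have "?B = {}" using B True by force
    then have "card ?B = 0" by simp
    then show ?thesis using True by simp
  qed
  moreover have "card ?B = 2 * n - card (generic n)"
    by (subst card_Diff_subset) (auto simp: generic_def)
  ultimately have "2 * real n - card (generic n) \<le> ?s * (2 * n)" using generic_card_le[of n] by (simp add: of_nat_diff)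
  then show ?thesis using assms by (simp add: field_simps)
qed

text \<open>Needed for every dimension, not only in the limit, so that admissible sequences exist.
  The mean is at most 1, hence at most its square root, and not all defects can exceed a number that
  is at least their mean.\<close>

lemma generic_nonempty:
  assumes "n > 0" shows "generic n \<noteq> {}"
proof
  assume empty: "generic n = {}"
  have "sqrt (mean_defect n) < defect n j" if "j \<in> {1..2 * n}" for j
  proof (rule ccontr)
    assume "\<not> sqrt (mean_defect n) < defect n j"
    then have "j \<in> generic n" using that by (simp add: generic_def)
    then show False using empty by simp
  qed
  then have "(\<Sum>j\<in>{1..2 * n}. sqrt (mean_defect n)) < (\<Sum>j\<in>{1..2 * n}. defect n j)"
    using assms by (intro sum_strict_mono) auto
  then have "sqrt (mean_defect n) < mean_defect n"
    using assms by (simp add: mean_defect_def field_simps)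
  moreover have "mean_defect n \<le> sqrt (mean_defect n)"
    using mean_defect_nonneg[of n] mean_defect_le_1[of n]
    by (intro real_le_rsqrt) (simp add: power2_eq_square mult_left_le)
  ultimately show False by simp
qed

lemma generic_density: "(\<lambda>n. card (generic n) / real (2 * n)) \<longlonglongrightarrow> 1"
proof (rule tendsto_sandwich)
  show "\<forall>\<^sub>F n in sequentially. 1 - sqrt (mean_defect n) \<le> card (generic n) / real (2 * n)"
    using eventually_gt_at_top[of 0] by eventually_elim (rule generic_card)
  have "card (generic n) / real (2 * n) \<le> 1" for n
    using generic_card_le[of n] by (intro divide_le_eq_1[THEN iffD2]) linarith
  then show "\<forall>\<^sub>F n in sequentially. card (generic n) / real (2 * n) \<le> 1" by simp
  have "(\<lambda>n. 1 - sqrt (mean_defect n)) \<longlonglongrightarrow> 1 - sqrt 0"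
    by (intro tendsto_intros mean_defect_tendsto)
  then show "(\<lambda>n. 1 - sqrt (mean_defect n)) \<longlonglongrightarrow> 1" by simp
qed simp

text \<open>The defect dominates each of its weighted terms, so on generic states the deviation of a
  fixed \<open>T(k)\<close> tends to 0. Its trace is eventually 0 unless \<open>k = (0, 0)\<close>,
  where the operator is the identity.\<close>

lemma generic_translation:
  assumes j: "\<And>n. n > 0 \<Longrightarrow> j n \<in> generic n"
  shows "(\<lambda>n. qinner (e n (j n)) (translation (2 * n) (lattice_enum i) *\<^sub>v e n (j n)))
    \<longlonglongrightarrow> (if lattice_enum i = (0, 0) then 1 else 0)"
proof -
  have r: "j n \<in> {1..2 * n}" if "n > 0" for n using j[OF that] by (simp add: generic_def)
  show ?thesis
  proof (cases "lattice_enum i = (0, 0)")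
    case True
    have one: "qinner (e n (j n)) (translation (2 * n) (lattice_enum i) *\<^sub>v e n (j n)) = 1" if "n > 0" for n
    proof -
      have "translation (2 * n) (0, 0) = 1\<^sub>m (2 * n)"
        by (rule eq_matI) (auto simp: translation_def)
      then show ?thesis using True e_carrier[OF r[OF that]] e_on[OF r[OF that] r[OF that]] by simp
    qed
    have "\<forall>\<^sub>F n in sequentially. qinner (e n (j n)) (translation (2 * n) (lattice_enum i) *\<^sub>v e n (j n)) = 1"
      using eventually_gt_at_top[of 0] by eventually_elim (rule one)
    then show ?thesis using True by (simp add: tendsto_eventually)
  next
    case False
    let ?T = "\<lambda>n. translation (2 * n) (lattice_enum i)"
    \<comment> \<open>The reciprocal of the weight of the \<open>i\<close>-th term times the 4 of
      \<open>defect\<close>; it does not depend on \<open>n\<close>.\<close>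
    let ?c = "2 ^ Suc i * 4 :: real"
    have b: "\<forall>\<^sub>F n in sequentially. norm ((cmod (deviation n (?T n) (j n)))\<^sup>2) \<le> ?c * sqrt (mean_defect n)"
      using eventually_gt_at_top[of 0]
    proof eventually_elim
      case (elim n)
      have "(1 / 2) ^ Suc i * ((cmod (deviation n (?T n) (j n)))\<^sup>2 / 4) \<le> sqrt (mean_defect n)"
        using defect_ge[OF r[OF elim], of i] j[OF elim] by (simp add: generic_def)
      then show ?case by (simp add: field_simps power_divide)
    qed
    have "(\<lambda>n. ?c * sqrt (mean_defect n)) \<longlonglongrightarrow> ?c * sqrt 0"
      by (intro tendsto_intros mean_defect_tendsto)
    then have "(\<lambda>n. (cmod (deviation n (?T n) (j n)))\<^sup>2) \<longlonglongrightarrow> 0"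
      using Lim_null_comparison[OF b] by simp
    then have "(\<lambda>n. sqrt ((cmod (deviation n (?T n) (j n)))\<^sup>2)) \<longlonglongrightarrow> sqrt 0" by (rule tendsto_real_sqrt)
    then have d: "(\<lambda>n. deviation n (?T n) (j n)) \<longlonglongrightarrow> 0" by (simp add: tendsto_norm_zero_iff)
    have "\<forall>\<^sub>F n in sequentially. ntrace (2 * n) (?T n) = 0"
      using eventually_gt_at_top[of "nat (\<bar>fst (lattice_enum i)\<bar> + \<bar>snd (lattice_enum i)\<bar>)"]
    proof eventually_elim
      case (elim n)
      then show ?case using False by (intro ntrace_translation) auto
    qed
    then have t: "(\<lambda>n. ntrace (2 * n) (?T n)) \<longlonglongrightarrow> 0" by (rule tendsto_eventually)
    from tendsto_add[OF d t] show ?thesis using False by (simp add: deviation_def)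
  qed
qed

text \<open>Entrywise the series is dominated by the Fourier coefficients, since entries of
  translations are at most 1 in modulus; a matrix element is a finite linear combination of
  entries.\<close>

lemma weyl_op_sums:
  assumes a: "smooth_torus a" and j: "j \<in> {1..2 * n}"
  shows "(\<lambda>i. fourier_coeff a (lattice_enum i) * qinner (e n j) (translation (2 * n) (lattice_enum i) *\<^sub>v e n j))
    sums qinner (e n j) (weyl_op (2 * n) a *\<^sub>v e n j)"
proof -
  let ?c = "\<lambda>i. fourier_coeff a (lattice_enum i)" and ?N = "2 * n"
  have sc: "summable (\<lambda>i. cmod (?c i))"
    by (rule fourier_coeff_enum_summable[OF a])
  have entry: "(\<lambda>i. ?c i * translation ?N (lattice_enum i) $$ (p, q)) sums (weyl_op ?N a $$ (p, q))"
    if pq: "p < ?N" "q < ?N" for p q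
  proof -
    let ?g = "\<lambda>k. fourier_coeff a k * translation ?N k $$ (p, q)"
    have "summable (\<lambda>i. norm (?g (lattice_enum i)))"
    proof (rule summable_comparison_test'[OF sc])
      fix i show "norm (norm (?g (lattice_enum i))) \<le> cmod (?c i)"
        using translation_entry_bound[OF pq, of "lattice_enum i"] by (simp add: norm_mult mult_left_le)
    qed
    moreover from this have s: "(\<lambda>i. ?g (lattice_enum i)) sums (\<Sum>i. ?g (lattice_enum i))"
      by (rule summable_sums[OF summable_norm_cancel])
    \<comment> \<open>Absolute summability identifies the ordered series with the unordered sum,
      which can then be carried over to the lattice.\<close>
    ultimately have "((\<lambda>i. ?g (lattice_enum i)) has_sum (\<Sum>i. ?g (lattice_enum i))) UNIV"
      by (rule norm_summable_imp_has_sum)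
    then have "infsum (\<lambda>i. ?g (lattice_enum i)) UNIV = (\<Sum>i. ?g (lattice_enum i))" by (intro infsumI)
    then have "infsum ?g UNIV = (\<Sum>i. ?g (lattice_enum i))"
      using infsum_reindex_bij_betw[OF bij_lattice_enum, of ?g] by simp
    then show ?thesis using s pq by (simp add: weyl_op_def)
  qed
  have w: "weyl_op ?N a \<in> carrier_mat ?N ?N" by (simp add: weyl_op_def)
  have ec: "e n j \<in> carrier_vec ?N" using e_carrier[OF j] .
  have "(\<lambda>i. \<Sum>p<?N. \<Sum>q<?N. cnj (e n j $ p) * (?c i * translation ?N (lattice_enum i) $$ (p, q)) * e n j $ q)
    sums (\<Sum>p<?N. \<Sum>q<?N. cnj (e n j $ p) * weyl_op ?N a $$ (p, q) * e n j $ q)"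
    by (intro sums_sum sums_mult sums_mult2 entry) auto
  moreover have "(\<Sum>p<?N. \<Sum>q<?N. cnj (e n j $ p) * (?c i * translation ?N (lattice_enum i) $$ (p, q)) * e n j $ q)
    = ?c i * qinner (e n j) (translation ?N (lattice_enum i) *\<^sub>v e n j)" for i
    unfolding qinner_sum[OF translation_carrier ec ec] sum_distrib_left
    by (intro sum.cong refl) (simp add: mult_ac)
  ultimately show ?thesis by (simp only: qinner_sum[OF w ec ec])
qed

text \<open>The limit is exchanged with the Fourier series by Tannery's theorem, the moduli of the
  Fourier coefficients serving as majorant. Only the coefficient of \<open>(0, 0)\<close> survives,
  and it is the integral.\<close>

lemma generic_equidistribution:
  assumes a: "smooth_torus a" and j: "\<And>n. n > 0 \<Longrightarrow> j n \<in> generic n"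
  shows "(\<lambda>n. qinner (e n (j n)) (weyl_op (2 * n) a *\<^sub>v e n (j n))) \<longlonglongrightarrow> torus_integral a"
proof -
  let ?c = "\<lambda>i. fourier_coeff a (lattice_enum i)"
  let ?t = "\<lambda>i n. ?c i * qinner (e n (j n)) (translation (2 * n) (lattice_enum i) *\<^sub>v e n (j n))"
  have r: "j n \<in> {1..2 * n}" if "n > 0" for n using j[OF that] by (simp add: generic_def)
  have sc: "summable (\<lambda>i. cmod (?c i))"
    by (rule fourier_coeff_enum_summable[OF a])
  have lim: "(\<lambda>n. ?t i n) \<longlonglongrightarrow> ?c i * (if lattice_enum i = (0, 0) then 1 else 0)" for i
    by (intro tendsto_mult tendsto_const generic_translation j)
  \<comment> \<open>For \<open>n = 0\<close> nothing is known about \<open>j n\<close>, so the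
    majorant is claimed only for positive \<open>n\<close>.\<close>
  have "eventually (\<lambda>(i :: nat, n :: nat). n > 0) (sequentially \<times>\<^sub>F sequentially)"
    using eventually_gt_at_top[of 0] by (subst eventually_prod2) auto
  then have bound: "eventually (\<lambda>(i, n). norm (?t i n) \<le> cmod (?c i)) (sequentially \<times>\<^sub>F sequentially)"
  proof (rule eventually_mono)
    fix x :: "nat \<times> nat" assume x: "case x of (i, n) \<Rightarrow> n > 0"
    obtain i n where i: "x = (i, n)" by fastforce
    then show "case x of (i, n) \<Rightarrow> norm (?t i n) \<le> cmod (?c i)"
      using qinner_translation_bound[OF r, of n "lattice_enum i"] x by (simp add: norm_mult mult_left_le)
  qed
  have "(\<lambda>n. \<Sum>i. ?t i n) \<longlonglongrightarrow> (\<Sum>i. ?c i * (if lattice_enum i = (0, 0) then 1 else 0))"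
    by (rule tannerys_theorem[THEN conjunct2, THEN conjunct2, OF lim bound sc]) simp
  also have "(\<Sum>i. ?c i * (if lattice_enum i = (0, 0) then 1 else 0)) = torus_integral a"
  proof -
    obtain i0 where i0: "lattice_enum i0 = (0, 0)" using bij_lattice_enum by (metis bij_pointE)
    have "lattice_enum i = (0, 0) \<longleftrightarrow> i = i0" for i
      using bij_lattice_enum i0 by (metis bij_def inj_eq)
    then have "(\<lambda>i. ?c i * (if lattice_enum i = (0, 0) then 1 else 0)) = (\<lambda>i. if i = i0 then ?c i else 0)" by auto
    moreover have "(\<Sum>i. if i = i0 then ?c i else 0) = ?c i0" using sums_single[of i0 ?c] by (simp add: sums_iff)
    ultimately show ?thesis by (simp add: i0 fourier_coeff_0)
  qed
  finally have "(\<lambda>n. \<Sum>i. ?t i n) \<longlonglongrightarrow> torus_integral a" .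
  moreover have "\<forall>\<^sub>F n in sequentially. (\<Sum>i. ?t i n) = qinner (e n (j n)) (weyl_op (2 * n) a *\<^sub>v e n (j n))"
    using eventually_gt_at_top[of 0]
    by eventually_elim (rule sums_unique[OF weyl_op_sums[OF a r], symmetric])
  ultimately show ?thesis by (rule Lim_transform_eventually)
qed

end

lemma tendsto_even_at_top:
  assumes "((\<lambda>n. g (2 * n)) \<longlongrightarrow> L) sequentially"
  shows "(g \<longlongrightarrow> L) even_at_top"
  unfolding tendsto_def
proof (intro allI impI)
  fix S assume "open S" "L \<in> S"
  then have "\<forall>\<^sub>F n in sequentially. g (2 * n) \<in> S" using assms by (auto simp: tendsto_def)
  then obtain m where m: "\<And>n. n \<ge> m \<Longrightarrow> g (2 * n) \<in> S" by (auto simp: eventually_sequentially)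
  have "g N \<in> S" if "N \<ge> 2 * m" "even N" for N
    using m[of "N div 2"] that by auto
  then show "\<forall>\<^sub>F N in even_at_top. g N \<in> S"
    unfolding even_at_top_def eventually_inf_principal eventually_sequentially by blast
qed

theorem corollary1p2:
  fixes \<phi> :: "nat \<Rightarrow> nat \<Rightarrow> complex vec"
  assumes "\<And>N. even N \<Longrightarrow> N \<ge> 2 \<Longrightarrow> orthonormal_basis N (\<phi> N)"
    and "\<And>N j. even N \<Longrightarrow> N \<ge> 2 \<Longrightarrow> j \<in> {1..N} \<Longrightarrow> \<exists>l. eigenvector (baker N) (\<phi> N j) l"
  shows "\<exists>J :: nat \<Rightarrow> nat set.
    (\<forall>N. even N \<and> N \<ge> 2 \<longrightarrow> J N \<subseteq> {1..N} \<and> J N \<noteq> {}) \<and>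
    ((\<lambda>N. real (card (J N)) / real N) \<longlongrightarrow> 1) even_at_top \<and>
    (\<forall>a. smooth_torus a \<longrightarrow>
      (\<forall>j :: nat \<Rightarrow> nat. (\<forall>N. even N \<and> N \<ge> 2 \<longrightarrow> j N \<in> J N) \<longrightarrow>
        ((\<lambda>N. qinner (\<phi> N (j N)) (weyl_op N a *\<^sub>v \<phi> N (j N)))
           \<longlongrightarrow> torus_integral a) even_at_top))"
proof -
  interpret quantum_eigenbases "\<lambda>n. \<phi> (2 * n)"
  proof
    fix n j :: nat assume j: "j \<in> {1..2 * n}"
    \<comment> \<open>The mere existence of an index \<open>j\<close> excludes dimension 0, so the
      hypotheses on even dimensions from 2 on suffice for every \<open>n\<close>.\<close>
    then have n: "2 * n \<ge> 2" by auto
    obtain l where l: "eigenvector (baker (2 * n)) (\<phi> (2 * n) j) l" using assms(2)[OF _ n j] by auto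
    then show "\<phi> (2 * n) j \<in> carrier_vec (2 * n)"
      using unitary_carrier[OF baker_map_unitary[of n]] by (simp add: eigenvector_def baker_eq)
    show "\<exists>l. baker_map n *\<^sub>v \<phi> (2 * n) j = l \<cdot>\<^sub>v \<phi> (2 * n) j"
      using l by (auto simp: eigenvector_def baker_eq)
    fix i assume "i \<in> {1..2 * n}"
    then show "qinner (\<phi> (2 * n) i) (\<phi> (2 * n) j) = (if i = j then 1 else 0)"
      using assms(1)[OF _ n] j by (simp add: orthonormal_basis_def)
  qed
  define J where "J N = generic (N div 2)" for N
  have "J N \<subseteq> {1..N} \<and> J N \<noteq> {}" if "even N" "N \<ge> 2" for N
    using generic_nonempty[of "N div 2"] that by (auto simp: J_def generic_def)
  moreover have "((\<lambda>N. real (card (J N)) / real N) \<longlongrightarrow> 1) even_at_top"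
    using generic_density by (intro tendsto_even_at_top) (simp add: J_def)
  moreover have "((\<lambda>N. qinner (\<phi> N (j N)) (weyl_op N a *\<^sub>v \<phi> N (j N))) \<longlongrightarrow> torus_integral a) even_at_top"
    if a: "smooth_torus a" and j: "\<forall>N. even N \<and> N \<ge> 2 \<longrightarrow> j N \<in> J N" for a j
  proof (rule tendsto_even_at_top)
    have "j (2 * n) \<in> generic n" if "n > 0" for n
      using j[rule_format, of "2 * n"] that by (simp add: J_def)
    then show "(\<lambda>n. qinner (\<phi> (2 * n) (j (2 * n))) (weyl_op (2 * n) a *\<^sub>v \<phi> (2 * n) (j (2 * n)))) \<longlonglongrightarrow> torus_integral a"
      using generic_equidistribution[OF a, of "\<lambda>n. j (2 * n)"] by simp
  qed
  ultimately show ?thesis by blast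
qed

end
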